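(* Let $G$ be a second countable connected compact nonabelian group. Then there exists a subset $\mathcal{O}\subset G\times G$, which is both of second Baire category in $G\times G$ and of full Haar measure in $G\times G$, such that for every pair $(a,b)\in\mathcal{O}$ the subgroup generated by $a$ and $b$ is a dense free subgroup of $G$.
   Context: Topological groups are assumed to be Hausdorff. A free group means a nonabelian free group, i.e. a free group on at least two generators (so here the subgroup generated by $a,b$ is free of rank $2$). Full Haar measure means that the complement has measure zero for the Haar measure of $G\times G$. *)

theory Defs
  imports "HOL-Analysis.Analysis" "HOL-Algebra.Generated_Groups"
begin

text \<open>Topological groups are Hausdorff by convention.\<close>

locale topological_group = group G for G :: "('a, 'b) monoid_scheme" (structure) +
  fixes T :: "'a topology"
  assumes topspace_eq: "topspace T = carrier G"
    and continuous_mult: "continuous_map (prod_topology T T) T (\<lambda>(x, y). x \<otimes> y)"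
    and continuous_inv: "continuous_map T T (\<lambda>x. inv x)"
    and Hausdorff: "Hausdorff_space T"


definition nowhere_dense_in :: "'a topology \<Rightarrow> 'a set \<Rightarrow> bool" where
  "nowhere_dense_in X A \<longleftrightarrow>
     A \<subseteq> topspace X \<and> X interior_of (Abstract_Topology.closure_of X A) = {}"

definition first_category_in :: "'a topology \<Rightarrow> 'a set \<Rightarrow> bool" where
  "first_category_in X A \<longleftrightarrow>
     (\<exists>\<N>. countable \<N> \<and> (\<forall>N\<in>\<N>. nowhere_dense_in X N) \<and> A = \<Union>\<N>)"

definition second_category_in :: "'a topology \<Rightarrow> 'a set \<Rightarrow> bool" where
  "second_category_in X A \<longleftrightarrow> A \<subseteq> topspace X \<and> \<not> first_category_in X A"


text \<open>A left Haar measure: a nonzero left invariant Radon measure on the Borel sets.  The measure is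
  determined only up to a positive factor, which does not affect null sets.\<close>

definition haar_measure ::
    "('a, 'b) monoid_scheme \<Rightarrow> 'a topology \<Rightarrow> 'a measure \<Rightarrow> bool" where
  "haar_measure G T \<mu> \<longleftrightarrow>
     sets \<mu> = sigma_sets (topspace T) {U. openin T U} \<and>
     emeasure \<mu> (space \<mu>) \<noteq> 0 \<and>
     (\<forall>g\<in>carrier G. \<forall>A\<in>sets \<mu>. emeasure \<mu> (g <#\<^bsub>G\<^esub> A) = emeasure \<mu> A) \<and>
     (\<forall>K. compactin T K \<longrightarrow> emeasure \<mu> K < \<infinity>) \<and>
     (\<forall>A\<in>sets \<mu>. emeasure \<mu> A = (INF U\<in>{U. openin T U \<and> A \<subseteq> U}. emeasure \<mu> U)) \<and>
     (\<forall>U. openin T U \<longrightarrow>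
        emeasure \<mu> U = (SUP K\<in>{K. compactin T K \<and> K \<subseteq> U}. emeasure \<mu> K))"

text \<open>The completion is used because the complement need not be a Borel set.\<close>

definition full_measure :: "'a measure \<Rightarrow> 'a set \<Rightarrow> bool" where
  "full_measure \<mu> A \<longleftrightarrow> A \<subseteq> space \<mu> \<and> space \<mu> - A \<in> null_sets (completion \<mu>)"


text \<open>A word is a list of letters; \<open>(x, True)\<close> stands for \<open>x\<close> and \<open>(x, False)\<close> for its formal
  inverse.\<close>

definition reduced_word :: "('a \<times> bool) list \<Rightarrow> bool" where
  "reduced_word w \<longleftrightarrow> successively (\<lambda>(x, e) (y, f). \<not> (x = y \<and> e \<noteq> f)) w"

definition word_value :: "('a, 'b) monoid_scheme \<Rightarrow> ('a \<times> bool) list \<Rightarrow> 'a" where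
  "word_value G w =
     foldr (\<lambda>(x, e) g. (if e then x else inv\<^bsub>G\<^esub> x) \<otimes>\<^bsub>G\<^esub> g) w \<one>\<^bsub>G\<^esub>"

definition free_basis :: "('a, 'b) monoid_scheme \<Rightarrow> 'a set \<Rightarrow> bool" where
  "free_basis G S \<longleftrightarrow>
     S \<subseteq> carrier G \<and> generate G S = carrier G \<and>
     (\<forall>w. fst ` set w \<subseteq> S \<and> reduced_word w \<and> w \<noteq> [] \<longrightarrow> word_value G w \<noteq> \<one>\<^bsub>G\<^esub>)"

definition free_group_of_rank :: "('a, 'b) monoid_scheme \<Rightarrow> nat \<Rightarrow> bool" where
  "free_group_of_rank G n \<longleftrightarrow> group G \<and> (\<exists>S. free_basis G S \<and> finite S \<and> card S = n)"

end

theory Submission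
  imports Defs "HOL-Library.Function_Algebras" "HOL-Complex_Analysis.Great_Picard"
    "Jordan_Normal_Form.Determinant"
begin

text \<open>Eigenspaces of convolution operators with countably many symmetric bump functions give countably many
  finite-dimensional orthogonal representations which separate points and detect, by a nonzero common
  fixed vector, each pair generating a nondense subgroup.  Having a common fixed vector in one of them,
  or satisfying one given word equation there, is the vanishing of a function on \<open>G \<times> G\<close> whose translates
  span a finite-dimensional space.  On a compact connected group the zero set of such a function is null
  unless the function vanishes identically, so it suffices to find a single good pair in each case.

  A good pair for density comes from minimizing dimensions of fixed spaces: tangent directions of a
  compact connected group of unitary matrices already determine its fixed vectors.  A good pair for a
  word comes from noncommutativity: the complexified tangent space then contains a nonzero nilpotent
  \<open>E\<close>; if the word were a law it would hold, by polynomial continuation, for \<open>exp (s E)\<close> and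
  \<open>exp (s E\<^sup>*)\<close>, but there its leading term as \<open>s\<close> tends to infinity does not vanish.  The bad pairs thus
  form a countable union of closed null sets, and Baire's theorem applies to its complement.\<close>

section \<open>Finite complex matrices of arbitrary size\<close>

text \<open>A general compact group carries no differentiable structure, so every infinitesimal
  argument takes place in a compact group of unitary matrices and uses only limits of difference
  quotients at the unit. Integration from tangent vectors back to the group is replaced by one
  principle: a subadditive function on the group that is small to first order at the unit vanishes.
  For words, the nilpotent \<open>E\<close> cannot lie in the real tangent algebra, since a nonzero
  skew matrix is never nilpotent. Complexifying is harmless because a law is a polynomial identity
  in a matrix and its inverse, and nilpotency turns the exponential into a polynomial, for which
  vanishing derivatives at 0 suffice. For density, the constants are fixed by every subgroup, so
  only eigenfunctions of mean zero are used. Measure and category have one source: nonempty open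
  sets have positive measure, hence closed null sets are nowhere dense.\<close>

typedef fmat = "{f :: nat \<Rightarrow> nat \<Rightarrow> complex. \<exists>n. \<forall>i j. f i j \<noteq> 0 \<longrightarrow> i < n \<and> j < n}"
  morphisms ent Abs_fmat
  by (rule exI[of _ "\<lambda>_ _. 0"]) auto

setup_lifting type_definition_fmat

text \<open>Support in the upper left \<open>n\<close> by \<open>n\<close> block. The size is a
  predicate and not a type parameter because the dimension of a representation is known only inside
  a proof. Accordingly the type has no unit; \<open>Idm n\<close> is the unit of a block.\<close>

definition bnd :: "nat \<Rightarrow> fmat \<Rightarrow> bool" where
  "bnd n A \<longleftrightarrow> (\<forall>i j. ent A i j \<noteq> 0 \<longrightarrow> i < n \<and> j < n)"

lemma fmat_eqI: "(\<And>i j. ent A i j = ent B i j) \<Longrightarrow> A = B"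
  by (simp add: ent_inject[symmetric] fun_eq_iff)

lemma ex_bnd: "\<exists>n. bnd n A"
  using ent[of A] by (auto simp: bnd_def)

lemma bnd_mono: "bnd m A \<Longrightarrow> m \<le> n \<Longrightarrow> bnd n A"
  unfolding bnd_def by (meson order_less_le_trans)

lemma ex_bnd2: "\<exists>n. bnd n A \<and> bnd n B"
proof -
  obtain k l where "bnd k A" "bnd l B" using ex_bnd by metis
  then show ?thesis by (meson bnd_mono max.cobounded1 max.cobounded2)
qed

lemma ex_bnd3: "\<exists>n. bnd n A \<and> bnd n B \<and> bnd n C"
proof -
  obtain k l where "bnd k A \<and> bnd k B" "bnd l C" using ex_bnd ex_bnd2 by metis
  then show ?thesis by (meson bnd_mono max.cobounded1 max.cobounded2)
qed

lemma bndD: "bnd n A \<Longrightarrow> \<not> (i < n \<and> j < n) \<Longrightarrow> ent A i j = 0"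
  by (auto simp: bnd_def)

lemma bndI: "(\<And>i j. \<not> (i < n \<and> j < n) \<Longrightarrow> ent A i j = 0) \<Longrightarrow> bnd n A"
  by (auto simp: bnd_def)

instantiation fmat :: real_vector
begin

lift_definition zero_fmat :: fmat is "\<lambda>_ _. 0" by simp
lift_definition plus_fmat :: "fmat \<Rightarrow> fmat \<Rightarrow> fmat" is "\<lambda>f g i j. f i j + g i j"
proof -
  fix f g :: "nat \<Rightarrow> nat \<Rightarrow> complex"
  assume "\<exists>n. \<forall>i j. f i j \<noteq> 0 \<longrightarrow> i < n \<and> j < n" "\<exists>n. \<forall>i j. g i j \<noteq> 0 \<longrightarrow> i < n \<and> j < n"
  then obtain m n where "\<forall>i j. f i j \<noteq> 0 \<longrightarrow> i < m \<and> j < m" "\<forall>i j. g i j \<noteq> 0 \<longrightarrow> i < n \<and> j < n"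
    by auto
  then have "\<forall>i j. f i j + g i j \<noteq> 0 \<longrightarrow> i < max m n \<and> j < max m n"
    by (metis add.right_neutral add_cancel_right_left less_max_iff_disj)
  then show "\<exists>n. \<forall>i j. f i j + g i j \<noteq> 0 \<longrightarrow> i < n \<and> j < n" by blast
qed
lift_definition uminus_fmat :: "fmat \<Rightarrow> fmat" is "\<lambda>f i j. - f i j" by simp
lift_definition scaleR_fmat :: "real \<Rightarrow> fmat \<Rightarrow> fmat" is "\<lambda>r f i j. r *\<^sub>R f i j" by auto
definition minus_fmat :: "fmat \<Rightarrow> fmat \<Rightarrow> fmat" where "minus_fmat A B = A + - B"

instance
proof
  fix a b c :: fmat and r s :: real
  show "a + b + c = a + (b + c)" by (rule fmat_eqI, simp add: plus_fmat.rep_eq)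
  show "a + b = b + a" by (rule fmat_eqI, simp add: plus_fmat.rep_eq)
  show "0 + a = a" by (rule fmat_eqI, simp add: plus_fmat.rep_eq zero_fmat.rep_eq)
  show "- a + a = 0" by (rule fmat_eqI, simp add: plus_fmat.rep_eq zero_fmat.rep_eq uminus_fmat.rep_eq)
  show "a - b = a + - b" by (simp add: minus_fmat_def)
  show "r *\<^sub>R (a + b) = r *\<^sub>R a + r *\<^sub>R b" "(r + s) *\<^sub>R a = r *\<^sub>R a + s *\<^sub>R a"
   by (rule fmat_eqI, simp add: plus_fmat.rep_eq scaleR_fmat.rep_eq scaleR_add_left scaleR_add_right)+
  show "r *\<^sub>R s *\<^sub>R a = (r * s) *\<^sub>R a" "1 *\<^sub>R a = a"
   by (rule fmat_eqI, simp add: scaleR_fmat.rep_eq)+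
qed

end

lemma ent_simps [simp]:
  shows "ent 0 i j = 0" "ent (A + B) i j = ent A i j + ent B i j" "ent (- A) i j = - ent A i j"
    and "ent (r *\<^sub>R A) i j = of_real r * ent A i j"
  by (simp_all add: plus_fmat.rep_eq zero_fmat.rep_eq uminus_fmat.rep_eq scaleR_fmat.rep_eq
      scaleR_conv_of_real)

lemma ent_minus [simp]: "ent (A - B) i j = ent A i j - ent B i j"
  unfolding minus_fmat_def ent_simps by simp

lemma bnd_zero: "bnd n 0"
  by (simp add: bnd_def)

lemma bnd_plus: "bnd n A \<Longrightarrow> bnd n B \<Longrightarrow> bnd n (A + B)"
  by (rule bndI) (simp add: bndD[of n])

lemma bnd_uminus: "bnd n A \<Longrightarrow> bnd n (- A)"
  by (simp add: bnd_def)

lemma bnd_minus: "bnd n A \<Longrightarrow> bnd n B \<Longrightarrow> bnd n (A - B)"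
  by (rule bndI) (simp add: bndD[of n])

lemma bnd_scaleR: "bnd n A \<Longrightarrow> bnd n (r *\<^sub>R A)"
  by (rule bndI) (simp add: bndD[of n])

lemmas bnd_simps = bnd_zero bnd_plus bnd_uminus bnd_minus bnd_scaleR

text \<open>Complex scalars act through a separate operation: the class instance is over the reals,
  so that real tangent spaces are subspaces in the sense of the type class.\<close>

lift_definition cs :: "complex \<Rightarrow> fmat \<Rightarrow> fmat" is "\<lambda>c f i j. c * f i j" by auto
lift_definition adj :: "fmat \<Rightarrow> fmat" is "\<lambda>f i j. cnj (f j i)" by auto

lemma ent_cs [simp]: "ent (cs c A) i j = c * ent A i j" by (simp add: cs.rep_eq)
lemma ent_adj [simp]: "ent (adj A) i j = cnj (ent A j i)" by (simp add: adj.rep_eq)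

instantiation fmat :: times
begin
text \<open>The condition \<open>f i k \<noteq> 0\<close> makes the index set finite without naming
  a dimension; \<open>ent_times\<close> replaces it by any block bound.\<close>

lift_definition times_fmat :: "fmat \<Rightarrow> fmat \<Rightarrow> fmat"
  is "\<lambda>f g i j. \<Sum>k | f i k \<noteq> 0. f i k * g k j"
proof -
  fix f g :: "nat \<Rightarrow> nat \<Rightarrow> complex"
  assume "\<exists>n. \<forall>i j. f i j \<noteq> 0 \<longrightarrow> i < n \<and> j < n" "\<exists>n. \<forall>i j. g i j \<noteq> 0 \<longrightarrow> i < n \<and> j < n"
  then obtain m n where f: "\<forall>i j. f i j \<noteq> 0 \<longrightarrow> i < m \<and> j < m"
    and g: "\<forall>i j. g i j \<noteq> 0 \<longrightarrow> i < n \<and> j < n"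
    by auto
  have "i < max m n \<and> j < max m n" if "(\<Sum>k | f i k \<noteq> 0. f i k * g k j) \<noteq> 0" for i j
  proof -
    from that obtain k where "f i k * g k j \<noteq> 0" by (meson sum.neutral)
    then show ?thesis using f g by fastforce
  qed
  then show "\<exists>n. \<forall>i j. (\<Sum>k | f i k \<noteq> 0. f i k * g k j) \<noteq> 0 \<longrightarrow> i < n \<and> j < n" by blast
qed
instance ..
end

lemma ent_times: "bnd n A \<Longrightarrow> ent (A * B) i j = (\<Sum>k<n. ent A i k * ent B k j)"
  unfolding times_fmat.rep_eq
  by (rule sum.mono_neutral_left) (auto simp: bnd_def)

lemma bnd_times: "bnd n A \<Longrightarrow> bnd n B \<Longrightarrow> bnd n (A * B)"
proof -
  assume A: "bnd n A" and B: "bnd n B"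
  show "bnd n (A * B)"
    unfolding bnd_def
  proof (intro allI impI)
    fix i j assume "ent (A * B) i j \<noteq> 0"
    then obtain k where "ent A i k * ent B k j \<noteq> 0"
      unfolding ent_times[OF A] by (meson sum.neutral)
    then show "i < n \<and> j < n" using A B by (auto simp: bnd_def)
  qed
qed

lemma bnd_cs: "bnd n A \<Longrightarrow> bnd n (cs c A)" and bnd_adj: "bnd n A \<Longrightarrow> bnd n (adj A)"
  by (auto simp: bnd_def)

instance fmat :: real_algebra
proof
  fix A B C :: fmat and r :: real
  obtain n where n: "bnd n A" "bnd n B" "bnd n C" using ex_bnd3 by blast
  show "A * B * C = A * (B * C)"
  proof (rule fmat_eqI)
    fix i j
    have "ent (A * B * C) i j = (\<Sum>l<n. \<Sum>k<n. ent A i k * ent B k l * ent C l j)"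
      using n by (simp add: ent_times[where n = n] bnd_times sum_distrib_right)
    also have "\<dots> = (\<Sum>k<n. \<Sum>l<n. ent A i k * ent B k l * ent C l j)" by (rule sum.swap)
    also have "\<dots> = ent (A * (B * C)) i j"
      using n by (simp add: ent_times[where n = n] bnd_times sum_distrib_left mult.assoc)
    finally show "ent (A * B * C) i j = ent (A * (B * C)) i j" .
  qed
  show "(A + B) * C = A * C + B * C"
    using n by (intro fmat_eqI) (simp add: ent_times[where n = n] bnd_simps sum.distrib distrib_right)
  show "A * (B + C) = A * B + A * C"
    using n by (intro fmat_eqI) (simp add: ent_times[where n = n] sum.distrib distrib_left)
  show "r *\<^sub>R A * B = r *\<^sub>R (A * B)"
    using n by (intro fmat_eqI) (simp add: ent_times[where n = n] bnd_simps sum_distrib_left mult.assoc)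
  show "A * r *\<^sub>R B = r *\<^sub>R (A * B)"
    using n by (intro fmat_eqI)
      (simp add: ent_times[where n = n] sum_distrib_left mult.left_commute)
qed

section \<open>The Frobenius inner product and norm\<close>

instantiation fmat :: real_inner
begin
definition inner_fmat :: "fmat \<Rightarrow> fmat \<Rightarrow> real" where
  "inner_fmat A B = (\<Sum>(i, j) | ent A i j \<noteq> 0. Re (ent A i j * cnj (ent B i j)))"
definition norm_fmat :: "fmat \<Rightarrow> real" where "norm_fmat A = sqrt (inner A A)"
definition dist_fmat :: "fmat \<Rightarrow> fmat \<Rightarrow> real" where "dist_fmat A B = norm (A - B)"
definition sgn_fmat :: "fmat \<Rightarrow> fmat" where "sgn_fmat A = inverse (norm A) *\<^sub>R A"
definition uniformity_fmat :: "(fmat \<times> fmat) filter" where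
  "uniformity_fmat = (INF e\<in>{0 <..}. principal {(x, y). dist x y < e})"
definition open_fmat :: "fmat set \<Rightarrow> bool" where
  "open_fmat U \<longleftrightarrow> (\<forall>x\<in>U. \<forall>\<^sub>F (x', y) in uniformity. x' = x \<longrightarrow> y \<in> U)"

lemma inner_fmat_eq:
  assumes "bnd n A"
  shows "inner A B = (\<Sum>i<n. \<Sum>j<n. Re (ent A i j * cnj (ent B i j)))"
proof -
  have "inner A B = (\<Sum>(i, j)\<in>{..<n} \<times> {..<n}. Re (ent A i j * cnj (ent B i j)))"
    unfolding inner_fmat_def
    by (rule sum.mono_neutral_left) (use assms in \<open>auto simp: bnd_def\<close>)
  then show ?thesis by (simp add: sum.cartesian_product)
qed

instance
proof
  fix A B C :: fmat and r :: real
  obtain n where n: "bnd n A" "bnd n B" "bnd n C" using ex_bnd3 by blast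
  show "inner A B = inner B A"
    using n by (simp add: inner_fmat_eq[where n = n] mult.commute)
  show "inner (A + B) C = inner A C + inner B C"
    using n by (simp add: inner_fmat_eq[where n = n] bnd_simps sum.distrib distrib_right)
  show "inner (r *\<^sub>R A) B = r * inner A B"
    using n by (simp add: inner_fmat_eq[where n = n] bnd_simps sum_distrib_left right_diff_distrib distrib_left mult.assoc)
  have eq: "inner A A = (\<Sum>i<n. \<Sum>j<n. (cmod (ent A i j))\<^sup>2)"
    using n by (simp only: inner_fmat_eq[where n = n]) (simp add: cmod_power2, simp add: power2_eq_square)
  show "0 \<le> inner A A" unfolding eq by (intro sum_nonneg) auto
  have "A = 0" if "inner A A = 0"
  proof (rule fmat_eqI)
    fix i j
    have "(cmod (ent A i j))\<^sup>2 = 0" if "i < n" "j < n"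
    proof -
      have "(\<Sum>j<n. (cmod (ent A i j))\<^sup>2) = 0"
        using \<open>inner A A = 0\<close> that unfolding eq by (subst (asm) sum_nonneg_eq_0_iff) (auto intro: sum_nonneg)
      then show ?thesis using that by (subst (asm) sum_nonneg_eq_0_iff) auto
    qed
    then show "ent A i j = ent 0 i j" using n(1) by (auto simp: bnd_def)
  qed
  then show "(inner A A = 0) = (A = 0)" by (auto simp: inner_fmat_def)
qed (simp_all add: norm_fmat_def dist_fmat_def sgn_fmat_def uniformity_fmat_def open_fmat_def)

end

lemma norm_fmat_eq:
  assumes "bnd n A"
  shows "(norm A)\<^sup>2 = (\<Sum>i<n. \<Sum>j<n. (cmod (ent A i j))\<^sup>2)"
proof -
  have "(norm A)\<^sup>2 = inner A A" by (simp add: dot_square_norm)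
  then show ?thesis
    unfolding inner_fmat_eq[OF assms] by (simp add: cmod_power2) (simp add: power2_eq_square)
qed

instance fmat :: real_normed_algebra
proof
  fix A B :: fmat
  obtain n where n: "bnd n A" "bnd n B" using ex_bnd2 by blast
  have "(norm (A * B))\<^sup>2 = (\<Sum>i<n. \<Sum>j<n. (cmod (\<Sum>k<n. ent A i k * ent B k j))\<^sup>2)"
    using n by (simp add: norm_fmat_eq[where n = n] bnd_times ent_times[where n = n])
  also have "\<dots> \<le> (\<Sum>i<n. \<Sum>j<n. (\<Sum>k<n. (cmod (ent A i k))\<^sup>2) * (\<Sum>k<n. (cmod (ent B k j))\<^sup>2))"
  proof (intro sum_mono)
    fix i j
    have "cmod (\<Sum>k<n. ent A i k * ent B k j) \<le> (\<Sum>k<n. cmod (ent A i k) * cmod (ent B k j))"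
      by (rule order_trans[OF norm_sum]) (simp add: norm_mult)
    then have "(cmod (\<Sum>k<n. ent A i k * ent B k j))\<^sup>2 \<le> (\<Sum>k<n. cmod (ent A i k) * cmod (ent B k j))\<^sup>2"
      by (intro power_mono) auto
    also have "\<dots> \<le> (\<Sum>k<n. (cmod (ent A i k))\<^sup>2) * (\<Sum>k<n. (cmod (ent B k j))\<^sup>2)"
      by (rule Cauchy_Schwarz_ineq_sum)
    finally show "(cmod (\<Sum>k<n. ent A i k * ent B k j))\<^sup>2 \<le> \<dots>" .
  qed
  also have "\<dots> = (\<Sum>i<n. \<Sum>k<n. (cmod (ent A i k))\<^sup>2) * (\<Sum>j<n. \<Sum>k<n. (cmod (ent B k j))\<^sup>2)"
    by (simp add: sum_product)
  also have "(\<Sum>j<n. \<Sum>k<n. (cmod (ent B k j))\<^sup>2) = (\<Sum>k<n. \<Sum>j<n. (cmod (ent B k j))\<^sup>2)"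
    by (rule sum.swap)
  also have "(\<Sum>i<n. \<Sum>k<n. (cmod (ent A i k))\<^sup>2) * \<dots> = (norm A * norm B)\<^sup>2"
    using n by (simp add: norm_fmat_eq[where n = n] power_mult_distrib)
  finally show "norm (A * B) \<le> norm A * norm B"
    by (rule power2_le_imp_le) simp
qed

lemma norm_ent_le: "cmod (ent A i j) \<le> norm A"
proof -
  obtain n where n: "bnd n A" using ex_bnd by blast
  show ?thesis
  proof (cases "i < n \<and> j < n")
    case True
    have "(cmod (ent A i j))\<^sup>2 \<le> (\<Sum>j<n. (cmod (ent A i j))\<^sup>2)"
      by (rule member_le_sum) (use True in auto)
    also have "\<dots> \<le> (\<Sum>i<n. \<Sum>j<n. (cmod (ent A i j))\<^sup>2)"
      by (rule member_le_sum[where f = "\<lambda>i. \<Sum>j<n. (cmod (ent A i j))\<^sup>2"])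
        (use True in \<open>auto intro: sum_nonneg\<close>)
    also have "\<dots> = (norm A)\<^sup>2" using n by (simp add: norm_fmat_eq[where n = n])
    finally show ?thesis by (rule power2_le_imp_le) simp
  next
    case False
    then show ?thesis using bndD[OF n] by simp
  qed
qed

lemma adj_simps [simp]:
  "adj (adj A) = A" "adj 0 = 0" "adj (A + B) = adj A + adj B" "adj (A - B) = adj A - adj B"
  "adj (- A) = - adj A" "adj (r *\<^sub>R A) = r *\<^sub>R adj A" "adj (cs c A) = cs (cnj c) (adj A)"
  by (auto intro!: fmat_eqI)

lemma adj_mult [simp]: "adj (A * B) = adj B * adj A"
proof -
  obtain n where n: "bnd n A" "bnd n B" using ex_bnd2 by blast
  then show ?thesis
    by (auto intro!: fmat_eqI simp: ent_times[where n = n] bnd_adj mult.commute)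
qed

lemma cs_simps:
  "cs c (A + B) = cs c A + cs c B" "cs c (A - B) = cs c A - cs c B" "cs (c + d) A = cs c A + cs d A"
  "cs c (cs d A) = cs (c * d) A" "cs 1 A = A" "cs 0 A = 0" "cs c 0 = 0" "cs c (- A) = - cs c A"
  "cs c (r *\<^sub>R A) = r *\<^sub>R cs c A" "cs (- c) A = - cs c A" "cs (of_real r) A = r *\<^sub>R A"
  by (auto intro!: fmat_eqI simp: algebra_simps)

lemma cs_mult: "cs c A * B = cs c (A * B)" "A * cs c B = cs c (A * B)"
proof -
  obtain n where n: "bnd n A" "bnd n B" using ex_bnd2 by blast
  then show "cs c A * B = cs c (A * B)" "A * cs c B = cs c (A * B)"
    by (auto intro!: fmat_eqI simp: ent_times[where n = n] bnd_cs sum_distrib_left mult.assoc mult.left_commute)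
qed

lemma norm_adj [simp]: "norm (adj A) = norm A"
proof -
  obtain n where n: "bnd n A" using ex_bnd by blast
  have "(norm (adj A))\<^sup>2 = (norm A)\<^sup>2"
    unfolding norm_fmat_eq[OF n] norm_fmat_eq[OF bnd_adj[OF n]] by simp (rule sum.swap)
  then show ?thesis by simp
qed

lemma norm_cs [simp]: "norm (cs c A) = cmod c * norm A"
proof -
  obtain n where n: "bnd n A" using ex_bnd by blast
  have "(norm (cs c A))\<^sup>2 = (cmod c * norm A)\<^sup>2"
    using n by (simp add: norm_fmat_eq[where n = n] bnd_cs norm_mult power_mult_distrib sum_distrib_left)
  then show ?thesis by simp
qed

lemma inner_mult_left: "inner (A * B) C = inner B (adj A * C)"
proof -
  obtain n where n: "bnd n A" "bnd n B" "bnd n C" using ex_bnd3 by blast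
  have "inner (A * B) C = Re (\<Sum>i<n. \<Sum>j<n. \<Sum>k<n. ent A i k * ent B k j * cnj (ent C i j))"
    using n by (simp add: inner_fmat_eq[where n = n] bnd_times ent_times[where n = n] sum_distrib_right)
  also have "(\<Sum>i<n. \<Sum>j<n. \<Sum>k<n. ent A i k * ent B k j * cnj (ent C i j))
      = (\<Sum>i<n. \<Sum>k<n. \<Sum>j<n. ent A i k * ent B k j * cnj (ent C i j))"
    by (intro sum.cong refl sum.swap)
  also have "\<dots> = (\<Sum>k<n. \<Sum>i<n. \<Sum>j<n. ent A i k * ent B k j * cnj (ent C i j))"
    by (rule sum.swap)
  also have "\<dots> = (\<Sum>k<n. \<Sum>j<n. \<Sum>i<n. ent A i k * ent B k j * cnj (ent C i j))"
    by (intro sum.cong refl sum.swap)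
  also have "Re \<dots> = inner B (adj A * C)"
    using n by (simp add: inner_fmat_eq[where n = n] bnd_times bnd_adj ent_times[where n = n] sum_distrib_left mult_ac)
  finally show ?thesis .
qed

lemma inner_adj: "inner (adj A) (adj B) = inner A B"
proof -
  obtain n where n: "bnd n A" using ex_bnd by blast
  show ?thesis
    unfolding inner_fmat_eq[OF n] inner_fmat_eq[OF bnd_adj[OF n]]
    by (subst sum.swap) (simp add: algebra_simps)
qed

lemma inner_mult_right: "inner (A * B) C = inner A (C * adj B)"
  using inner_mult_left[of "adj B" "adj A" "adj C"] by (metis adj_mult adj_simps(1) inner_adj)

lemma bounded_linear_adj: "bounded_linear adj"
  by (rule bounded_linear_intro[where K = 1]) auto

lemmas tendsto_adj [tendsto_intros] = bounded_linear.tendsto[OF bounded_linear_adj]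

definition Mat :: "nat \<Rightarrow> (nat \<Rightarrow> nat \<Rightarrow> complex) \<Rightarrow> fmat" where
  "Mat n f = Abs_fmat (\<lambda>i j. if i < n \<and> j < n then f i j else 0)"

lemma ent_Mat [simp]: "ent (Mat n f) i j = (if i < n \<and> j < n then f i j else 0)"
  unfolding Mat_def by (subst Abs_fmat_inverse) auto

lemma bnd_Mat [simp]: "bnd n (Mat n f)"
  by (auto simp: bnd_def)

definition Idm :: "nat \<Rightarrow> fmat" where "Idm n = Mat n (\<lambda>i j. if i = j then 1 else 0)"

lemma Idm_mult [simp]: "bnd n A \<Longrightarrow> Idm n * A = A" "bnd n A \<Longrightarrow> A * Idm n = A"
proof -
  assume A: "bnd n A"
  have I: "bnd n (Idm n)" by (simp add: Idm_def)
  show "Idm n * A = A"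
  proof (rule fmat_eqI)
    fix i j
    have "ent (Idm n * A) i j = (\<Sum>k<n. if k = i then ent A i j else 0)"
      unfolding ent_times[OF I] by (rule sum.cong) (auto simp: Idm_def)
    also have "\<dots> = ent A i j" using bndD[OF A, of i j] by (auto simp: sum.delta)
    finally show "ent (Idm n * A) i j = ent A i j" .
  qed
  show "A * Idm n = A"
  proof (rule fmat_eqI)
    fix i j
    have "ent (A * Idm n) i j = (\<Sum>k<n. if k = j then ent A i j else 0)"
      unfolding ent_times[OF A] by (rule sum.cong) (auto simp: Idm_def)
    also have "\<dots> = ent A i j" using bndD[OF A, of i j] by (auto simp: sum.delta)
    finally show "ent (A * Idm n) i j = ent A i j" .
  qed
qed

lemma bnd_Idm [simp]: "bnd n (Idm n)" and adj_Idm [simp]: "adj (Idm n) = Idm n"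
  by (auto simp: Idm_def intro: fmat_eqI)

text \<open>The common block is essential: on the whole type, entrywise convergence does not imply
  convergence in norm.\<close>

lemma tendsto_fmatI:
  assumes n: "\<And>k. bnd n (X k)" "bnd n L"
    and lim: "\<And>i j. ((\<lambda>k. ent (X k) i j) \<longlongrightarrow> ent L i j) F"
  shows "(X \<longlongrightarrow> L) F"
proof -
  have "((\<lambda>k. (norm (X k - L))\<^sup>2) \<longlongrightarrow> 0) F"
  proof -
    have "((\<lambda>k. \<Sum>i<n. \<Sum>j<n. (cmod (ent (X k) i j - ent L i j))\<^sup>2) \<longlongrightarrow> (\<Sum>i<n. \<Sum>j<n. 0\<^sup>2)) F"
      by (intro tendsto_sum tendsto_power tendsto_norm_zero) (use lim in \<open>simp add: LIM_zero_iff\<close>)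
    then show ?thesis using n by (simp add: norm_fmat_eq[where n = n] bnd_simps)
  qed
  then have "((\<lambda>k. norm (X k - L)) \<longlongrightarrow> 0) F"
    using tendsto_real_sqrt[of "\<lambda>k. (norm (X k - L))\<^sup>2" 0 F] by simp
  then show ?thesis by (simp add: LIM_zero_iff tendsto_norm_zero_iff)
qed

text \<open>Bolzano-Weierstrass by a diagonal argument over the countably many entries.\<close>

lemma fmat_bounded_subseq:
  fixes X :: "nat \<Rightarrow> fmat"
  assumes n: "\<And>k. bnd n (X k)" and C: "\<And>k. norm (X k) \<le> C"
  obtains r L where "strict_mono r" "bnd n L" "(X \<circ> r) \<longlonglongrightarrow> L"
proof -
  have le: "norm (ent (X k) (fst p) (snd p)) \<le> C" for k p
    using norm_ent_le C order_trans by blast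
  obtain r where r: "strict_mono (r :: nat \<Rightarrow> nat)"
    and "\<And>p. p \<in> UNIV \<Longrightarrow> \<exists>l. (\<lambda>k. ent (X (r k)) (fst p) (snd p)) \<longlonglongrightarrow> l"
    by (rule function_convergent_subsequence[of UNIV "\<lambda>k p. ent (X k) (fst p) (snd p)" C]) (use le in auto)
  then have "\<forall>i j. \<exists>l. (\<lambda>k. ent (X (r k)) i j) \<longlonglongrightarrow> l"
    by (metis UNIV_I fst_conv snd_conv)
  then obtain l where l: "\<And>i j. (\<lambda>k. ent (X (r k)) i j) \<longlonglongrightarrow> l i j"
    by metis
  have "(X \<circ> r) \<longlonglongrightarrow> Mat n l"
  proof (rule tendsto_fmatI[of n])
    show "bnd n ((X \<circ> r) k)" for k using n by simp
    show "(\<lambda>k. ent ((X \<circ> r) k) i j) \<longlonglongrightarrow> ent (Mat n l) i j" for i j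
    proof (cases "i < n \<and> j < n")
      case True then show ?thesis using l by simp
    next
      case False
      then have "(\<lambda>k. ent ((X \<circ> r) k) i j) = (\<lambda>k. 0)" using n bndD by fastforce
      then show ?thesis using False by auto
    qed
  qed simp
  then show thesis using r that bnd_Mat by blast
qed

lemma closed_bnd: assumes "X \<longlonglongrightarrow> L" "\<And>k. bnd n (X k)" shows "bnd n L"
proof -
  have "ent L i j = 0" if "\<not> (i < n \<and> j < n)" for i j
  proof -
    have "cmod (ent L i j) \<le> norm (X k - L)" for k
      using norm_ent_le[of "X k - L" i j] bndD[OF assms(2) that, of k] by simp
    moreover have "(\<lambda>k. norm (X k - L)) \<longlonglongrightarrow> 0"
      using assms(1) by (simp add: LIM_zero tendsto_norm_zero)
    ultimately have "cmod (ent L i j) \<le> 0"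
      by (intro LIMSEQ_le_const[of "\<lambda>k. norm (X k - L)"]) auto
    then show ?thesis by simp
  qed
  then show ?thesis unfolding bnd_def by blast
qed

section \<open>Orthonormal families\<close>

definition onf :: "('a \<Rightarrow> 'a \<Rightarrow> real) \<Rightarrow> 'a set \<Rightarrow> nat \<Rightarrow> (nat \<Rightarrow> 'a) \<Rightarrow> bool" where
  "onf B U d u \<longleftrightarrow> (\<forall>i<d. u i \<in> U) \<and> (\<forall>i<d. \<forall>j<d. B (u i) (u j) = (if i = j then 1 else 0))"

text \<open>The form is a parameter living on a subspace because it has to cover both the inner
  product of matrices and the L2 product of functions, which is definite only on the continuous
  functions in \<open>C0\<close>.\<close>

locale inner_form =
  fixes B :: "'a::real_vector \<Rightarrow> 'a \<Rightarrow> real" and U :: "'a set"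
  assumes sub: "subspace U"
    and sym: "x \<in> U \<Longrightarrow> y \<in> U \<Longrightarrow> B x y = B y x"
    and add: "x \<in> U \<Longrightarrow> y \<in> U \<Longrightarrow> z \<in> U \<Longrightarrow> B (x + y) z = B x z + B y z"
    and scale: "x \<in> U \<Longrightarrow> z \<in> U \<Longrightarrow> B (r *\<^sub>R x) z = r * B x z"
    and nonneg: "x \<in> U \<Longrightarrow> 0 \<le> B x x"
    and pos: "x \<in> U \<Longrightarrow> B x x = 0 \<Longrightarrow> x = 0"
begin

lemma zero: "z \<in> U \<Longrightarrow> B 0 z = 0"
  using scale[of 0 z 0] subspace_0[OF sub] by simp

lemma diff: "x \<in> U \<Longrightarrow> y \<in> U \<Longrightarrow> z \<in> U \<Longrightarrow> B (x - y) z = B x z - B y z"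
  using add[of x "(-1) *\<^sub>R y" z] scale[of y z "-1"] subspace_scale[OF sub, of y "-1"] by simp

lemma sum_in: "(\<And>i. i < (d::nat) \<Longrightarrow> u i \<in> U) \<Longrightarrow> (\<Sum>i<d. c i *\<^sub>R u i) \<in> U"
  by (intro subspace_sum[OF sub] subspace_scale[OF sub]) auto

lemma sum_left: "(\<And>i. i < (d::nat) \<Longrightarrow> u i \<in> U) \<Longrightarrow> z \<in> U
    \<Longrightarrow> B (\<Sum>i<d. c i *\<^sub>R u i) z = (\<Sum>i<d. c i * B (u i) z)"
proof (induction d)
  case (Suc d)
  then show ?case
    using add[OF sum_in[of d u c] subspace_scale[OF sub, of "u d" "c d"] Suc.prems(2)] scale[of "u d" z "c d"]
    by simp
qed (simp add: zero)

lemma residual: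
  assumes "onf B U d u" "x \<in> U"
  defines "y \<equiv> x - (\<Sum>i<d. B x (u i) *\<^sub>R u i)"
  shows "y \<in> U" "i < d \<Longrightarrow> B y (u i) = 0" "B y y = B x x - (\<Sum>i<d. (B x (u i))\<^sup>2)"
proof -
  have u: "u i \<in> U" if "i < d" for i using assms that by (auto simp: onf_def)
  have s: "(\<Sum>i<d. B x (u i) *\<^sub>R u i) \<in> U" using u by (intro sum_in)
  show y: "y \<in> U" unfolding y_def using s assms by (intro subspace_diff[OF sub])
  have Bs: "B (\<Sum>i<d. B x (u i) *\<^sub>R u i) (u i) = B x (u i)" if "i < d" for i
  proof -
    have "B (\<Sum>i<d. B x (u i) *\<^sub>R u i) (u i) = (\<Sum>j<d. B x (u j) * B (u j) (u i))"
      using u that by (intro sum_left) auto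
    also have "\<dots> = (\<Sum>j<d. if j = i then B x (u i) else 0)"
      using assms(1) that by (intro sum.cong) (auto simp: onf_def)
    finally show ?thesis using that by simp
  qed
  show orth: "B y (u i) = 0" if "i < d" for i
    unfolding y_def using diff[OF assms(2) s u[OF that]] Bs[OF that] by simp
  have "B y y = B x y - B (\<Sum>i<d. B x (u i) *\<^sub>R u i) y"
    unfolding y_def using diff[OF assms(2) s] y y_def by simp
  also have "B (\<Sum>i<d. B x (u i) *\<^sub>R u i) y = (\<Sum>i<d. B x (u i) * B (u i) y)"
    using u y by (intro sum_left) auto
  also have "\<dots> = 0" using orth sym[OF u y] by (intro sum.neutral) auto
  also have "B x y = B y x" using sym assms y by auto
  also have "\<dots> = B x x - B (\<Sum>i<d. B x (u i) *\<^sub>R u i) x"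
    unfolding y_def using diff[OF assms(2) s assms(2)] .
  also have "B (\<Sum>i<d. B x (u i) *\<^sub>R u i) x = (\<Sum>i<d. B x (u i) * B (u i) x)"
    using u assms by (intro sum_left) auto
  also have "\<dots> = (\<Sum>i<d. (B x (u i))\<^sup>2)"
    using sym[OF u assms(2)] by (intro sum.cong) (auto simp: power2_eq_square)
  finally show "B y y = B x x - (\<Sum>i<d. (B x (u i))\<^sup>2)" by simp
qed

lemma bessel: "onf B U d u \<Longrightarrow> x \<in> U \<Longrightarrow> (\<Sum>i<d. (B x (u i))\<^sup>2) \<le> B x x"
  using residual(3)[of d u x] nonneg[OF residual(1)[of d u x]] by linarith

text \<open>A nonzero residual could be normalized and appended to the family. Maximal orthonormal
  families take the place of bases and dimensions throughout.\<close>

lemma maximal_onf_expands: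
  assumes u: "onf B U d u" and max: "\<And>u. \<not> onf B U (Suc d) u" and x: "x \<in> U"
  shows "x = (\<Sum>i<d. B x (u i) *\<^sub>R u i)"
proof (rule ccontr)
  define y where "y = x - (\<Sum>i<d. B x (u i) *\<^sub>R u i)"
  assume "x \<noteq> (\<Sum>i<d. B x (u i) *\<^sub>R u i)"
  then have "y \<noteq> 0" by (simp add: y_def)
  note y = residual(1,2)[OF u x, folded y_def]
  have Byy: "B y y > 0" using nonneg[OF y(1)] pos[OF y(1)] \<open>y \<noteq> 0\<close> by fastforce
  define w where "w = (1 / sqrt (B y y)) *\<^sub>R y"
  have w: "w \<in> U" unfolding w_def by (intro subspace_scale[OF sub] y)
  have Bw: "B w z = (1 / sqrt (B y y)) * B y z" if "z \<in> U" for z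
    unfolding w_def using scale[OF y(1) that] .
  have "B w w = 1"
    using Bw[OF w] sym[OF y(1) w] Bw[OF y(1)] Byy by (simp add: field_simps)
  moreover have "B w (u i) = 0" "B (u i) w = 0" if "i < d" for i
    using Bw[of "u i"] y(2)[OF that] u that w sym[of "u i" w] by (auto simp: onf_def)
  ultimately have "onf B U (Suc d) (u(d := w))"
    using u w by (auto simp: onf_def less_Suc_eq)
  then show False using max by blast
qed

end

lemma onf_mono: "onf B U d u \<Longrightarrow> k \<le> d \<Longrightarrow> onf B U k u"
  by (auto simp: onf_def)

lemma maximal_onf_exists:
  assumes "\<And>d u. onf B U d u \<Longrightarrow> d \<le> N"
  obtains d u where "onf B U d u" "\<And>u. \<not> onf B U (Suc d) u"
proof -
  define P where "P d \<longleftrightarrow> (\<exists>u. onf B U d u)" for d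
  have "P 0" by (simp add: P_def onf_def)
  have N: "\<And>d. P d \<Longrightarrow> d \<le> N" using assms by (auto simp: P_def)
  have "P (Greatest P)" using GreatestI_nat[of P 0 N] \<open>P 0\<close> N by blast
  moreover have "\<not> P (Suc (Greatest P))"
    using Greatest_le_nat[of P "Suc (Greatest P)" N] N by auto
  ultimately show thesis using that by (auto simp: P_def)
qed

lemma inner_form_inner: "subspace U \<Longrightarrow> inner_form inner (U :: 'a::real_inner set)"
  by unfold_locales (simp_all add: inner_add_left, rule inner_commute)

text \<open>The number \<open>d\<close> is the sum of the squared norms of the \<open>u k\<close>.
  Expanding each of them in the \<open>2 * n * n\<close> real matrix units and exchanging the sums,
  Bessel's inequality bounds the share of every matrix unit by 1.\<close>

lemma onf_fmat_bound:
  assumes u: "onf inner U d u" and U: "\<And>x. x \<in> U \<Longrightarrow> bnd n x"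
  shows "d \<le> 2 * n * n"
proof -
  interpret inner_form inner "UNIV :: fmat set" by (rule inner_form_inner) simp
  have u': "onf inner UNIV d u" using u by (auto simp: onf_def)
  define E where "E i j c = Mat n (\<lambda>i' j'. if i' = i \<and> j' = j then c else 0)" for i j c
  have inE: "inner (E i j c) x = Re (c * cnj (ent x i j))" if "i < n" "j < n" for i j c x
  proof -
    have "inner (E i j c) x = (\<Sum>i'<n. \<Sum>j'<n. if i' = i \<and> j' = j then Re (c * cnj (ent x i j)) else 0)"
      unfolding inner_fmat_eq[of n "E i j c" x, unfolded E_def, OF bnd_Mat] E_def by (intro sum.cong) auto
    also have "\<dots> = (\<Sum>i'<n. if i' = i then (\<Sum>j'<n. if j' = j then Re (c * cnj (ent x i j)) else 0) else 0)"
      by (intro sum.cong) auto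
    also have "\<dots> = Re (c * cnj (ent x i j))" using that by simp
    finally show ?thesis .
  qed
  have "real d = (\<Sum>k<d. inner (u k) (u k))" using u by (simp add: onf_def)
  also have "\<dots> = (\<Sum>k<d. \<Sum>i<n. \<Sum>j<n. (inner (E i j 1) (u k))\<^sup>2 + (inner (E i j \<i>) (u k))\<^sup>2)"
  proof (intro sum.cong refl)
    fix k assume "k \<in> {..<d}"
    then have "bnd n (u k)" using u U by (auto simp: onf_def)
    then show "inner (u k) (u k) = (\<Sum>i<n. \<Sum>j<n. (inner (E i j 1) (u k))\<^sup>2 + (inner (E i j \<i>) (u k))\<^sup>2)"
      by (simp add: inner_fmat_eq[of n] inE power2_eq_square)
  qed
  also have "\<dots> = (\<Sum>i<n. \<Sum>k<d. \<Sum>j<n. (inner (E i j 1) (u k))\<^sup>2 + (inner (E i j \<i>) (u k))\<^sup>2)"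
    by (rule sum.swap)
  also have "\<dots> = (\<Sum>i<n. \<Sum>j<n. \<Sum>k<d. (inner (E i j 1) (u k))\<^sup>2 + (inner (E i j \<i>) (u k))\<^sup>2)"
    by (intro sum.cong refl sum.swap)
  also have "\<dots> \<le> (\<Sum>i<n. \<Sum>j<n. 1 + 1)"
  proof (intro sum_mono)
    fix i j assume ij: "i \<in> {..<n}" "j \<in> {..<n}"
    have "(\<Sum>k<d. (inner (E i j c) (u k))\<^sup>2) \<le> inner (E i j c) (E i j c)" for c
      by (rule bessel[OF u']) simp
    moreover have "inner (E i j 1) (E i j 1) = 1" "inner (E i j \<i>) (E i j \<i>) = 1"
      using ij by (simp_all add: inE) (simp_all add: E_def)
    ultimately have "(\<Sum>k<d. (inner (E i j 1) (u k))\<^sup>2) \<le> 1" "(\<Sum>k<d. (inner (E i j \<i>) (u k))\<^sup>2) \<le> 1"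
      by metis+
    then show "(\<Sum>k<d. (inner (E i j 1) (u k))\<^sup>2 + (inner (E i j \<i>) (u k))\<^sup>2) \<le> 1 + 1"
      by (simp add: sum.distrib)
  qed
  also have "\<dots> = real (2 * n * n)" by simp
  finally show ?thesis by (simp only: of_nat_le_iff)
qed

lemma fmat_family_subseq:
  fixes u :: "nat \<Rightarrow> nat \<Rightarrow> fmat"
  assumes "\<And>j i. i < d \<Longrightarrow> bnd n (u j i)" "\<And>j i. i < d \<Longrightarrow> norm (u j i) \<le> C"
  obtains r L where "strict_mono (r :: nat \<Rightarrow> nat)" "\<And>i. i < d \<Longrightarrow> (\<lambda>j. u (r j) i) \<longlonglongrightarrow> L i"
  using assms
proof (induction d arbitrary: thesis)
  case 0
  then show ?case using strict_mono_id by blast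
next
  case (Suc d)
  obtain r L where r: "strict_mono (r :: nat \<Rightarrow> nat)" "\<And>i. i < d \<Longrightarrow> (\<lambda>j. u (r j) i) \<longlonglongrightarrow> L i"
    by (rule Suc.IH) (use Suc.prems(2,3) in auto)
  obtain s l where s: "strict_mono s" "((\<lambda>j. u (r j) d) \<circ> s) \<longlonglongrightarrow> l"
    by (rule fmat_bounded_subseq[of n "\<lambda>j. u (r j) d" C]) (use Suc.prems(2,3) in auto)
  show ?case
  proof (rule Suc.prems(1)[of "r \<circ> s" "L(d := l)"])
    show "strict_mono (r \<circ> s)" using r(1) s(1) by (rule strict_mono_o)
    show "(\<lambda>j. u ((r \<circ> s) j) i) \<longlonglongrightarrow> (L(d := l)) i" if "i < Suc d" for i
      using that s(2) LIMSEQ_subseq_LIMSEQ[OF r(2) s(1), of i] by (auto simp: less_Suc_eq o_def)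
  qed
qed

text \<open>Limits of orthonormal families of size \<open>d\<close> in the \<open>V j\<close> form
  an orthonormal family in \<open>U\<close>, and \<open>d\<close> is the maximal size there. Hence
  the limits span \<open>U\<close>, and approximants are obtained by keeping the coordinates and
  replacing the limit vectors by \<open>u (r j)\<close>.\<close>

lemma semicontinuous_subspaces:
  assumes U: "subspace U" "\<And>x. x \<in> U \<Longrightarrow> bnd n x" and Uj: "\<And>j. subspace (V j)" "\<And>j x. x \<in> V j \<Longrightarrow> bnd n x"
    and u: "\<And>j::nat. onf inner (V j) d (u j)" and max: "\<And>u. \<not> onf inner U (Suc d) u"
    and lim: "\<And>(r::nat\<Rightarrow>nat) x y. strict_mono r \<Longrightarrow> (\<And>j. x j \<in> V (r j)) \<Longrightarrow> x \<longlonglongrightarrow> y \<Longrightarrow> y \<in> U"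
  obtains r where "strict_mono (r :: nat \<Rightarrow> nat)" "\<And>v. v \<in> U \<Longrightarrow> \<exists>x. (\<forall>j. x j \<in> V (r j)) \<and> x \<longlonglongrightarrow> v"
proof -
  interpret inner_form inner U by (rule inner_form_inner) (rule U)
  have uV: "u j i \<in> V j" if "i < d" for j i using u that by (auto simp: onf_def)
  have "norm (u j i) \<le> 1" if "i < d" for j i
    using u[of j] that by (simp add: onf_def norm_eq_sqrt_inner)
  then obtain r L where r: "strict_mono (r :: nat \<Rightarrow> nat)" "\<And>i. i < d \<Longrightarrow> (\<lambda>j. u (r j) i) \<longlonglongrightarrow> L i"
    using fmat_family_subseq[of d n u 1] uV Uj(2) by blast
  have "onf inner U d L"
    unfolding onf_def
  proof (intro conjI allI impI)
    fix i assume "i < d"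
    then show "L i \<in> U" using lim[OF r(1) _ r(2)] uV by blast
  next
    fix i j assume ij: "i < d" "j < d"
    have "(\<lambda>k. inner (u (r k) i) (u (r k) j)) \<longlonglongrightarrow> inner (L i) (L j)"
      by (intro tendsto_intros r ij)
    moreover have "inner (u (r k) i) (u (r k) j) = (if i = j then 1 else 0)" for k
      using u ij by (auto simp: onf_def)
    ultimately show "inner (L i) (L j) = (if i = j then 1 else 0)"
      by (simp add: LIMSEQ_const_iff)
  qed
  note exp = maximal_onf_expands[OF this max]
  show thesis
  proof (rule that[OF r(1)])
    fix v assume v: "v \<in> U"
    have "(\<lambda>k. \<Sum>i<d. inner v (L i) *\<^sub>R u (r k) i) \<longlonglongrightarrow> (\<Sum>i<d. inner v (L i) *\<^sub>R L i)"
      by (intro tendsto_intros r) auto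
    then show "\<exists>x. (\<forall>j. x j \<in> V (r j)) \<and> x \<longlonglongrightarrow> v"
      using exp[OF v] uV by (intro exI[of _ "\<lambda>k. \<Sum>i<d. inner v (L i) *\<^sub>R u (r k) i"])
        (auto intro!: subspace_sum[OF Uj(1)] subspace_scale[OF Uj(1)])
  qed
qed

section \<open>Compact connected groups of unitary matrices\<close>

primrec mpow :: "nat \<Rightarrow> fmat \<Rightarrow> nat \<Rightarrow> fmat" where
  "mpow n k 0 = Idm n"
| "mpow n k (Suc m) = k * mpow n k m"

locale unitary_group =
  fixes n :: nat and K :: "fmat set"
  assumes compactK: "compact K" and connK: "connected K"
    and bndK: "k \<in> K \<Longrightarrow> bnd n k" and eK: "Idm n \<in> K"
    and multK: "k \<in> K \<Longrightarrow> l \<in> K \<Longrightarrow> k * l \<in> K" and adjK: "k \<in> K \<Longrightarrow> adj k \<in> K"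
    and adj_left: "k \<in> K \<Longrightarrow> adj k * k = Idm n" and adj_right: "k \<in> K \<Longrightarrow> k * adj k = Idm n"
begin

abbreviation e where "e \<equiv> Idm n"

lemma inner_left: "k \<in> K \<Longrightarrow> bnd n y \<Longrightarrow> inner (k * x) (k * y) = inner x y"
  by (simp add: inner_mult_left adj_left mult.assoc[symmetric])

lemma norm_left: "k \<in> K \<Longrightarrow> bnd n y \<Longrightarrow> norm (k * y) = norm y"
  by (simp add: norm_eq_sqrt_inner inner_left)

lemma norm_right: "k \<in> K \<Longrightarrow> bnd n y \<Longrightarrow> norm (y * k) = norm y"
  using norm_left[of "adj k" "adj y"] adjK[of k] bnd_adj[of n y] norm_adj[of "y * k"] by simp

lemma norm_mult_adj: "k \<in> K \<Longrightarrow> l \<in> K \<Longrightarrow> norm (k * adj l - e) = norm (k - l)"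
proof -
  assume kl: "k \<in> K" "l \<in> K"
  have "norm (k * adj l - e) = norm ((k * adj l - e) * l)"
    using kl by (intro norm_right[symmetric]) (auto simp: bnd_simps bnd_times bndK adjK)
  also have "(k * adj l - e) * l = k - l"
    using kl by (simp add: left_diff_distrib mult.assoc adj_left bndK)
  finally show ?thesis .
qed

lemma mpowK: "k \<in> K \<Longrightarrow> mpow n k m \<in> K"
  by (induction m) (auto intro: eK multK)

lemma norm_mpow_1:
  assumes "k \<in> K" shows "norm (mpow n k m - e) \<le> m * norm (k - e)"
proof (induction m)
  case (Suc m)
  have "mpow n k (Suc m) - e = k * (mpow n k m - e) + (k - e)"
    using assms by (simp add: right_diff_distrib bndK)
  then have "norm (mpow n k (Suc m) - e) \<le> norm (k * (mpow n k m - e)) + norm (k - e)"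
    by (simp only: norm_triangle_ineq)
  also have "norm (k * (mpow n k m - e)) = norm (mpow n k m - e)"
    using assms by (intro norm_left) (auto simp: bnd_simps bndK mpowK)
  finally show ?case using Suc by (simp add: distrib_right)
qed simp

text \<open>Multiplication by elements of \<open>K\<close> is isometric, so errors add up without
  being amplified. The constant does not depend on the number of factors, which permits many very
  short steps.\<close>

lemma norm_mpow_2:
  assumes "k \<in> K"
  shows "norm (mpow n k m - e - real m *\<^sub>R (k - e)) \<le> (m * norm (k - e))\<^sup>2"
proof (induction m)
  case (Suc m)
  let ?p = "mpow n k m"
  have "mpow n k (Suc m) - e - real (Suc m) *\<^sub>R (k - e) = (?p - e - real m *\<^sub>R (k - e)) + (k - e) * (?p - e)"
    using assms mpowK[OF assms, of m] by (simp add: algebra_simps bndK)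
  then have "norm (mpow n k (Suc m) - e - real (Suc m) *\<^sub>R (k - e))
      \<le> norm (?p - e - real m *\<^sub>R (k - e)) + norm (k - e) * norm (?p - e)"
    by (metis norm_triangle_le add_left_mono norm_mult_ineq)
  also have "norm (k - e) * norm (?p - e) \<le> norm (k - e) * (m * norm (k - e))"
    by (intro mult_left_mono norm_mpow_1 assms) auto
  also have "norm (?p - e - real m *\<^sub>R (k - e)) \<le> (m * norm (k - e))\<^sup>2" by (rule Suc)
  also have "(m * norm (k - e))\<^sup>2 + norm (k - e) * (m * norm (k - e)) \<le> (Suc m * norm (k - e))\<^sup>2"
    by (simp add: power2_eq_square algebra_simps)
  finally show ?case by simp
qed simp

lemma K_subseq:
  assumes "\<And>j. X j \<in> K" obtains r L where "strict_mono (r :: nat \<Rightarrow> nat)" "L \<in> K" "(X \<circ> r) \<longlonglongrightarrow> L"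
  using compactK assms unfolding compact_def by blast

text \<open>Among the points of a coset of the zero set of \<open>p\<close> take the one nearest to \<open>e\<close>.  Powers of such
  points fill out a one-parameter group along the limit direction on which \<open>p\<close> vanishes, and moving
  along it brings the point still nearer to \<open>e\<close>.\<close>

lemma small_length_vanishes_near_e:
  assumes cont: "continuous_on K p" and nonneg: "\<And>k. k \<in> K \<Longrightarrow> 0 \<le> p k" and p_e: "p e = 0"
    and p_mult: "\<And>k l. k \<in> K \<Longrightarrow> l \<in> K \<Longrightarrow> p (k * l) \<le> p k + p l"
    and p_adj: "\<And>k. k \<in> K \<Longrightarrow> p (adj k) = p k"
    and small: "\<And>\<eta>::real. \<eta> > 0 \<Longrightarrow> \<exists>\<delta>>0. \<forall>k\<in>K. norm (k - e) < \<delta> \<longrightarrow> p k \<le> \<eta> * norm (k - e)"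
  shows "\<exists>\<delta>>0. \<forall>k\<in>K. norm (k - e) < \<delta> \<longrightarrow> p k = (0::real)"
proof (rule ccontr)
  define N where "N = {k\<in>K. p k = 0}"
  have NK: "N \<subseteq> K" and eN: "e \<in> N" by (auto simp: N_def eK p_e)
  have "closedin (top_of_set K) {k\<in>K. p k = 0}"
    by (rule continuous_closedin_preimage_constant[OF cont])
  then have compN: "compact N" unfolding N_def using compactK closedin_compact by blast
  have N_mult: "k * l \<in> N" if "k \<in> N" "l \<in> N" for k l
    using that p_mult[of k l] nonneg[of "k * l"] by (auto simp: N_def multK)
  have N_adj: "adj k \<in> N" if "k \<in> N" for k using that by (auto simp: N_def adjK p_adj)
  assume neg: "\<not> ?thesis"
  have "\<exists>h\<in>K. norm (h - e) < 1 / real (Suc j) \<and> p h \<noteq> 0 \<and> (\<forall>d\<in>N. norm (h - e) \<le> norm (h * d - e))" for j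
  proof -
    obtain g where g: "g \<in> K" "norm (g - e) < 1 / real (Suc j)" "p g \<noteq> 0"
      using neg by (metis of_nat_0_less_iff zero_less_Suc zero_less_divide_1_iff)
    have "continuous_on N (\<lambda>c. norm (g * c - e))" by (intro continuous_intros)
    then obtain c where c: "c \<in> N" "\<And>d. d \<in> N \<Longrightarrow> norm (g * c - e) \<le> norm (g * d - e)"
      using continuous_attains_inf[OF compN] eN by blast
    have gK: "g * c \<in> K" using g c NK multK by auto
    have "norm (g * c - e) \<le> norm (g * e - e)" using c eN by blast
    then have 1: "norm (g * c - e) < 1 / real (Suc j)" using g bndK by simp
    have "g = (g * c) * adj c" using g(1) c(1) NK by (auto simp: mult.assoc adj_right bndK)
    then have "p g \<le> p (g * c) + p (adj c)" using p_mult[OF gK, of "adj c"] adjK c NK by auto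
    then have 2: "p (g * c) \<noteq> 0" using N_adj[OF c(1)] g nonneg[OF g(1)] by (auto simp: N_def)
    show ?thesis
      by (rule bexI[OF _ gK]) (use 1 2 c N_mult in \<open>auto simp: mult.assoc\<close>)
  qed
  then obtain h where h: "\<And>j. h j \<in> K" "\<And>j. norm (h j - e) < 1 / real (Suc j)" "\<And>j. p (h j) \<noteq> 0"
      "\<And>j d. d \<in> N \<Longrightarrow> norm (h j - e) \<le> norm (h j * d - e)"
    by metis
  define D where "D j = (1 / norm (h j - e)) *\<^sub>R (h j - e)" for j
  have hpos: "norm (h j - e) > 0" for j using h(3)[of j] p_e by auto
  have D: "bnd n (D j)" "norm (D j) = 1" for j
    using h(1) hpos[of j] by (auto simp: D_def bnd_simps bndK)
  obtain r X where r: "strict_mono (r::nat\<Rightarrow>nat)" "(D \<circ> r) \<longlonglongrightarrow> X"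
    by (rule fmat_bounded_subseq[of n D 1]) (use D in auto)
  define \<epsilon> where "\<epsilon> j = norm (h (r j) - e)" for j
  have \<epsilon>pos: "\<epsilon> j > 0" for j using hpos by (simp add: \<epsilon>_def)
  have "(\<lambda>j. norm (h j - e)) \<longlonglongrightarrow> 0"
    by (rule tendsto_sandwich[OF _ _ tendsto_const lim_1_over_n[THEN LIMSEQ_Suc]])
      (use h(2) in \<open>auto intro!: always_eventually less_imp_le\<close>)
  then have \<epsilon>0: "\<epsilon> \<longlonglongrightarrow> 0" unfolding \<epsilon>_def using LIMSEQ_subseq_LIMSEQ[OF _ r(1)] by (force simp: o_def)
  have h\<epsilon>: "h (r j) - e = \<epsilon> j *\<^sub>R D (r j)" for j using hpos by (simp add: D_def \<epsilon>_def)
  have "(\<lambda>j. norm (D (r j) - X) + \<epsilon> j) \<longlonglongrightarrow> 0 + 0"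
    by (intro tendsto_add \<epsilon>0 tendsto_norm_zero LIM_zero) (use r(2) in \<open>simp add: o_def\<close>)
  then have "\<forall>\<^sub>F j in sequentially. norm (D (r j) - X) + \<epsilon> j < 1"
    by (rule order_tendstoD(2)) simp
  then obtain j where j: "norm (D (r j) - X) + \<epsilon> j < 1" by (auto simp: eventually_sequentially)
  \<comment> \<open>The length to travel is the distance from \<open>e\<close> of one particular
    point \<open>h (r j)\<close>, which lies close to \<open>e + t *\<^sub>R X\<close>. The element
    \<open>c\<close> found below is within \<open>t^2\<close> of the same place, so dividing by
    \<open>c\<close> brings \<open>h (r j)\<close> nearer to \<open>e\<close>.\<close>
  define t where "t = \<epsilon> j"
  have t: "t > 0" using \<epsilon>pos by (simp add: t_def)
  \<comment> \<open>As many steps of length \<open>\<epsilon> i\<close> as fit into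
    \<open>t\<close>; the powers \<open>q i\<close> then travel the distance \<open>t\<close> in
    direction \<open>X\<close> up to second order.\<close>
  define m where "m i = nat \<lfloor>t / \<epsilon> i\<rfloor>" for i
  have m_le: "real (m i) * \<epsilon> i \<le> t" and m_ge: "t - \<epsilon> i \<le> real (m i) * \<epsilon> i" for i
  proof -
    have nn: "t / \<epsilon> i \<ge> 0" using t \<epsilon>pos[of i] by simp
    have "real (m i) \<le> t / \<epsilon> i" using nn unfolding m_def by linarith
    then show "real (m i) * \<epsilon> i \<le> t" using \<epsilon>pos[of i] by (simp add: pos_le_divide_eq)
    have "t / \<epsilon> i - 1 \<le> real (m i)" using nn unfolding m_def by linarith
    then have "(t / \<epsilon> i - 1) * \<epsilon> i \<le> real (m i) * \<epsilon> i" using \<epsilon>pos[of i] by (intro mult_right_mono) auto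
    then show "t - \<epsilon> i \<le> real (m i) * \<epsilon> i" using \<epsilon>pos[of i] by (simp add: left_diff_distrib)
  qed
  have m\<epsilon>: "(\<lambda>i. real (m i) * \<epsilon> i) \<longlonglongrightarrow> t"
    by (rule tendsto_sandwich[of "\<lambda>i. t - \<epsilon> i" _ _ "\<lambda>_. t"])
      (use m_le m_ge tendsto_diff[OF tendsto_const \<epsilon>0, of t] in \<open>auto intro!: always_eventually\<close>)
  define q where "q i = mpow n (h (r i)) (m i)" for i
  have qK: "q i \<in> K" for i using h(1) by (simp add: q_def mpowK)
  obtain s c where s: "strict_mono (s::nat\<Rightarrow>nat)" "c \<in> K" "(q \<circ> s) \<longlonglongrightarrow> c"
    using K_subseq[of q, OF qK] .
  have near: "norm (c - e - t *\<^sub>R X) \<le> t\<^sup>2"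
  proof -
    have "norm (q i - e - (real (m i) * \<epsilon> i) *\<^sub>R D (r i)) \<le> t\<^sup>2" for i
    proof -
      have "norm (q i - e - (real (m i) * \<epsilon> i) *\<^sub>R D (r i)) \<le> (real (m i) * \<epsilon> i)\<^sup>2"
        using norm_mpow_2[OF h(1)[of "r i"], of "m i"] unfolding q_def[symmetric] \<epsilon>_def[symmetric] h\<epsilon>
        by (simp add: D abs_of_pos[OF \<epsilon>pos])
      also have "\<dots> \<le> t\<^sup>2" using m_le[of i] \<epsilon>pos[of i] by (intro power_mono) auto
      finally show ?thesis .
    qed
    moreover have "(\<lambda>i. norm ((q \<circ> s) i - e - (real (m (s i)) * \<epsilon> (s i)) *\<^sub>R (D \<circ> r) (s i)))
        \<longlonglongrightarrow> norm (c - e - t *\<^sub>R X)"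
      using s(3) LIMSEQ_subseq_LIMSEQ[OF m\<epsilon> s(1)] LIMSEQ_subseq_LIMSEQ[OF r(2) s(1)]
      by (intro tendsto_intros) (auto simp: o_def)
    ultimately show ?thesis by (intro LIMSEQ_le_const2) (auto simp: o_def)
  qed
  have p_pow: "p (mpow n k l) \<le> real l * p k" if "k \<in> K" for k l
  proof (induction l)
    case (Suc l)
    then show ?case using p_mult[OF that mpowK[OF that, of l]] by (simp add: distrib_right)
  qed (simp add: p_e)
  \<comment> \<open>Subadditivity charges \<open>p\<close> at most \<open>\<eta>\<close> per unit of
    length along \<open>m i\<close> steps of total length at most \<open>t\<close>. As
    \<open>\<eta>\<close> is arbitrary, \<open>p\<close> vanishes at \<open>c\<close>.\<close>
  have "p c \<le> t * \<eta>" if \<eta>: "\<eta> > 0" for \<eta>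
  proof -
    obtain \<delta> where \<delta>: "\<delta> > 0" "\<And>k. k \<in> K \<Longrightarrow> norm (k - e) < \<delta> \<Longrightarrow> p k \<le> \<eta> * norm (k - e)"
      using small[OF \<eta>] by blast
    have "\<forall>\<^sub>F i in sequentially. \<epsilon> i < \<delta>" using order_tendstoD(2)[OF \<epsilon>0 \<delta>(1)] .
    then have ev: "\<forall>\<^sub>F i in sequentially. p (q i) \<le> t * \<eta>"
    proof eventually_elim
      case (elim i)
      have "p (q i) \<le> real (m i) * p (h (r i))" unfolding q_def by (rule p_pow[OF h(1)])
      also have "\<dots> \<le> real (m i) * (\<eta> * \<epsilon> i)"
        using \<delta>(2)[OF h(1), of "r i"] elim by (intro mult_left_mono) (auto simp: \<epsilon>_def)
      also have "\<dots> = (real (m i) * \<epsilon> i) * \<eta>" by simp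
      also have "\<dots> \<le> t * \<eta>" using m_le \<eta> by (intro mult_right_mono) auto
      finally show ?case .
    qed
    have "(\<lambda>i. p ((q \<circ> s) i)) \<longlonglongrightarrow> p c"
      by (rule continuous_on_tendsto_compose[OF cont s(3,2)]) (simp add: qK)
    moreover have "\<forall>\<^sub>F i in sequentially. p ((q \<circ> s) i) \<le> t * \<eta>"
      using eventually_subseq[OF s(1) ev] by simp
    ultimately show ?thesis using tendsto_upperbound by fastforce
  qed
  then have "p c \<le> 0 + \<eta>'" if "\<eta>' > 0" for \<eta>' using that t by (metis add_0 divide_pos_pos nonzero_mult_div_cancel_left less_numeral_extra(3) times_divide_eq_right)
  then have "p c \<le> 0" by (rule field_le_epsilon)
  then have "p c = 0" using nonneg[OF s(2)] by simp
  then have cN: "adj c \<in> N" using s(2) by (intro N_adj) (simp add: N_def)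
  have "\<epsilon> j \<le> norm (h (r j) * adj c - e)" unfolding \<epsilon>_def using h(4)[OF cN] .
  also have "\<dots> = norm (h (r j) - c)" using h(1) s(2) by (rule norm_mult_adj)
  also have "h (r j) - c = t *\<^sub>R (D (r j) - X) - (c - e - t *\<^sub>R X)"
    using h\<epsilon>[of j] by (simp add: t_def algebra_simps)
  also have "norm \<dots> \<le> norm (t *\<^sub>R (D (r j) - X)) + norm (c - e - t *\<^sub>R X)" by (rule norm_triangle_ineq4)
  also have "\<dots> \<le> t * norm (D (r j) - X) + t * t" using near t by (simp add: power2_eq_square)
  also have "\<dots> = t * (norm (D (r j) - X) + \<epsilon> j)" by (simp add: t_def distrib_left)
  also have "\<dots> < t * 1" using j t by (intro mult_strict_left_mono) auto
  finally show False by (simp add: t_def)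
qed

text \<open>The zero set is a closed subgroup. It contains a neighbourhood of \<open>e\<close>, so
  it is also open, and connectedness makes it all of \<open>K\<close>.\<close>

lemma small_length_vanishes:
  assumes cont: "continuous_on K p" and nonneg: "\<And>k. k \<in> K \<Longrightarrow> 0 \<le> p k" and p_e: "p e = 0"
    and p_mult: "\<And>k l. k \<in> K \<Longrightarrow> l \<in> K \<Longrightarrow> p (k * l) \<le> p k + p l"
    and p_adj: "\<And>k. k \<in> K \<Longrightarrow> p (adj k) = p k"
    and small: "\<And>\<eta>::real. \<eta> > 0 \<Longrightarrow> \<exists>\<delta>>0. \<forall>k\<in>K. norm (k - e) < \<delta> \<longrightarrow> p k \<le> \<eta> * norm (k - e)"
    and k: "k \<in> K"
  shows "p k = (0::real)"
proof -
  obtain \<delta> where \<delta>: "\<delta> > 0" "\<And>k. k \<in> K \<Longrightarrow> norm (k - e) < \<delta> \<Longrightarrow> p k = 0"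
    using small_length_vanishes_near_e[OF cont nonneg p_e p_mult p_adj small] by blast
  define N where "N = {k\<in>K. p k = 0}"
  have 1: "closedin (top_of_set K) N"
    unfolding N_def by (rule continuous_closedin_preimage_constant[OF cont])
  have 2: "openin (top_of_set K) N"
    unfolding openin_euclidean_subtopology_iff
  proof (intro conjI ballI)
    show "N \<subseteq> K" by (auto simp: N_def)
    fix x assume x: "x \<in> N"
    have "y \<in> N" if y: "y \<in> K" "dist y x < \<delta>" for y
    proof -
      have xK: "x \<in> K" using x by (simp add: N_def)
      have "p (y * adj x) = 0"
        using y xK by (intro \<delta>) (auto simp: norm_mult_adj dist_norm intro: multK adjK)
      moreover have "y = (y * adj x) * x" using xK y by (simp add: mult.assoc adj_left bndK)
      ultimately have "p y \<le> 0" using p_mult[of "y * adj x" x] x xK y by (auto simp: N_def multK adjK)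
      then show ?thesis using nonneg[of y] y by (auto simp: N_def)
    qed
    then show "\<exists>\<delta>>0. \<forall>y\<in>K. dist y x < \<delta> \<longrightarrow> y \<in> N" using \<delta>(1) by blast
  qed
  have "N = K" using connK 1 2 eK p_e unfolding connected_clopen by (auto simp: N_def)
  then show ?thesis using k by (auto simp: N_def)
qed

text \<open>The Bouligand tangent cone of \<open>K\<close> at the unit. It is not shown to be a
  vector space, which is why \<open>liealg\<close> is defined as its span.\<close>

definition tangent :: "fmat \<Rightarrow> bool" where
  "tangent X \<longleftrightarrow> (\<exists>k \<epsilon>. (\<forall>j. k j \<in> K \<and> \<epsilon> j > 0) \<and> k \<longlonglongrightarrow> e
      \<and> (\<lambda>j. (1 / \<epsilon> j) *\<^sub>R (k j - e)) \<longlonglongrightarrow> X)"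

lemma tangent_bnd: "tangent X \<Longrightarrow> bnd n X"
proof -
  assume "tangent X"
  then obtain k \<epsilon> where k: "\<And>j. k j \<in> K" "(\<lambda>j. (1 / \<epsilon> j) *\<^sub>R (k j - e)) \<longlonglongrightarrow> X"
    unfolding tangent_def by blast
  show "bnd n X"
    by (rule closed_bnd[OF k(2)]) (simp add: bnd_simps bndK k(1))
qed

text \<open>A sequence of counterexamples tending to \<open>e\<close> has, after normalization, a
  convergent subsequence of directions. The limit is tangent, yet \<open>f\<close> is bounded away
  from 0 there.\<close>

lemma small_of_tangent:
  assumes f: "bounded_linear f" and 0: "\<And>X. tangent X \<Longrightarrow> f X = (0::fmat)" and \<eta>: "\<eta> > 0"
  shows "\<exists>\<delta>>0. \<forall>k\<in>K. norm (k - e) < \<delta> \<longrightarrow> norm (f (k - e)) \<le> \<eta> * norm (k - e)"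
proof (rule ccontr)
  interpret f: bounded_linear f by (rule f)
  assume neg: "\<not> ?thesis"
  have "\<exists>k\<in>K. norm (k - e) < 1 / real (Suc j) \<and> norm (f (k - e)) > \<eta> * norm (k - e)" for j
    using neg by (metis not_le of_nat_0_less_iff zero_less_Suc zero_less_divide_1_iff)
  then obtain k where k: "\<And>j. k j \<in> K" "\<And>j. norm (k j - e) < 1 / real (Suc j)"
      "\<And>j. norm (f (k j - e)) > \<eta> * norm (k j - e)"
    by metis
  have kpos: "norm (k j - e) > 0" for j using k(3)[of j] f.zero by fastforce
  define D where "D j = (1 / norm (k j - e)) *\<^sub>R (k j - e)" for j
  have D: "bnd n (D j)" "norm (D j) = 1" for j
    using k(1) kpos[of j] by (auto simp: D_def bnd_simps bndK)
  obtain r X where r: "strict_mono (r::nat\<Rightarrow>nat)" "(D \<circ> r) \<longlonglongrightarrow> X"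
    by (rule fmat_bounded_subseq[of n D 1]) (use D in auto)
  have "(\<lambda>j. norm (k j - e)) \<longlonglongrightarrow> 0"
    by (rule tendsto_sandwich[OF _ _ tendsto_const lim_1_over_n[THEN LIMSEQ_Suc]])
      (use k(2) in \<open>auto intro!: always_eventually less_imp_le\<close>)
  then have "k \<longlonglongrightarrow> e" by (simp add: LIM_zero_iff tendsto_norm_zero_iff)
  then have "(k \<circ> r) \<longlonglongrightarrow> e" by (rule LIMSEQ_subseq_LIMSEQ[OF _ r(1)])
  then have "tangent X"
    unfolding tangent_def using k(1) kpos r(2)
    by (intro exI[of _ "k \<circ> r"] exI[of _ "\<lambda>j. norm (k (r j) - e)"]) (auto simp: D_def o_def)
  have "(\<lambda>j. norm (f ((D \<circ> r) j))) \<longlonglongrightarrow> norm (f X)" by (intro tendsto_norm f.tendsto r)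
  moreover have "norm (f ((D \<circ> r) j)) \<ge> \<eta>" for j
  proof -
    have "norm (f ((D \<circ> r) j)) = norm (f (k (r j) - e)) / norm (k (r j) - e)"
      by (simp only: D_def o_def f.scaleR) simp
    then show ?thesis using k(3)[of "r j"] kpos[of "r j"] by (simp only: pos_le_divide_eq)
  qed
  ultimately have "norm (f X) \<ge> \<eta>" by (intro LIMSEQ_le_const) auto
  then show False using 0[OF \<open>tangent X\<close>] \<eta> by simp
qed

text \<open>The displacement \<open>norm (k * v - v)\<close> is subadditive because \<open>K\<close>
  acts by isometries, and small to first order because the tangent vectors annihilate
  \<open>v\<close>.\<close>

lemma fixed_of_tangent:
  assumes v: "bnd n v" and 0: "\<And>X. tangent X \<Longrightarrow> X * v = 0" and k: "k \<in> K"
  shows "k * v = v"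
proof -
  have "norm (k * v - v) = 0"
  proof (rule small_length_vanishes[where p = "\<lambda>k. norm (k * v - v)", OF _ _ _ _ _ _ k])
    show "continuous_on K (\<lambda>k. norm (k * v - v))" by (intro continuous_intros)
    show "norm (k * l * v - v) \<le> norm (k * v - v) + norm (l * v - v)" if "k \<in> K" "l \<in> K" for k l
    proof -
      have "k * l * v - v = k * (l * v - v) + (k * v - v)" by (simp add: algebra_simps)
      then have "norm (k * l * v - v) \<le> norm (k * (l * v - v)) + norm (k * v - v)"
        by (simp only: norm_triangle_ineq)
      also have "norm (k * (l * v - v)) = norm (l * v - v)"
        using that v by (intro norm_left) (auto simp: bnd_simps bnd_times bndK)
      finally show ?thesis by simp
    qed
    show "norm (adj k * v - v) = norm (k * v - v)" if "k \<in> K" for k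
    proof -
      have "norm (adj k * v - v) = norm (k * (adj k * v - v))"
        using that v by (intro norm_left[symmetric]) (auto simp: bnd_simps bnd_times bndK adjK)
      also have "k * (adj k * v - v) = - (k * v - v)"
        using that v by (simp add: right_diff_distrib mult.assoc[symmetric] adj_right)
      finally show ?thesis by (simp only: norm_minus_cancel)
    qed
    fix \<eta> :: real assume "\<eta> > 0"
    moreover have "k * v - v = (k - e) * v" for k using v by (simp add: left_diff_distrib)
    ultimately show "\<exists>\<delta>>0. \<forall>k\<in>K. norm (k - e) < \<delta> \<longrightarrow> norm (k * v - v) \<le> \<eta> * norm (k - e)"
      using small_of_tangent[OF bounded_linear_mult_left[of v] 0] by simp
  qed (use v in auto)
  then show ?thesis by simp
qed

text \<open>The same argument for the action of \<open>K\<close> by conjugation; multiplying the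
  displacement of \<open>A\<close> on either side by unitary matrices does not change its
  norm.\<close>

lemma commute_of_tangent:
  assumes A: "bnd n A" and 0: "\<And>X. tangent X \<Longrightarrow> X * A = A * X" and k: "k \<in> K"
  shows "k * A = A * k"
proof -
  have "norm (k * A - A * k) = 0"
  proof (rule small_length_vanishes[where p = "\<lambda>k. norm (k * A - A * k)", OF _ _ _ _ _ _ k])
    show "continuous_on K (\<lambda>k. norm (k * A - A * k))" by (intro continuous_intros)
    show "norm (k * l * A - A * (k * l)) \<le> norm (k * A - A * k) + norm (l * A - A * l)"
      if "k \<in> K" "l \<in> K" for k l
    proof -
      have "k * l * A - A * (k * l) = k * (l * A - A * l) + (k * A - A * k) * l" by (simp add: algebra_simps)
      then have "norm (k * l * A - A * (k * l)) \<le> norm (k * (l * A - A * l)) + norm ((k * A - A * k) * l)"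
        by (simp only: norm_triangle_ineq)
      also have "norm (k * (l * A - A * l)) = norm (l * A - A * l)"
        using that A by (intro norm_left) (auto simp: bnd_simps bnd_times bndK)
      also have "norm ((k * A - A * k) * l) = norm (k * A - A * k)"
        using that A by (intro norm_right) (auto simp: bnd_simps bnd_times bndK)
      finally show ?thesis by simp
    qed
    show "norm (adj k * A - A * adj k) = norm (k * A - A * k)" if "k \<in> K" for k
    proof -
      have "norm (adj k * A - A * adj k) = norm (k * (adj k * A - A * adj k))"
        using that A by (intro norm_left[symmetric]) (auto simp: bnd_simps bnd_times bndK adjK)
      also have "\<dots> = norm (k * (adj k * A - A * adj k) * k)"
        using that A by (intro norm_right[symmetric]) (auto simp: bnd_simps bnd_times bndK adjK)
      also have "k * (adj k * A - A * adj k) * k = (k * adj k) * A * k - k * A * (adj k * k)"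
        by (simp add: algebra_simps)
      also have "\<dots> = - (k * A - A * k)"
        using that A by (simp add: adj_left adj_right bndK bnd_times)
      finally show ?thesis by (simp only: norm_minus_cancel)
    qed
    fix \<eta> :: real assume "\<eta> > 0"
    moreover have "k * A - A * k = (k - e) * A - A * (k - e)" for k using A by (simp add: algebra_simps)
    moreover have "bounded_linear (\<lambda>k. k * A - A * k)"
      by (intro bounded_linear_sub bounded_linear_mult_left bounded_linear_mult_right)
    ultimately show "\<exists>\<delta>>0. \<forall>k\<in>K. norm (k - e) < \<delta> \<longrightarrow> norm (k * A - A * k) \<le> \<eta> * norm (k - e)"
      using small_of_tangent[of "\<lambda>k. k * A - A * k" \<eta>] 0 by simp
  qed (use A in auto)
  then show ?thesis by simp
qed

end

section \<open>Fixed spaces of least dimension and generic pairs\<close>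

context unitary_group
begin

definition fixs :: "fmat set \<Rightarrow> fmat \<Rightarrow> fmat set" where
  "fixs W a = {v\<in>W. a * v = v}"

lemma subspace_fixs: "subspace W \<Longrightarrow> subspace (fixs W a)"
  by (auto simp: subspace_def fixs_def distrib_left)

text \<open>Lower semicontinuity of the fixed space at \<open>a\<close>: fixed vectors survive as
  limits of fixed vectors of the perturbed elements \<open>a * k (r j)\<close>. This is the only
  consequence of minimal dimension that is used later.\<close>

definition generic_in :: "fmat set \<Rightarrow> fmat \<Rightarrow> bool" where
  "generic_in W a \<longleftrightarrow> (\<forall>k. (\<forall>j. k j \<in> K) \<longrightarrow> k \<longlonglongrightarrow> e \<longrightarrow> (\<exists>r. strict_mono (r :: nat \<Rightarrow> nat) \<and>
      (\<forall>v\<in>fixs W a. \<exists>x. (\<forall>j. x j \<in> fixs W (a * k (r j))) \<and> x \<longlonglongrightarrow> v)))"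

lemma generic_inE:
  assumes "generic_in W a" "\<And>j. k j \<in> K" "k \<longlonglongrightarrow> e"
  obtains r where "strict_mono (r :: nat \<Rightarrow> nat)"
    "\<And>v. v \<in> fixs W a \<Longrightarrow> \<exists>x. (\<forall>j. x j \<in> fixs W (a * k (r j))) \<and> x \<longlonglongrightarrow> v"
  using assms unfolding generic_in_def by blast

text \<open>Take \<open>a\<close> whose fixed space in \<open>W\<close> has the least maximal
  orthonormal family. Every perturbation has at least that many orthonormal fixed vectors, and their
  limits are fixed by \<open>a\<close>.\<close>

lemma generic_fixed_space:
  assumes W: "subspace W" "\<And>x. x \<in> W \<Longrightarrow> bnd n x"
    and lim: "\<And>x y. (\<And>j. x j \<in> W) \<Longrightarrow> x \<longlonglongrightarrow> y \<Longrightarrow> y \<in> W"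
  shows "\<exists>a\<in>K. generic_in W a"
proof -
  have "\<exists>d u. onf inner (fixs W a) d u \<and> (\<forall>u. \<not> onf inner (fixs W a) (Suc d) u)" for a
    by (rule maximal_onf_exists[of inner "fixs W a" "2 * n * n"])
      (use W in \<open>auto simp: fixs_def intro!: onf_fmat_bound[where U = "fixs W a"]\<close>)
  then obtain d u where du: "\<And>a. onf inner (fixs W a) (d a) (u a)"
      "\<And>a u. \<not> onf inner (fixs W a) (Suc (d a)) u"
    by metis
  obtain a where a: "a \<in> K" "\<And>b. b \<in> K \<Longrightarrow> d a \<le> d b"
    using ex_has_least_nat[of "\<lambda>a. a \<in> K" e d] eK by blast
  show ?thesis
    unfolding generic_in_def
  proof (intro bexI[OF _ a(1)] allI impI)
    fix k assume "\<forall>j. k j \<in> K" and k2: "k \<longlonglongrightarrow> e"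
    then have k: "\<And>j. k j \<in> K" "k \<longlonglongrightarrow> e" by auto
    obtain r where "strict_mono (r :: nat \<Rightarrow> nat)"
      "\<And>v. v \<in> fixs W a \<Longrightarrow> \<exists>x. (\<forall>j. x j \<in> fixs W (a * k (r j))) \<and> x \<longlonglongrightarrow> v"
    proof (rule semicontinuous_subspaces[of "fixs W a" n "\<lambda>j. fixs W (a * k j)" "d a" "\<lambda>j. u (a * k j)"])
      show "onf inner (fixs W (a * k j)) (d a) (u (a * k j))" for j
        by (rule onf_mono[OF du(1)]) (use a k multK in auto)
      show "y \<in> fixs W a" if "strict_mono r" and x: "\<And>j. x j \<in> fixs W (a * k (r j))" "x \<longlonglongrightarrow> y"
        for r :: "nat \<Rightarrow> nat" and x y
      proof -
        have "(\<lambda>j. a * k (r j) * x j) \<longlonglongrightarrow> a * e * y"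
          by (intro tendsto_intros x LIMSEQ_subseq_LIMSEQ[OF k(2) that(1), unfolded o_def])
        then have "x \<longlonglongrightarrow> a * y" using x(1) a bndK by (simp add: fixs_def)
        then have "a * y = y" using x(2) LIMSEQ_unique by blast
        moreover have "y \<in> W" by (rule lim[OF _ x(2)]) (use x(1) in \<open>simp add: fixs_def\<close>)
        ultimately show ?thesis by (simp add: fixs_def)
      qed
    qed (use W du subspace_fixs in \<open>auto simp: fixs_def\<close>)
    then show "\<exists>r. strict_mono (r :: nat \<Rightarrow> nat) \<and>
      (\<forall>v\<in>fixs W a. \<exists>x. (\<forall>j. x j \<in> fixs W (a * k (r j))) \<and> x \<longlonglongrightarrow> v)" by blast
  qed
qed

lemma tangent_conj:
  assumes "tangent X" "b \<in> K" shows "tangent (b * X * adj b)"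
proof -
  obtain k \<epsilon> where k: "\<And>j. k j \<in> K" "\<And>j. \<epsilon> j > 0" "k \<longlonglongrightarrow> e" "(\<lambda>j. (1 / \<epsilon> j) *\<^sub>R (k j - e)) \<longlonglongrightarrow> X"
    using assms(1) unfolding tangent_def by blast
  have "(\<lambda>j. b * k j * adj b) \<longlonglongrightarrow> b * e * adj b" by (intro tendsto_intros k)
  then have 1: "(\<lambda>j. b * k j * adj b) \<longlonglongrightarrow> e" using assms by (simp add: bndK adj_right)
  have lim: "(\<lambda>j. b * ((1 / \<epsilon> j) *\<^sub>R (k j - e)) * adj b) \<longlonglongrightarrow> b * X * adj b" by (intro tendsto_intros k)
  have eq: "b * ((1 / \<epsilon> j) *\<^sub>R (k j - e)) * adj b = (1 / \<epsilon> j) *\<^sub>R (b * k j * adj b - e)" for j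
    using assms by (simp add: right_diff_distrib left_diff_distrib bndK adj_right)
  show ?thesis
    unfolding tangent_def using 1 k(1,2) assms multK adjK lim[unfolded eq]
    by (intro exI[of _ "\<lambda>j. b * k j * adj b"] exI[of _ \<epsilon>]) auto
qed

text \<open>If \<open>a\<close> has the smallest possible fixed space \<open>U\<close>, fixed vectors deform along with \<open>a\<close>, and this
  forces \<open>X * u\<close> to be orthogonal to \<open>U\<close> for every tangent vector \<open>X\<close>.  If then \<open>b\<close> has the smallest
  possible fixed space inside \<open>U\<close>, deforming \<open>b\<close> shows that \<open>X * v\<close> is orthogonal to itself for every
  common fixed vector \<open>v\<close>.\<close>

lemma generic_pair_fixed_vectors:
  obtains a b where "a \<in> K" "b \<in> K"
    "\<And>v k. bnd n v \<Longrightarrow> a * v = v \<Longrightarrow> b * v = v \<Longrightarrow> k \<in> K \<Longrightarrow> k * v = v"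
proof -
  \<comment> \<open>Matrices play the role of vectors: \<open>a * v = v\<close> holds column by
    column, and the inner product is the sum over the columns.\<close>
  define M where "M = {v. bnd n v}"
  have M: "subspace M" by (auto simp: M_def subspace_def bnd_simps)
  obtain a where a: "a \<in> K" and gen_a: "generic_in M a"
  proof -
    have "\<exists>a\<in>K. generic_in M a"
    proof (rule generic_fixed_space[OF M])
      show "y \<in> M" if "\<And>j. x j \<in> M" "x \<longlonglongrightarrow> y" for x y
        using that(1) closed_bnd[OF that(2)] by (simp add: M_def)
    qed (simp add: M_def)
    then show thesis using that by blast
  qed
  define U where "U = fixs M a"
  have U: "subspace U" "\<And>v. v \<in> U \<longleftrightarrow> bnd n v \<and> a * v = v"
    using subspace_fixs[OF M] by (auto simp: U_def fixs_def M_def)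
  have Ub: "\<And>v. v \<in> U \<Longrightarrow> bnd n v" by (simp add: U(2))
  have Ulim: "y \<in> U" if x: "\<And>j. x j \<in> U" "x \<longlonglongrightarrow> y" for x y
  proof -
    have "(\<lambda>j. a * x j) \<longlonglongrightarrow> a * y" by (intro tendsto_intros x)
    then have "x \<longlonglongrightarrow> a * y" using x(1) by (simp add: U(2))
    then have "a * y = y" using x(2) LIMSEQ_unique by blast
    moreover have "bnd n y" by (rule closed_bnd[OF x(2)]) (use x(1) U(2) in auto)
    ultimately show ?thesis by (simp add: U(2))
  qed
  have orth: "inner (X * u) u' = 0" if X: "tangent X" and u: "u \<in> U" "u' \<in> U" for X u u'
  proof -
    obtain k \<epsilon> where k: "\<And>j. k j \<in> K" "\<And>j. \<epsilon> j > 0" "k \<longlonglongrightarrow> e" "(\<lambda>j. (1 / \<epsilon> j) *\<^sub>R (k j - e)) \<longlonglongrightarrow> X"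
      using X unfolding tangent_def by blast
    obtain r where r: "strict_mono (r :: nat \<Rightarrow> nat)"
      "\<And>v. v \<in> U \<Longrightarrow> \<exists>x. (\<forall>j. x j \<in> fixs M (a * k (r j))) \<and> x \<longlonglongrightarrow> v"
      using generic_inE[OF gen_a k(1,3)] unfolding U_def by blast
    obtain x where x: "\<And>j. x j \<in> fixs M (a * k (r j))" "x \<longlonglongrightarrow> u" using r(2)[OF u(1)] by blast
    have x': "bnd n (x j)" "a * (k (r j) * x j) = x j" for j
      using x(1)[of j] by (auto simp: fixs_def M_def mult.assoc)
    \<comment> \<open>The unitary \<open>a\<close> fixes \<open>u'\<close> and sends
      \<open>k (r j) * x j\<close> back to \<open>x j\<close>; applying it to both arguments shows
      that replacing \<open>x j\<close> by \<open>k (r j) * x j\<close> does not change the product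
      with \<open>u'\<close>.\<close>
    have "inner ((k (r j) - e) * x j) u' = 0" for j
    proof -
      have "inner (k (r j) * x j) u' = inner (a * (k (r j) * x j)) (a * u')"
        using u by (intro inner_left[symmetric] a) (simp add: U(2))
      also have "\<dots> = inner (x j) u'" using u by (simp add: x' U(2))
      finally show ?thesis by (simp add: left_diff_distrib inner_diff_left x')
    qed
    then have 0: "inner ((1 / \<epsilon> (r j)) *\<^sub>R (k (r j) - e) * x j) u' = 0" for j by simp
    have "(\<lambda>j. inner ((1 / \<epsilon> (r j)) *\<^sub>R (k (r j) - e) * x j) u') \<longlonglongrightarrow> inner (X * u) u'"
      by (intro tendsto_intros x LIMSEQ_subseq_LIMSEQ[OF k(4) r(1), unfolded o_def])
    then show ?thesis unfolding 0 by (simp add: LIMSEQ_const_iff)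
  qed
  obtain b where b: "b \<in> K" and gen_b: "generic_in U b"
  proof -
    have "\<exists>b\<in>K. generic_in U b"
    proof (rule generic_fixed_space[OF U(1) Ub])
      show "y \<in> U" if "\<And>j. x j \<in> U" "x \<longlonglongrightarrow> y" for x y
        using that by (rule Ulim)
    qed
    then show thesis using that by blast
  qed
  have "X * v = 0" if X: "tangent X" and v: "v \<in> U" "b * v = v" for X v
  proof -
    obtain k \<epsilon> where k: "\<And>j. k j \<in> K" "\<And>j. \<epsilon> j > 0" "k \<longlonglongrightarrow> e" "(\<lambda>j. (1 / \<epsilon> j) *\<^sub>R (k j - e)) \<longlonglongrightarrow> X"
      using X unfolding tangent_def by blast
    obtain r where r: "strict_mono (r :: nat \<Rightarrow> nat)"
      "\<And>v. v \<in> fixs U b \<Longrightarrow> \<exists>x. (\<forall>j. x j \<in> fixs U (b * k (r j))) \<and> x \<longlonglongrightarrow> v"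
      using generic_inE[OF gen_b k(1,3)] by blast
    obtain x where x: "\<And>j. x j \<in> fixs U (b * k (r j))" "x \<longlonglongrightarrow> v"
      using r(2)[of v] v by (auto simp: fixs_def)
    have x': "x j \<in> U" "bnd n (x j)" "b * (k (r j) * x j) = x j" for j
      using x(1)[of j] by (auto simp: fixs_def U(2) mult.assoc)
    have vb: "bnd n v" using v U by simp
    have Xb: "bnd n X" by (rule tangent_bnd[OF X])
    have adjv: "adj b * v = v" using v b vb by (metis adj_left Idm_mult(1) mult.assoc)
    \<comment> \<open>Here it matters that the fixed space of \<open>b\<close> is taken inside
      \<open>U\<close>: both \<open>v\<close> and \<open>x j\<close> lie in \<open>U\<close>, so
      \<open>orth\<close> applies to them with \<open>X\<close> and with its conjugate
      \<open>b * X * adj b\<close>.\<close>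
    have "inner ((k (r j) - e) * x j) (X * v) = 0" for j
    proof -
      let ?w = "x j - v"
      have w: "?w \<in> U" using x'(1) v(1) by (intro subspace_diff U)
      have "inner (k (r j) * x j) (X * v) = inner (b * (k (r j) * x j)) (b * (X * v))"
        using vb Xb by (intro inner_left[symmetric] b bnd_times)
      also have "\<dots> = inner (x j) (b * X * adj b * v)" by (simp add: x' mult.assoc adjv)
      also have "\<dots> = inner v (b * X * adj b * v) + inner ?w (b * X * adj b * v)"
        by (simp add: inner_diff_left)
      also have "\<dots> = 0"
        using orth[OF tangent_conj[OF X b] v(1)] v(1) w by (simp only: inner_commute[of _ "b * X * adj b * v"])
      finally have 1: "inner (k (r j) * x j) (X * v) = 0" .
      have "inner (x j) (X * v) = 0" using orth[OF X v(1) x'(1)] by (metis inner_commute)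
      then show ?thesis using 1 x' by (simp add: left_diff_distrib inner_diff_left)
    qed
    then have 0: "inner ((1 / \<epsilon> (r j)) *\<^sub>R (k (r j) - e) * x j) (X * v) = 0" for j by simp
    have "(\<lambda>j. inner ((1 / \<epsilon> (r j)) *\<^sub>R (k (r j) - e) * x j) (X * v)) \<longlonglongrightarrow> inner (X * v) (X * v)"
      by (intro tendsto_intros x LIMSEQ_subseq_LIMSEQ[OF k(4) r(1), unfolded o_def])
    then show ?thesis unfolding 0 by (simp add: LIMSEQ_const_iff)
  qed
  then show thesis
    using that[OF a b] fixed_of_tangent U(2) by blast
qed

end

section \<open>No laws in nonabelian compact connected groups of unitary matrices\<close>

datatype pexp = PConst fmat | PX | PI | PAdd pexp pexp | PMul pexp pexp

text \<open>Polynomial expressions in an invertible matrix and its inverse; \<open>PI\<close> stands for the inverse,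
  and \<open>pd Z\<close> is the derivative along the left invariant vector field \<open>Z\<close>.\<close>

primrec ev :: "fmat \<Rightarrow> fmat \<Rightarrow> pexp \<Rightarrow> fmat" where
  "ev x y (PConst c) = c"
| "ev x y PX = x"
| "ev x y PI = y"
| "ev x y (PAdd p q) = ev x y p + ev x y q"
| "ev x y (PMul p q) = ev x y p * ev x y q"

primrec pd :: "fmat \<Rightarrow> pexp \<Rightarrow> pexp" where
  "pd Z (PConst c) = PConst 0"
| "pd Z PX = PMul PX (PConst Z)"
| "pd Z PI = PMul (PConst (- Z)) PI"
| "pd Z (PAdd p q) = PAdd (pd Z p) (pd Z q)"
| "pd Z (PMul p q) = PAdd (PMul (pd Z p) q) (PMul p (pd Z q))"

lemma ev_pd_zero: "ev x y (pd 0 p) = 0"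
  by (induction p) auto

lemma ev_pd_add: "ev x y (pd (Z + W) p) = ev x y (pd Z p) + ev x y (pd W p)"
  by (induction p) (auto simp: algebra_simps)

lemma ev_pd_scaleR: "ev x y (pd (r *\<^sub>R Z) p) = r *\<^sub>R ev x y (pd Z p)"
  by (induction p) (auto simp: algebra_simps)

text \<open>Complex linearity in the direction is what carries vanishing derivatives from real
  tangent vectors to their complexification.\<close>

lemma ev_pd_cs: "ev x y (pd (cs c Z) p) = cs c (ev x y (pd Z p))"
  by (induction p) (auto simp: cs_simps cs_mult)

text \<open>Requiring the identity for every \<open>D \<ge> d\<close> forces the coefficients beyond
  \<open>d\<close> to vanish, so two such functions can be written with one common degree
  bound.\<close>

definition polyf :: "(real \<Rightarrow> fmat) \<Rightarrow> bool" where
  "polyf f \<longleftrightarrow> (\<exists>d a. \<forall>D\<ge>d. \<forall>s. f s = (\<Sum>i\<le>D. s ^ i *\<^sub>R a i))"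

lemma polyf_monom: "polyf (\<lambda>s. s ^ k *\<^sub>R c)"
proof -
  have "s ^ k *\<^sub>R c = (\<Sum>i\<le>D. s ^ i *\<^sub>R (if i = k then c else 0))" if "D \<ge> k" for D s
  proof -
    have "(\<Sum>i\<le>D. s ^ i *\<^sub>R (if i = k then c else 0)) = (\<Sum>i\<le>D. if i = k then s ^ k *\<^sub>R c else 0)"
      by (rule sum.cong) auto
    then show ?thesis using that by simp
  qed
  then show ?thesis
    unfolding polyf_def by (intro exI[of _ k] exI[of _ "\<lambda>i. if i = k then c else 0"] allI impI)
qed

lemma polyf_add: assumes "polyf f" "polyf g" shows "polyf (\<lambda>s. f s + g s)"
proof -
  obtain d a where a: "\<And>D s. D \<ge> d \<Longrightarrow> f s = (\<Sum>i\<le>D. s ^ i *\<^sub>R a i)" using assms(1) polyf_def by metis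
  obtain d' b where b: "\<And>D s. D \<ge> d' \<Longrightarrow> g s = (\<Sum>i\<le>D. s ^ i *\<^sub>R b i)" using assms(2) polyf_def by metis
  have "f s + g s = (\<Sum>i\<le>D. s ^ i *\<^sub>R (a i + b i))" if "D \<ge> max d d'" for D s
    using a[of D s] b[of D s] that by (simp add: scaleR_add_right sum.distrib)
  then show ?thesis unfolding polyf_def by (intro exI[of _ "max d d'"] exI[of _ "\<lambda>i. a i + b i"]) auto
qed

lemma polyf_const: "polyf (\<lambda>s. c)"
  using polyf_monom[of 0 c] by simp

lemma polyf_sum: "(\<And>i. i \<in> I \<Longrightarrow> polyf (f i)) \<Longrightarrow> polyf (\<lambda>s. \<Sum>i\<in>I. f i s)"
  by (induction I rule: infinite_finite_induct) (auto intro: polyf_add polyf_const)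

lemma polyf_mult: assumes "polyf f" "polyf g" shows "polyf (\<lambda>s. f s * g s)"
proof -
  obtain d a where a: "\<And>s. f s = (\<Sum>i\<le>d. s ^ i *\<^sub>R a i)" using assms(1) polyf_def by blast
  obtain d' b where b: "\<And>s. g s = (\<Sum>i\<le>d'. s ^ i *\<^sub>R b i)" using assms(2) polyf_def by blast
  have "f s * g s = (\<Sum>i\<le>d. \<Sum>j\<le>d'. s ^ (i + j) *\<^sub>R (a i * b j))" for s
    unfolding a b sum_product by (intro sum.cong) (auto simp: power_add)
  then show ?thesis by (auto intro!: polyf_sum polyf_monom)
qed

text \<open>Descent from \<open>M\<close>: if one member of the chain is zero, the preceding one is
  constant, with value 0 at 0.\<close>

lemma derivative_chain_zero:
  assumes "\<And>m s. (\<phi> m has_vector_derivative \<phi> (Suc m) s) (at s)" "\<And>m. \<phi> m 0 = (0::fmat)"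
    and "\<And>s. \<phi> M s = 0"
  shows "\<phi> 0 (s::real) = 0"
  using assms
proof (induction M arbitrary: \<phi> s)
  case (Suc M)
  have 1: "\<phi> 1 s = 0" for s
    using Suc.IH[of "\<lambda>m. \<phi> (Suc m)"] Suc.prems by simp
  have "(\<phi> 0 has_vector_derivative 0) (at s)" for s
    using Suc.prems(1)[of 0 s] 1 by simp
  then have "\<phi> 0 s = \<phi> 0 0"
    by (metis DERIV_zero_connected_constant has_vector_derivative_zero_constant[of UNIV] UNIV_I convex_UNIV)
  then show ?case using Suc.prems(2) by simp
qed simp

lemma derivative_chain_polynomial:
  assumes "\<And>m s. (\<phi> m has_vector_derivative \<phi> (Suc m) s) (at s)"
    and "\<And>s::real. \<phi> 0 s = (\<Sum>i\<le>d. s ^ i *\<^sub>R (a i :: fmat))"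
  shows "\<phi> (Suc d) s = 0"
  using assms
proof (induction d arbitrary: \<phi> a s)
  case 0
  have "(\<phi> 0 has_vector_derivative 0) (at s)" by (simp add: 0(2)[abs_def])
  then show ?case using 0(1)[of 0 s] vector_derivative_unique_at by force
next
  case (Suc d)
  have "\<phi> 1 s = (\<Sum>i\<le>d. s ^ i *\<^sub>R (real (Suc i) *\<^sub>R a (Suc i)))" for s
  proof -
    have "((\<lambda>s. \<Sum>i\<le>Suc d. s ^ i *\<^sub>R a i) has_vector_derivative
        (\<Sum>i\<le>Suc d. (real i * s ^ (i - 1)) *\<^sub>R a i)) (at s)"
      by (intro has_vector_derivative_sum)
        (auto intro!: derivative_eq_intros simp: has_vector_derivative_def has_field_derivative_def fun_eq_iff)
    then have "\<phi> 1 s = (\<Sum>i\<le>Suc d. (real i * s ^ (i - 1)) *\<^sub>R a i)"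
      using Suc.prems(1)[of 0 s] vector_derivative_unique_at unfolding Suc.prems(2)[abs_def] One_nat_def by blast
    also have "\<dots> = (\<Sum>i\<le>d. s ^ i *\<^sub>R (real (Suc i) *\<^sub>R a (Suc i)))"
      unfolding sum.atMost_Suc_shift by (simp add: mult.commute)
    finally show ?thesis .
  qed
  then show ?case
    using Suc.IH[of "\<lambda>m. \<phi> (Suc m)" "\<lambda>i. real (Suc i) *\<^sub>R a (Suc i)"] Suc.prems(1) by simp
qed

text \<open>A polynomial all of whose derivatives vanish at 0 is zero. The derivatives are given as
  a family because in the application they are evaluations of iterated \<open>pd\<close>.\<close>

lemma derivative_chain_polyf_zero:
  assumes "\<And>m s. (\<phi> m has_vector_derivative \<phi> (Suc m) s) (at s)" "\<And>m. \<phi> m 0 = 0" "polyf (\<phi> 0)"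
  shows "\<phi> 0 s = 0"
proof -
  obtain d a where "\<And>s. \<phi> 0 s = (\<Sum>i\<le>d. s ^ i *\<^sub>R a i)" using assms(3) polyf_def by blast
  then show ?thesis
    using derivative_chain_polynomial[of \<phi> a d] derivative_chain_zero[of \<phi> "Suc d"] assms by blast
qed

text \<open>The exponential of \<open>s\<close> times \<open>E\<close>, cut off after
  \<open>N\<close> terms. The truncation is exact when \<open>E\<close> to the power
  \<open>Suc N\<close> vanishes, and the function of \<open>s\<close> is then visibly a
  polynomial.\<close>

definition nexp :: "nat \<Rightarrow> nat \<Rightarrow> fmat \<Rightarrow> real \<Rightarrow> fmat" where
  "nexp n N E s = (\<Sum>j\<le>N. (s ^ j / fact j) *\<^sub>R mpow n E j)"

lemma bnd_mpow: "bnd n E \<Longrightarrow> bnd n (mpow n E j)"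
  by (induction j) (auto intro: bnd_times)

lemma mpow_commute: "bnd n E \<Longrightarrow> E * mpow n E j = mpow n E j * E"
proof (induction j)
  case (Suc j)
  then show ?case by (simp only: mpow.simps mult.assoc Suc.IH[OF Suc.prems, symmetric])
qed simp

lemma nexp_zero: "nexp n N E 0 = Idm n"
proof -
  have "nexp n N E 0 = (\<Sum>j\<le>N. if j = 0 then Idm n else 0)"
    unfolding nexp_def by (intro sum.cong) auto
  then show ?thesis by simp
qed

lemma bnd_sum: "(\<And>i. i \<in> I \<Longrightarrow> bnd n (f i)) \<Longrightarrow> bnd n (sum f I)"
  by (induction I rule: infinite_finite_induct) (auto simp: bnd_simps)

lemma bnd_nexp: "bnd n E \<Longrightarrow> bnd n (nexp n N E s)"
  unfolding nexp_def by (intro bnd_sum bnd_simps bnd_mpow)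

lemma nexp_commute: "bnd n E \<Longrightarrow> E * nexp n N E s = nexp n N E s * E"
  unfolding nexp_def by (simp add: sum_distrib_left sum_distrib_right mpow_commute)

lemma nexp_deriv:
  assumes E: "bnd n E" and nil: "mpow n E (Suc N) = 0"
  shows "(nexp n N E has_vector_derivative E * nexp n N E s) (at s)"
proof -
  have "((\<lambda>s. \<Sum>j\<le>N. (s ^ j / fact j) *\<^sub>R mpow n E j) has_vector_derivative
      (\<Sum>j\<le>N. (real j * s ^ (j - 1) / fact j) *\<^sub>R mpow n E j)) (at s)"
    by (intro has_vector_derivative_sum)
      (auto intro!: derivative_eq_intros simp: has_vector_derivative_def has_field_derivative_def fun_eq_iff)
  also have "(\<Sum>j\<le>N. (real j * s ^ (j - 1) / fact j) *\<^sub>R mpow n E j) = E * nexp n N E s"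
  proof -
    have eq: "real (Suc j) * s ^ (Suc j - 1) / fact (Suc j) = s ^ j / fact j" for j
      by (simp add: divide_simps)
    have "E * nexp n N E s = (\<Sum>j\<le>N. (s ^ j / fact j) *\<^sub>R mpow n E (Suc j))"
      by (simp add: nexp_def sum_distrib_left)
    also have "\<dots> = (\<Sum>j<N. (s ^ j / fact j) *\<^sub>R mpow n E (Suc j))"
      using nil by (simp add: lessThan_Suc_atMost[symmetric] del: mpow.simps)
    also have "\<dots> = (\<Sum>j<N. (real (Suc j) * s ^ (Suc j - 1) / fact (Suc j)) *\<^sub>R mpow n E (Suc j))"
      unfolding eq ..
    also have "\<dots> = (\<Sum>j<Suc N. (real j * s ^ (j - 1) / fact j) *\<^sub>R mpow n E j)"
      unfolding sum.lessThan_Suc_shift by simp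
    finally show ?thesis by (simp add: lessThan_Suc_atMost)
  qed
  finally show ?thesis unfolding nexp_def[abs_def] .
qed

text \<open>The difference \<open>g\<close> of both sides solves \<open>g' = E * g\<close> with
  \<open>g 0 = 0\<close>. The chain \<open>mpow n E m * g\<close> consists of successive derivatives
  and ends in 0 by nilpotency.\<close>

lemma nexp_add:
  assumes E: "bnd n E" and nil: "mpow n E (Suc N) = 0"
  shows "nexp n N E (s + t) = nexp n N E s * nexp n N E t"
proof -
  let ?u = "nexp n N E"
  define g where "g t = ?u (s + t) - ?u s * ?u t" for t
  have bg: "bnd n (g t)" for t using E by (auto simp: g_def intro!: bnd_minus bnd_times bnd_nexp)
  have dg: "(g has_vector_derivative E * g t) (at t)" for t
  proof -
    have "((\<lambda>t. ?u (s + t)) has_vector_derivative E * ?u (s + t)) (at t)"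
    proof -
      have "((\<lambda>t. s + t) has_real_derivative 1) (at t)" by (auto intro!: derivative_eq_intros)
      then show ?thesis
        using vector_diff_chain_at[of "\<lambda>t. s + t" 1 t ?u "E * ?u (s + t)"] nexp_deriv[OF assms]
        by (simp add: o_def has_real_derivative_iff_has_vector_derivative)
    qed
    moreover have "((\<lambda>t. ?u s * ?u t) has_vector_derivative ?u s * (E * ?u t)) (at t)"
      by (rule bounded_linear.has_vector_derivative[OF bounded_linear_mult_right nexp_deriv[OF assms]])
    ultimately have "(g has_vector_derivative E * ?u (s + t) - ?u s * (E * ?u t)) (at t)"
      unfolding g_def by (rule has_vector_derivative_diff)
    moreover have "?u s * (E * ?u t) = E * (?u s * ?u t)"
      by (simp only: mult.assoc[symmetric] nexp_commute[OF E, of N s])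
    ultimately show ?thesis by (simp add: g_def right_diff_distrib)
  qed
  have "g t = 0" for t
  proof -
    have "mpow n E 0 * g t = 0"
    proof (rule derivative_chain_zero[of "\<lambda>m t. mpow n E m * g t" "Suc N"])
      fix m and s :: real
      have "((\<lambda>t. mpow n E m * g t) has_vector_derivative mpow n E m * (E * g s)) (at s)"
        by (rule bounded_linear.has_vector_derivative[OF bounded_linear_mult_right dg])
      then show "((\<lambda>t. mpow n E m * g t) has_vector_derivative mpow n E (Suc m) * g s) (at s)"
        by (simp add: mult.assoc[symmetric] mpow_commute[OF E])
      show "mpow n E m * g 0 = 0" using E by (simp add: g_def nexp_zero bnd_nexp)
      show "mpow n E (Suc N) * g s = 0" by (simp add: nil del: mpow.simps)
    qed
    then show ?thesis using bg by simp
  qed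
  then show ?thesis by (simp add: g_def)
qed

lemma nexp_polyf: "polyf (\<lambda>s. nexp n N E (r * s))"
proof -
  have "nexp n N E (r * s) = (\<Sum>j\<le>N. s ^ j *\<^sub>R ((r ^ j / fact j) *\<^sub>R mpow n E j))" for s
    unfolding nexp_def by (intro sum.cong) (auto simp: power_mult_distrib)
  then show ?thesis by (simp only:) (intro polyf_sum polyf_monom)
qed

lemma nexp_leading:
  assumes "\<kappa> \<noteq> 0"
  shows "((\<lambda>s. (1 / s ^ N) *\<^sub>R nexp n N E (\<kappa> * s)) \<longlongrightarrow> (\<kappa> ^ N / fact N) *\<^sub>R mpow n E N) at_top"
proof -
  have lim: "((\<lambda>s::real. s ^ j / s ^ N) \<longlongrightarrow> (if j = N then 1 else 0)) at_top" if "j \<le> N" for j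
  proof (cases "j = N")
    case True
    have "\<forall>\<^sub>F s in at_top. s ^ j / s ^ N = (1::real)"
      using eventually_gt_at_top[of 0] by eventually_elim (simp add: True)
    then show ?thesis using True by (auto intro: tendsto_eventually)
  next
    case False
    then have "filterlim (\<lambda>s::real. s ^ (N - j)) at_top at_top"
      using that by (intro filterlim_pow_at_top filterlim_ident) auto
    then have "((\<lambda>s::real. inverse (s ^ (N - j))) \<longlongrightarrow> 0) at_top"
      by (rule tendsto_inverse_0_at_top)
    moreover have "\<forall>\<^sub>F s in at_top. inverse (s ^ (N - j)) = s ^ j / (s ^ N :: real)"
      using eventually_gt_at_top[of 0] by eventually_elim (use that in \<open>simp add: power_diff divide_inverse\<close>)
    ultimately show ?thesis using False by (simp add: filterlim_cong)
  qed
  have "((\<lambda>s. \<Sum>j\<le>N. (\<kappa> ^ j / fact j * (s ^ j / s ^ N)) *\<^sub>R mpow n E j) \<longlongrightarrow>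
      (\<Sum>j\<le>N. (\<kappa> ^ j / fact j * (if j = N then 1 else 0)) *\<^sub>R mpow n E j)) at_top"
    by (intro tendsto_intros lim) auto
  moreover have "(\<Sum>j\<le>N. (\<kappa> ^ j / fact j * (s ^ j / s ^ N)) *\<^sub>R mpow n E j) = (1 / s ^ N) *\<^sub>R nexp n N E (\<kappa> * s)" for s
    unfolding nexp_def scaleR_sum_right by (intro sum.cong) (auto simp: power_mult_distrib)
  moreover have "(\<Sum>j\<le>N. (\<kappa> ^ j / fact j * (if j = N then 1 else 0)) *\<^sub>R mpow n E j)
      = (\<Sum>j\<le>N. if j = N then (\<kappa> ^ N / fact N) *\<^sub>R mpow n E N else 0)"
    by (intro sum.cong) auto
  ultimately show ?thesis by simp
qed

section \<open>Words in exponentials of a nilpotent matrix and its adjoint\<close>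

definition word_prod :: "nat \<Rightarrow> ('l \<Rightarrow> fmat) \<Rightarrow> 'l list \<Rightarrow> fmat" where
  "word_prod n f w = foldr (\<lambda>l g. f l * g) w (Idm n)"

text \<open>The inverses \<open>x'\<close> and \<open>y'\<close> are separate arguments because they
  are adjoints for elements of \<open>K\<close> but \<open>nexp\<close> at \<open>- s\<close> for
  the exponentials.\<close>

definition letters :: "fmat \<Rightarrow> fmat \<Rightarrow> fmat \<Rightarrow> fmat \<Rightarrow> bool \<times> bool \<Rightarrow> fmat" where
  "letters x x' y y' = (\<lambda>(c, \<epsilon>). if c then (if \<epsilon> then x else x') else (if \<epsilon> then y else y'))"

lemma word_prod_simps [simp]:
  "word_prod n f [] = Idm n" "word_prod n f (l # w) = f l * word_prod n f w"
  by (simp_all add: word_prod_def)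

lemma word_prod_pexp: "\<exists>p. \<forall>x y. ev x y p = word_prod n (\<lambda>l. ev x y (f l)) w"
proof (induction w)
  case Nil
  show ?case by (intro exI[of _ "PConst (Idm n)"]) simp
next
  case (Cons l w)
  then obtain p where "\<forall>x y. ev x y p = word_prod n (\<lambda>l. ev x y (f l)) w" by blast
  then show ?case by (intro exI[of _ "PMul (f l) p"]) simp
qed

text \<open>As \<open>s\<close> tends to infinity, the product of a reduced word in \<open>exp (s E)\<close> and \<open>exp (s (adj E))\<close> is
  dominated by an alternating product of \<open>E^N\<close> and its adjoint, which is nonzero.\<close>

lemma reduced_word_nexp_leading:
  fixes E :: fmat and N n :: nat
  defines "F \<equiv> \<lambda>c. mpow n (if c then E else adj E) N"
    and "L \<equiv> \<lambda>s. letters (nexp n N E s) (nexp n N E (- s)) (nexp n N (adj E) s) (nexp n N (adj E) (- s))"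
  assumes E: "bnd n E" "mpow n E (Suc N) = 0" "mpow n E N \<noteq> 0"
    and w: "reduced_word w" "w \<noteq> []"
  shows "\<exists>\<kappa> d C Q. (\<kappa> > 0 \<longleftrightarrow> snd (hd w)) \<and> \<kappa> \<noteq> 0
      \<and> (\<forall>s. word_prod n (L s) w = nexp n N (if fst (hd w) then E else adj E) (\<kappa> * s) * Q s)
      \<and> ((\<lambda>s. (1 / s ^ d) *\<^sub>R Q s) \<longlongrightarrow> C) at_top \<and> F (fst (hd w)) * C \<noteq> 0"
  using w
proof (induction w)
  case (Cons l w)
  obtain c \<epsilon> where l: "l = (c, \<epsilon>)" by fastforce
  define U where "U c = (if c then E else adj E)" for c
  have adjF: "adj (F c) = F (\<not> c)" for c
  proof -
    have "mpow n (adj E) j = adj (mpow n E j)" for j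
      by (induction j) (use mpow_commute[OF bnd_adj[OF E(1)]] mpow_commute[OF E(1)] in auto)
    then show ?thesis by (simp add: F_def)
  qed
  have bU: "bnd n (U c)" for c using E(1) by (simp add: U_def bnd_adj)
  have F0: "F c \<noteq> 0" for c using adjF[of c] E(3) by (cases c) (auto simp: F_def)
  have nilU: "mpow n (U c) (Suc N) = 0" for c
  proof -
    have "mpow n (adj E) j = adj (mpow n E j)" for j
      by (induction j) (use mpow_commute[OF bnd_adj[OF E(1)]] mpow_commute[OF E(1)] in auto)
    then show ?thesis using E(2) by (simp add: U_def del: mpow.simps)
  qed
  define \<sigma> :: real where "\<sigma> = (if \<epsilon> then 1 else - 1)"
  have Ll: "L s l = nexp n N (U c) (\<sigma> * s)" for s
    by (simp add: L_def l letters_def U_def \<sigma>_def)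
  have bF: "bnd n (F c)" for c using bU by (simp add: F_def U_def bnd_mpow)
  show ?case
  proof (cases w)
    case Nil
    have "word_prod n (L s) [l] = nexp n N (U c) (\<sigma> * s) * Idm n" for s
      by (simp add: Ll)
    moreover have "F c * Idm n \<noteq> 0" using F0 bF by simp
    ultimately show ?thesis
      by (intro exI[of _ \<sigma>] exI[of _ 0] exI[of _ "Idm n"] exI[of _ "\<lambda>_. Idm n"])
        (auto simp: l Nil U_def \<sigma>_def)
  next
    case (Cons m w')
    obtain c' \<epsilon>' where m: "m = (c', \<epsilon>')" by fastforce
    have red: "reduced_word w" "c = c' \<Longrightarrow> \<epsilon> = \<epsilon>'"
      using Cons.prems(1) by (auto simp: reduced_word_def Cons l m)
    obtain \<kappa> d C Q where IH: "\<kappa> > 0 \<longleftrightarrow> \<epsilon>'" "\<kappa> \<noteq> 0"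
      "\<And>s. word_prod n (L s) w = nexp n N (U c') (\<kappa> * s) * Q s"
      "((\<lambda>s. (1 / s ^ d) *\<^sub>R Q s) \<longlongrightarrow> C) at_top" "F c' * C \<noteq> 0"
      using Cons.IH[OF red(1)] by (auto simp: Cons m U_def)
    show ?thesis
    proof (cases "c = c'")
      case True
      \<comment> \<open>The new letter joins the first syllable. Reducedness gives
        \<open>\<sigma>\<close> and \<open>\<kappa>\<close> the same sign, so the exponents cannot
        cancel.\<close>
      have "word_prod n (L s) (l # w) = nexp n N (U c) ((\<sigma> + \<kappa>) * s) * Q s" for s
        using nexp_add[OF bU nilU, of c "\<sigma> * s" "\<kappa> * s"]
        by (simp add: IH(3) Ll True distrib_right mult.assoc)
      moreover have "(\<sigma> + \<kappa> > 0 \<longleftrightarrow> \<epsilon>) \<and> \<sigma> + \<kappa> \<noteq> 0"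
        using IH(1,2) red(2)[OF True] by (auto simp: \<sigma>_def)
      ultimately show ?thesis using IH(4,5) True
        by (intro exI[of _ "\<sigma> + \<kappa>"] exI[of _ d] exI[of _ C] exI[of _ Q]) (auto simp: l U_def)
    next
      case False
      define Q' where "Q' s = nexp n N (U c') (\<kappa> * s) * Q s" for s
      define C' where "C' = (\<kappa> ^ N / fact N) *\<^sub>R (F c' * C)"
      have "((\<lambda>s. ((1 / s ^ N) *\<^sub>R nexp n N (U c') (\<kappa> * s)) * ((1 / s ^ d) *\<^sub>R Q s)) \<longlongrightarrow>
          ((\<kappa> ^ N / fact N) *\<^sub>R F c') * C) at_top"
        unfolding F_def U_def[symmetric] by (intro tendsto_mult nexp_leading IH)
      then have lim: "((\<lambda>s. (1 / s ^ (N + d)) *\<^sub>R Q' s) \<longlongrightarrow> C') at_top"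
        by (simp add: Q'_def C'_def power_add mult.commute[of "_ ^ N :: real"])
      \<comment> \<open>The reason for pairing \<open>E\<close> with its adjoint: \<open>F c\<close>
        is the adjoint of \<open>F c'\<close>, so a vanishing product would make the norm of
        \<open>F c' * C\<close> zero.\<close>
      have "F c * (F c' * C) \<noteq> 0"
      proof
        assume "F c * (F c' * C) = 0"
        moreover have "inner (F c' * C) (F c' * C) = inner C (F c * (F c' * C))"
          using False adjF[of c'] by (cases c; cases c') (simp_all add: inner_mult_left)
        ultimately show False using IH(5) by simp
      qed
      then have "F c * C' \<noteq> 0" using IH(2) by (simp add: C'_def)
      moreover have "word_prod n (L s) (l # w) = nexp n N (U c) (\<sigma> * s) * Q' s" for s
        by (simp add: IH(3) Ll Q'_def)
      ultimately show ?thesis using lim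
        by (intro exI[of _ \<sigma>] exI[of _ "N + d"] exI[of _ C'] exI[of _ Q']) (auto simp: l U_def \<sigma>_def)
    qed
  qed
qed simp

text \<open>Divided by \<open>s ^ (N + d)\<close>, the identity tends to 0 because
  \<open>N \<noteq> 0\<close>, whereas the word tends to its nonzero leading coefficient.\<close>

lemma reduced_word_nexp_not_one:
  assumes E: "bnd n E" "mpow n E (Suc N) = 0" "mpow n E N \<noteq> 0" "N \<noteq> 0"
    and w: "reduced_word w" "w \<noteq> []"
  shows "\<exists>s. word_prod n (letters (nexp n N E s) (nexp n N E (- s)) (nexp n N (adj E) s) (nexp n N (adj E) (- s))) w
    \<noteq> Idm n"
proof (rule ccontr)
  assume "\<not> ?thesis"
  then have one: "word_prod n (letters (nexp n N E s) (nexp n N E (- s)) (nexp n N (adj E) s) (nexp n N (adj E) (- s))) w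
    = Idm n" for s by blast
  define U where "U = (if fst (hd w) then E else adj E)"
  obtain \<kappa> d C Q where Q: "\<kappa> \<noteq> 0" "\<And>s. Idm n = nexp n N U (\<kappa> * s) * Q s"
      "((\<lambda>s. (1 / s ^ d) *\<^sub>R Q s) \<longlongrightarrow> C) at_top" "mpow n U N * C \<noteq> 0"
    using reduced_word_nexp_leading[OF E(1-3) w] unfolding one U_def by blast
  have "((\<lambda>s. ((1 / s ^ N) *\<^sub>R nexp n N U (\<kappa> * s)) * ((1 / s ^ d) *\<^sub>R Q s)) \<longlongrightarrow>
      ((\<kappa> ^ N / fact N) *\<^sub>R mpow n U N) * C) at_top"
    by (intro tendsto_mult nexp_leading Q)
  then have lim: "((\<lambda>s::real. (1 / s ^ (N + d)) *\<^sub>R Idm n) \<longlongrightarrow> (\<kappa> ^ N / fact N) *\<^sub>R (mpow n U N * C)) at_top"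
    by (simp add: Q(2)[symmetric] power_add mult.commute[of "_ ^ N :: real"])
  have "filterlim (\<lambda>s::real. s ^ (N + d)) at_top at_top"
    using E(4) by (intro filterlim_pow_at_top filterlim_ident) auto
  then have "((\<lambda>s::real. 1 / s ^ (N + d)) \<longlongrightarrow> 0) at_top"
    using tendsto_inverse_0_at_top by (simp add: inverse_eq_divide)
  then have "((\<lambda>s::real. (1 / s ^ (N + d)) *\<^sub>R Idm n) \<longlongrightarrow> 0 *\<^sub>R Idm n) at_top"
    by (intro tendsto_scaleR tendsto_const)
  then have "(\<kappa> ^ N / fact N) *\<^sub>R (mpow n U N * C) = 0 *\<^sub>R Idm n"
    using tendsto_unique[OF _ lim] by simp
  then show False using Q(1,4) by simp
qed

section \<open>The tangent algebra and polynomial continuation\<close>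

context unitary_group
begin

definition liealg :: "fmat set" where "liealg = span {X. tangent X}"

lemma liealg_subspace: "subspace liealg" by (simp add: liealg_def)

lemma liealg_bnd: "A \<in> liealg \<Longrightarrow> bnd n A"
  unfolding liealg_def by (induction rule: span_induct) (auto simp: subspace_def bnd_simps tangent_bnd)

lemma tangent_skew: assumes "tangent X" shows "adj X = - X"
proof -
  obtain k \<epsilon> where k: "\<And>j. k j \<in> K" "\<And>j. \<epsilon> j > 0" "k \<longlonglongrightarrow> e" "(\<lambda>j. (1 / \<epsilon> j) *\<^sub>R (k j - e)) \<longlonglongrightarrow> X"
    using assms unfolding tangent_def by blast
  have "(k j - e) + adj (k j - e) = - ((k j - e) * adj (k j - e))" for j
    using k(1)[of j] by (simp add: algebra_simps adj_right bndK adjK)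
  then have eq: "(1 / \<epsilon> j) *\<^sub>R (k j - e) + adj ((1 / \<epsilon> j) *\<^sub>R (k j - e))
      = - (((1 / \<epsilon> j) *\<^sub>R (k j - e)) * adj (k j - e))" for j
    by (simp only: adj_simps scaleR_add_right[symmetric] mult_scaleR_left scaleR_minus_right)
  have "(\<lambda>j. (1 / \<epsilon> j) *\<^sub>R (k j - e) + adj ((1 / \<epsilon> j) *\<^sub>R (k j - e))) \<longlonglongrightarrow> X + adj X"
    by (intro tendsto_intros k)
  moreover have "(\<lambda>j. - (((1 / \<epsilon> j) *\<^sub>R (k j - e)) * adj (k j - e))) \<longlonglongrightarrow> - (X * adj (e - e))"
    by (intro tendsto_intros k)
  ultimately have "X + adj X = - (X * adj (e - e))" unfolding eq by (rule LIMSEQ_unique)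
  then show ?thesis by (simp add: add_eq_0_iff)
qed

lemma liealg_skew: "A \<in> liealg \<Longrightarrow> adj A = - A"
  unfolding liealg_def by (induction rule: span_induct) (auto simp: subspace_def tangent_skew)

text \<open>Finitely many coordinates with respect to a maximal orthonormal family determine an
  element, and the expansion passes to the limit.\<close>

lemma liealg_closed:
  assumes "\<And>j. x j \<in> liealg" "x \<longlonglongrightarrow> y" shows "y \<in> liealg"
proof -
  interpret inner_form inner liealg by (rule inner_form_inner[OF liealg_subspace])
  obtain d u where u: "onf inner liealg d u" "\<And>u. \<not> onf inner liealg (Suc d) u"
    using maximal_onf_exists[of inner liealg "2 * n * n"] onf_fmat_bound liealg_bnd by metis
  have "(\<lambda>j. \<Sum>i<d. inner (x j) (u i) *\<^sub>R u i) \<longlonglongrightarrow> (\<Sum>i<d. inner y (u i) *\<^sub>R u i)"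
    by (intro tendsto_intros assms)
  moreover have "(\<lambda>j. \<Sum>i<d. inner (x j) (u i) *\<^sub>R u i) = x"
    using maximal_onf_expands[OF u assms(1)] by (simp add: fun_eq_iff)
  ultimately have "y = (\<Sum>i<d. inner y (u i) *\<^sub>R u i)" using assms(2) LIMSEQ_unique by metis
  also have "\<dots> \<in> liealg" using u by (intro sum_in) (auto simp: onf_def)
  finally show ?thesis .
qed

lemma liealg_conj: assumes "A \<in> liealg" "b \<in> K" shows "b * A * adj b \<in> liealg"
  using assms(1) unfolding liealg_def
proof (induction rule: span_induct)
  case (step X)
  then show ?case using tangent_conj[OF _ assms(2)] by (auto intro: span_base)
next
  case base
  show ?case
    by (auto simp: subspace_def algebra_simps intro: span_zero span_add span_scale)
qed

text \<open>The commutator is the derivative at \<open>e\<close> of \<open>k * A * adj k\<close>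
  along a sequence defining \<open>X\<close>. The difference quotients stay in the closed space
  \<open>liealg\<close>.\<close>

lemma liealg_bracket: assumes "tangent X" "A \<in> liealg" shows "X * A - A * X \<in> liealg"
proof -
  obtain k \<epsilon> where k: "\<And>j. k j \<in> K" "\<And>j. \<epsilon> j > 0" "k \<longlonglongrightarrow> e" "(\<lambda>j. (1 / \<epsilon> j) *\<^sub>R (k j - e)) \<longlonglongrightarrow> X"
    using assms(1) unfolding tangent_def by blast
  have A: "bnd n A" by (rule liealg_bnd[OF assms(2)])
  have lim: "(\<lambda>j. (1 / \<epsilon> j) *\<^sub>R (k j - e) * A * adj (k j) + A * adj ((1 / \<epsilon> j) *\<^sub>R (k j - e)))
      \<longlonglongrightarrow> X * A * adj e + A * adj X"
    by (intro tendsto_intros k)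
  have eq: "(1 / \<epsilon> j) *\<^sub>R (k j - e) * A * adj (k j) + A * adj ((1 / \<epsilon> j) *\<^sub>R (k j - e))
      = (1 / \<epsilon> j) *\<^sub>R (k j * A * adj (k j) - A)" for j
    using A k(1)[of j] by (simp add: algebra_simps)
  have mem: "(1 / \<epsilon> j) *\<^sub>R (k j * A * adj (k j) - A) \<in> liealg" for j
    by (intro subspace_scale subspace_diff liealg_subspace liealg_conj assms k)
  have "X * A * adj e + A * adj X \<in> liealg"
    by (rule liealg_closed[OF _ lim]) (simp only: eq mem)
  then show ?thesis using A tangent_bnd[OF assms(1)] by (simp add: tangent_skew[OF assms(1)] bnd_times)
qed

text \<open>If tangent vectors commuted with each other, \<open>commute_of_tangent\<close> would
  make \<open>K\<close> commute with every tangent vector, and a second application, with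
  \<open>l\<close> in the role of \<open>A\<close>, would make \<open>K\<close> commutative.\<close>

lemma noncommuting_tangents:
  assumes "k \<in> K" "l \<in> K" "k * l \<noteq> l * k"
  obtains X A where "tangent X" "tangent A" "X * A \<noteq> A * X"
proof (rule ccontr)
  note th = that
  assume neg: "\<not> thesis"
  have comm: "X * A = A * X" if "tangent X" "tangent A" for X A using th[OF that] neg by blast
  have "k * A = A * k" if "tangent A" "k \<in> K" for k A
    using commute_of_tangent[OF tangent_bnd[OF that(1)] comm[OF _ that(1)] that(2)] .
  then have "k * l = l * k"
    using commute_of_tangent[OF bndK[OF assms(2)], of k] assms(1,2) by metis
  then show False using assms(3) by simp
qed

text \<open>\<open>T\<close> is the adjoint action of \<open>X\<close>, skew for the inner product,
  and nonzero on the tangent algebra. A unit vector \<open>A\<close> at which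
  \<open>norm (T A)\<close> is maximal spans with \<open>T A\<close> a plane on which
  \<open>T\<close> acts as a rotation, which gives a complex eigenvector \<open>E\<close> of
  eigenvalue \<open>\<i> * M\<close>. It is a root vector, and its powers are eigenvectors of
  growing eigenvalue, so they must vanish eventually.\<close>

lemma nilpotent_in_complexification:
  assumes "k \<in> K" "l \<in> K" "k * l \<noteq> l * k"
  obtains A C E N where "A \<in> liealg" "C \<in> liealg" "E = A + cs \<i> C" "N \<noteq> 0" "mpow n E N \<noteq> 0" "mpow n E (Suc N) = 0"
proof -
  obtain X A0 where X: "tangent X" "tangent A0" "X * A0 \<noteq> A0 * X" using noncommuting_tangents[OF assms] by metis
  define T where "T A = X * A - A * X" for A
  have T_in: "T A \<in> liealg" if "A \<in> liealg" for A unfolding T_def using liealg_bracket[OF X(1) that] .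
  have T_lin: "T (A + B) = T A + T B" "T (r *\<^sub>R A) = r *\<^sub>R T A" for A B r
    by (auto simp: T_def algebra_simps)
  have T_skew: "inner (T A) B = - inner A (T B)" for A B
    using inner_mult_left[of X A B] inner_mult_right[of A X B] tangent_skew[OF X(1)]
    by (simp add: T_def inner_diff_left inner_diff_right)
  define S where "S = {A\<in>liealg. norm A = 1}"
  have A0: "A0 \<in> liealg" using X(2) by (auto simp: liealg_def intro: span_base)
  have A0': "T A0 \<noteq> 0" "A0 \<noteq> 0" using X(3) by (auto simp: T_def)
  have "compact S"
    unfolding compact_def
  proof (intro allI impI)
    fix f :: "nat \<Rightarrow> fmat" assume f: "\<forall>j. f j \<in> S"
    obtain r L where r: "strict_mono (r::nat\<Rightarrow>nat)" "(f \<circ> r) \<longlonglongrightarrow> L"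
      by (rule fmat_bounded_subseq[of n f 1]) (use f in \<open>auto simp: S_def liealg_bnd\<close>)
    have "L \<in> liealg" using liealg_closed[OF _ r(2)] f by (simp add: S_def)
    moreover have "norm L = 1"
      using tendsto_norm[OF r(2)] f by (simp add: S_def o_def LIMSEQ_const_iff)
    ultimately show "\<exists>l\<in>S. \<exists>r. strict_mono (r::nat\<Rightarrow>nat) \<and> (f \<circ> r) \<longlonglongrightarrow> l" using r by (auto simp: S_def)
  qed
  moreover have "(1 / norm A0) *\<^sub>R A0 \<in> S" using A0 A0' by (auto simp: S_def subspace_scale[OF liealg_subspace])
  moreover have "continuous_on S (\<lambda>A. norm (T A))" unfolding T_def by (intro continuous_intros)
  ultimately obtain A where A: "A \<in> S" "\<And>B. B \<in> S \<Longrightarrow> norm (T B) \<le> norm (T A)"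
    using continuous_attains_sup[of S "\<lambda>A. norm (T A)"] by blast
  define M where "M = norm (T A)"
  have AL: "A \<in> liealg" "norm A = 1" using A(1) by (auto simp: S_def)
  have le: "norm (T B) \<le> M * norm B" if B: "B \<in> liealg" for B
  proof (cases "B = 0")
    case False
    have "norm (T ((1 / norm B) *\<^sub>R B)) \<le> M"
      unfolding M_def by (rule A(2)) (use B False in \<open>auto simp: S_def subspace_scale[OF liealg_subspace]\<close>)
    then show ?thesis using False by (simp add: T_lin field_simps)
  qed (simp add: T_def)
  have M: "M > 0"
  proof -
    have "0 < norm (T A0)" using A0' by simp
    also have "\<dots> \<le> M * norm A0" by (rule le[OF A0])
    finally show ?thesis by (simp add: zero_less_mult_iff)
  qed
  \<comment> \<open>The equality case of Cauchy-Schwarz: \<open>inner (T (T A)) A\<close> is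
    \<open>- M^2\<close> while \<open>T (T A)\<close> has norm at most \<open>M^2\<close>, so
    expanding the square leaves nothing.\<close>
  have TT: "T (T A) = - (M\<^sup>2 *\<^sub>R A)"
  proof -
    have "norm (T (T A)) \<le> M * M" using le[OF T_in[OF AL(1)]] by (simp add: M_def)
    then have "(norm (T (T A)))\<^sup>2 \<le> (M * M)\<^sup>2" by (intro power_mono) auto
    moreover have "inner (T (T A)) A = - M\<^sup>2" by (simp add: T_skew M_def power2_norm_eq_inner)
    moreover have "(norm (T (T A) + M\<^sup>2 *\<^sub>R A))\<^sup>2 = (norm (T (T A)))\<^sup>2 + 2 * M\<^sup>2 * inner (T (T A)) A + (M\<^sup>2)\<^sup>2 * (norm A)\<^sup>2"
      unfolding power2_norm_eq_inner
      using inner_commute[of A "T (T A)"] by (simp add: inner_add_left inner_add_right power2_eq_square distrib_left mult.assoc)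
    ultimately have "(norm (T (T A) + M\<^sup>2 *\<^sub>R A))\<^sup>2 \<le> 0"
      by (simp add: AL power2_eq_square algebra_simps)
    then show ?thesis by (simp add: add_eq_0_iff)
  qed
  define C where "C = - (1 / M) *\<^sub>R T A"
  have C: "C \<in> liealg" unfolding C_def by (intro subspace_scale[OF liealg_subspace] T_in AL)
  define E where "E = A + cs \<i> C"
  have bE: "bnd n E" unfolding E_def by (intro bnd_plus bnd_cs liealg_bnd AL C)
  have XE: "X * E - E * X = cs (\<i> * of_real M) E"
  proof -
    have "X * E - E * X = T A + cs \<i> (T C)"
      by (simp add: E_def T_def algebra_simps cs_mult cs_simps)
    also have "T C = M *\<^sub>R A" using M by (simp only: C_def T_lin TT) (simp add: power2_eq_square)
    also have "T A + cs \<i> (M *\<^sub>R A) = cs (\<i> * of_real M) E"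
      using M by (intro fmat_eqI) (simp add: E_def C_def algebra_simps)
    finally show ?thesis .
  qed
  have bX: "bnd n X" using tangent_bnd[OF X(1)] .
  have XEm: "X * mpow n E m - mpow n E m * X = cs (\<i> * of_real (m * M)) (mpow n E m)" for m
  proof (induction m)
    case 0 then show ?case using bX by (simp add: cs_simps)
  next
    case (Suc m)
    have "X * mpow n E (Suc m) - mpow n E (Suc m) * X
        = (X * E - E * X) * mpow n E m + E * (X * mpow n E m - mpow n E m * X)"
      by (simp add: algebra_simps)
    also have "\<dots> = cs (\<i> * of_real M) (E * mpow n E m) + cs (\<i> * of_real (m * M)) (E * mpow n E m)"
      unfolding XE Suc cs_mult ..
    also have "\<dots> = cs (\<i> * of_real (Suc m * M)) (mpow n E (Suc m))"
      unfolding cs_simps(3)[symmetric] by (simp add: algebra_simps)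
    finally show ?case .
  qed
  \<comment> \<open>\<open>A\<close> is skew while \<open>cs \<i> C\<close> is self-adjoint, so
    \<open>E\<close> can vanish only if \<open>A\<close> does.\<close>
  have "A \<noteq> - cs \<i> C"
  proof
    assume eq: "A = - cs \<i> C"
    then have "adj A = adj (- cs \<i> C)" by simp
    then have "A = cs \<i> C" using liealg_skew[OF AL(1)] liealg_skew[OF C] by (simp add: cs_simps)
    with eq have "A + A = 0" by (metis add.right_inverse)
    then have "2 *\<^sub>R A = 0" by (simp add: scaleR_2)
    then show False using AL(2) by auto
  qed
  then have E0: "E \<noteq> 0" by (simp add: E_def eq_neg_iff_add_eq_0)
  \<comment> \<open>The commutator with \<open>X\<close> has operator norm at most
    \<open>2 * norm X\<close>, so for this \<open>m\<close> the number \<open>m * M\<close> is too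
    large for the modulus of an eigenvalue.\<close>
  obtain m where m: "real m * M > 2 * norm X" using reals_Archimedean3[OF M] by (metis)
  have Em: "mpow n E m = 0"
  proof (rule ccontr)
    assume ne: "mpow n E m \<noteq> 0"
    have "real m * M * norm (mpow n E m) = norm (X * mpow n E m - mpow n E m * X)"
      unfolding XEm using M by (simp add: norm_mult)
    also have "\<dots> \<le> norm (X * mpow n E m) + norm (mpow n E m * X)" by (rule norm_triangle_ineq4)
    also have "\<dots> \<le> norm X * norm (mpow n E m) + norm (mpow n E m) * norm X"
      by (intro add_mono norm_mult_ineq)
    also have "\<dots> = 2 * norm X * norm (mpow n E m)" by simp
    finally show False using m ne by simp
  qed
  \<comment> \<open>The exponent of the last nonzero power, as required for the truncation in
    \<open>nexp\<close>.\<close>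
  define N where "N = (LEAST m. mpow n E (Suc m) = 0)"
  have "m \<noteq> 0"
  proof
    assume "m = 0"
    then have "E = 0" using Em Idm_mult(1)[OF bE] by simp
    then show False using E0 by simp
  qed
  then have ex: "mpow n E (Suc (m - 1)) = 0" using Em by simp
  have N1: "mpow n E (Suc N) = 0" unfolding N_def by (rule LeastI[of "\<lambda>m. mpow n E (Suc m) = 0", OF ex])
  have "N \<noteq> 0"
  proof
    assume "N = 0" then show False using N1 E0 bE by simp
  qed
  moreover have "mpow n E N \<noteq> 0"
    using not_less_Least[of "N - 1" "\<lambda>m. mpow n E (Suc m) = 0"] \<open>N \<noteq> 0\<close> by (simp add: N_def[symmetric] del: mpow.simps)
  ultimately show thesis using that[OF AL(1) C E_def _ _ N1] by blast
qed

definition vanishes :: "pexp \<Rightarrow> bool" where "vanishes p \<longleftrightarrow> (\<forall>k\<in>K. ev k (adj k) p = 0)"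

text \<open>Difference quotients along \<open>x * k j\<close> are identically zero and converge to
  the left invariant derivative at \<open>x\<close>.\<close>

lemma vanishes_pd_tangent:
  assumes X: "tangent X" and p: "vanishes p" shows "vanishes (pd X p)"
  unfolding vanishes_def
proof
  fix x assume x: "x \<in> K"
  obtain k \<epsilon> where k: "\<And>j. k j \<in> K" "\<And>j. \<epsilon> j > 0" "k \<longlonglongrightarrow> e" "(\<lambda>j. (1 / \<epsilon> j) *\<^sub>R (k j - e)) \<longlonglongrightarrow> X"
    using X unfolding tangent_def by blast
  let ?v = "\<lambda>j. ev (x * k j) (adj (x * k j))" and ?w = "ev x (adj x)"
  have xe: "x * e = x" "adj e * adj x = adj x" using x by (auto simp: bndK adjK)
  have lim: "(\<lambda>j. ?v j p) \<longlonglongrightarrow> ?w p" for p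
  proof (induction p)
    case PX
    have "(\<lambda>j. x * k j) \<longlonglongrightarrow> x * e" by (intro tendsto_intros k)
    then show ?case by (simp add: xe)
  next
    case PI
    have "(\<lambda>j. adj (x * k j)) \<longlonglongrightarrow> adj (x * e)" by (intro tendsto_intros k)
    then show ?case by (simp add: xe)
  qed (auto intro: tendsto_intros)
  have "(\<lambda>j. (1 / \<epsilon> j) *\<^sub>R (?v j p - ?w p)) \<longlonglongrightarrow> ?w (pd X p)" for p
  proof (induction p)
    case PX
    have "(\<lambda>j. x * ((1 / \<epsilon> j) *\<^sub>R (k j - e))) \<longlonglongrightarrow> x * X" by (intro tendsto_intros k)
    then show ?case by (simp add: right_diff_distrib xe)
  next
    case PI
    have "(\<lambda>j. adj ((1 / \<epsilon> j) *\<^sub>R (k j - e)) * adj x) \<longlonglongrightarrow> adj X * adj x" by (intro tendsto_intros k)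
    then show ?case using xe by (simp add: left_diff_distrib tangent_skew[OF X])
  next
    case (PAdd p q)
    then show ?case using tendsto_add[OF PAdd] by (simp add: algebra_simps)
  next
    case (PMul p q)
    have "(\<lambda>j. ((1 / \<epsilon> j) *\<^sub>R (?v j p - ?w p)) * ?v j q + ?w p * ((1 / \<epsilon> j) *\<^sub>R (?v j q - ?w q)))
        \<longlonglongrightarrow> ?w (pd X p) * ?w q + ?w p * ?w (pd X q)"
      by (intro tendsto_intros PMul lim)
    then show ?case by (simp add: algebra_simps)
  qed simp
  from this[of p] have lim: "(\<lambda>j. (1 / \<epsilon> j) *\<^sub>R (?v j p - ?w p)) \<longlonglongrightarrow> ?w (pd X p)" .
  have "?v j p = 0" "?w p = 0" for j using p x k(1) multK by (auto simp: vanishes_def simp del: adj_mult)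
  then show "?w (pd X p) = 0" using lim by (simp add: LIMSEQ_const_iff del: adj_mult)
qed

lemma vanishes_pd_liealg:
  assumes "A \<in> liealg" and p: "vanishes p" shows "vanishes (pd A p)"
  using assms(1) unfolding liealg_def
proof (induction rule: span_induct)
  case (step X)
  then show ?case using vanishes_pd_tangent[OF _ p] by simp
next
  case base
  show ?case by (auto simp: subspace_def vanishes_def ev_pd_zero ev_pd_add ev_pd_scaleR)
qed

text \<open>All iterated derivatives of \<open>p\<close> in the complex direction \<open>E\<close>
  vanish at the unit. Along the curve \<open>nexp n N E\<close> the expression is a polynomial in
  \<open>s\<close> because \<open>E\<close> is nilpotent, hence it is zero. The curve itself need
  not stay in \<open>K\<close>.\<close>

lemma vanishes_at_nexp:
  assumes A: "A \<in> liealg" "C \<in> liealg" and nil: "mpow n (A + cs \<i> C) (Suc N) = 0" and p: "vanishes p"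
  shows "ev (nexp n N (A + cs \<i> C) s) (nexp n N (A + cs \<i> C) (- s)) p = 0"
proof -
  define E where "E = A + cs \<i> C"
  let ?u = "nexp n N E"
  have bE: "bnd n E" unfolding E_def by (intro bnd_plus bnd_cs liealg_bnd A)
  have van: "vanishes ((pd E ^^ m) p)" for m
  proof (induction m)
    case (Suc m)
    then show ?case
      using vanishes_pd_liealg[OF A(1) Suc] vanishes_pd_liealg[OF A(2) Suc]
      by (simp add: vanishes_def E_def ev_pd_add ev_pd_cs cs_simps)
  qed (simp add: p)
  have d1: "(?u has_vector_derivative ?u s * E) (at s)" for s
    using nexp_deriv[OF bE nil[folded E_def]] by (simp add: nexp_commute[OF bE])
  have d2: "((\<lambda>s. ?u (- s)) has_vector_derivative (- E) * ?u (- s)) (at s)" for s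
  proof -
    have "((\<lambda>s::real. - s) has_real_derivative - 1) (at s)" by (auto intro!: derivative_eq_intros)
    then show ?thesis
      using vector_diff_chain_at[of "\<lambda>s. - s" "- 1" s ?u "E * ?u (- s)"] nexp_deriv[OF bE nil[folded E_def]]
      by (simp add: o_def has_real_derivative_iff_has_vector_derivative)
  qed
  have deriv: "((\<lambda>s. ev (?u s) (?u (- s)) p) has_vector_derivative ev (?u s) (?u (- s)) (pd E p)) (at s)" for s p
  proof (induction p)
    case (PMul p q)
    then show ?case using has_vector_derivative_mult[OF PMul] by (simp add: algebra_simps)
  qed (use d1 d2 in \<open>auto intro: has_vector_derivative_add\<close>)
  have poly: "polyf (\<lambda>s. ev (?u s) (?u (- s)) p)" for p
  proof (induction p)
    case PX show ?case using nexp_polyf[of n N E 1] by simp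
  next
    case PI show ?case using nexp_polyf[of n N E "- 1"] by simp
  qed (auto intro: polyf_const polyf_add polyf_mult)
  have "ev (?u s) (?u (- s)) ((pd E ^^ 0) p) = 0"
  proof (rule derivative_chain_polyf_zero[of "\<lambda>m s. ev (?u s) (?u (- s)) ((pd E ^^ m) p)"])
    show "((\<lambda>s. ev (?u s) (?u (- s)) ((pd E ^^ m) p)) has_vector_derivative
        ev (?u s) (?u (- s)) ((pd E ^^ Suc m) p)) (at s)" for m s
      using deriv by simp
    show "ev (?u 0) (?u (- 0)) ((pd E ^^ m) p) = 0" for m
      using van[of m] eK by (auto simp: vanishes_def nexp_zero)
  qed (simp add: poly)
  then show ?thesis by (simp add: E_def)
qed

text \<open>The law is continued one variable at a time: \<open>x\<close> is replaced by an
  exponential while \<open>y\<close> still ranges over \<open>K\<close>, and afterwards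
  \<open>y\<close> is replaced as well.\<close>

lemma nonabelian_no_law:
  assumes kl: "k \<in> K" "l \<in> K" "k * l \<noteq> l * k" and w: "reduced_word w" "w \<noteq> []"
  shows "\<exists>x\<in>K. \<exists>y\<in>K. word_prod n (letters x (adj x) y (adj y)) w \<noteq> e"
proof (rule ccontr)
  assume "\<not> ?thesis"
  then have law: "word_prod n (letters x (adj x) y (adj y)) w = e" if "x \<in> K" "y \<in> K" for x y using that by blast
  obtain A C E N where E: "A \<in> liealg" "C \<in> liealg" "E = A + cs \<i> C" "N \<noteq> 0" "mpow n E N \<noteq> 0" "mpow n E (Suc N) = 0"
    using nilpotent_in_complexification[OF kl] .
  have bE: "bnd n E" unfolding E by (intro bnd_plus bnd_cs liealg_bnd E)
  \<comment> \<open>The adjoint again belongs to the complexification, so the continuation applies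
    to the second variable too.\<close>
  have E': "adj E = (- A) + cs \<i> C"
    unfolding E using liealg_skew[OF E(1)] liealg_skew[OF E(2)] by (simp add: cs_simps)
  have nil': "mpow n (adj E) (Suc N) = 0"
  proof -
    have "mpow n (adj E) j = adj (mpow n E j)" for j
      by (induction j) (use mpow_commute[OF bnd_adj[OF bE]] mpow_commute[OF bE] in auto)
    then show ?thesis using E(6) by (simp del: mpow.simps)
  qed
  have 1: "word_prod n (letters (nexp n N E s) (nexp n N E (- s)) y (adj y)) w = e" if y: "y \<in> K" for y s
  proof -
    obtain p where p: "\<And>x x'. ev x x' p = word_prod n (\<lambda>l. ev x x' (case l of (c, \<epsilon>) \<Rightarrow>
        if c then (if \<epsilon> then PX else PI) else PConst (if \<epsilon> then y else adj y))) w"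
      using word_prod_pexp[of n "\<lambda>l. case l of (c, \<epsilon>) \<Rightarrow>
        if c then (if \<epsilon> then PX else PI) else PConst (if \<epsilon> then y else adj y)" w] by blast
    have eq: "(\<lambda>l. ev x x' (case l of (c, \<epsilon>) \<Rightarrow>
        if c then (if \<epsilon> then PX else PI) else PConst (if \<epsilon> then y else adj y))) = letters x x' y (adj y)" for x x'
      by (auto simp: letters_def fun_eq_iff)
    have "vanishes (PAdd p (PConst (- e)))" using law[OF _ y] by (auto simp: vanishes_def p eq)
    from vanishes_at_nexp[OF E(1,2) E(6)[unfolded E] this, of s] show ?thesis by (simp add: p eq E(3))
  qed
  have "word_prod n (letters (nexp n N E s) (nexp n N E (- s)) (nexp n N (adj E) s) (nexp n N (adj E) (- s))) w = e" for s
  proof -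
    let ?x = "nexp n N E s" and ?x' = "nexp n N E (- s)"
    obtain p where p: "\<And>y y'. ev y y' p = word_prod n (\<lambda>l. ev y y' (case l of (c, \<epsilon>) \<Rightarrow>
        if c then PConst (if \<epsilon> then ?x else ?x') else (if \<epsilon> then PX else PI))) w"
      using word_prod_pexp[of n "\<lambda>l. case l of (c, \<epsilon>) \<Rightarrow>
        if c then PConst (if \<epsilon> then ?x else ?x') else (if \<epsilon> then PX else PI)" w] by blast
    have eq: "(\<lambda>l. ev y y' (case l of (c, \<epsilon>) \<Rightarrow>
        if c then PConst (if \<epsilon> then ?x else ?x') else (if \<epsilon> then PX else PI))) = letters ?x ?x' y y'" for y y'
      by (auto simp: letters_def fun_eq_iff)
    have v: "vanishes (PAdd p (PConst (- e)))" using 1 by (auto simp: vanishes_def p eq)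
    have "- A \<in> liealg" using E(1) by (rule subspace_neg[OF liealg_subspace])
    from vanishes_at_nexp[OF this E(2) nil'[unfolded E'] v, of s] show ?thesis by (simp add: p eq E')
  qed
  then show False using reduced_word_nexp_not_one[OF bE E(6,5,4) w] by blast
qed

end

section \<open>Continuous functions on a compact group\<close>

text \<open>Makes \<open>span\<close>, \<open>subspace\<close> and \<open>independent\<close>
  available for real-valued functions.\<close>

instantiation "fun" :: (type, real_vector) real_vector
begin
definition scaleR_fun :: "real \<Rightarrow> ('a \<Rightarrow> 'b) \<Rightarrow> 'a \<Rightarrow> 'b" where "scaleR_fun r f = (\<lambda>x. r *\<^sub>R f x)"
instance by standard (auto simp: scaleR_fun_def fun_eq_iff scaleR_add_right scaleR_add_left)
end

lemma scaleR_fun_apply [simp]: "(r *\<^sub>R f) x = r *\<^sub>R f x" by (simp add: scaleR_fun_def)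

lemma sum_fun_apply: "(\<Sum>i\<in>I. f i) x = (\<Sum>i\<in>I. f i x)"
  by (induction I rule: infinite_finite_induct) auto

lemma (in inner_form) cauchy_schwarz:
  assumes "x \<in> U" "y \<in> U" shows "(B x y)\<^sup>2 \<le> B x x * B y y"
proof (cases "y = 0")
  case True
  then show ?thesis using assms zero sym[of x 0] subspace_0[OF sub] by simp
next
  case False
  then have y: "B y y > 0" using nonneg[OF assms(2)] pos[OF assms(2)] by fastforce
  define w where "w = (1 / sqrt (B y y)) *\<^sub>R y"
  have w: "w \<in> U" unfolding w_def by (intro subspace_scale[OF sub] assms)
  have Bw: "B w z = (1 / sqrt (B y y)) * B y z" if "z \<in> U" for z
    unfolding w_def using scale[OF assms(2) that] .
  have "B w w = 1" using Bw[OF w] sym[OF assms(2) w] Bw[OF assms(2)] y by (simp add: field_simps)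
  then have "onf B U 1 (\<lambda>_. w)" using w by (simp add: onf_def)
  from bessel[OF this assms(1)] have "(B x w)\<^sup>2 \<le> B x x" by simp
  also have "B x w = B x y / sqrt (B y y)"
    using sym[OF assms(1) w] Bw[OF assms(1)] sym[OF assms] by simp
  finally show ?thesis using y by (simp add: power_divide field_simps)
qed

text \<open>Plays the part of uniform continuity: the tube lemma is applied to the open set where
  \<open>F\<close> differs from its values on the slice at \<open>x0\<close> by less than
  \<open>\<epsilon>\<close>.\<close>

lemma tube_uniform:
  assumes F: "continuous_map (prod_topology X Y) euclideanreal (\<lambda>(x, y). F x y)"
    and Y: "compact_space Y" and x0: "x0 \<in> topspace X" and \<epsilon>: "\<epsilon> > 0"
  obtains U where "openin X U" "x0 \<in> U" "\<And>x y. x \<in> U \<Longrightarrow> y \<in> topspace Y \<Longrightarrow> \<bar>F x y - F x0 y\<bar> < \<epsilon>"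
proof -
  have cont: "continuous_map (prod_topology X Y) euclideanreal (\<lambda>p. F (fst p) (snd p) - F x0 (snd p))"
  proof (rule continuous_map_diff)
    show "continuous_map (prod_topology X Y) euclideanreal (\<lambda>p. F (fst p) (snd p))"
      using F by (simp add: case_prod_unfold)
    have "continuous_map (prod_topology X Y) (prod_topology X Y) (\<lambda>p. (x0, snd p))"
      using x0 by (intro continuous_map_pairedI) (auto simp: continuous_map_snd)
    from continuous_map_compose[OF this F]
    show "continuous_map (prod_topology X Y) euclideanreal (\<lambda>p. F x0 (snd p))" by (simp add: o_def)
  qed
  define W where "W = {p \<in> topspace (prod_topology X Y). F (fst p) (snd p) - F x0 (snd p) \<in> {- \<epsilon><..<\<epsilon>}}"
  have "openin (prod_topology X Y) W"
    unfolding W_def by (rule openin_continuous_map_preimage[OF cont]) simp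
  moreover have "{x0} \<times> topspace Y \<subseteq> W" using x0 \<epsilon> by (auto simp: W_def)
  ultimately obtain U V where "openin X U" "x0 \<in> U" "topspace Y \<subseteq> V" "U \<times> V \<subseteq> W"
    using tube_lemma_right[of X Y W "topspace Y" x0] Y x0 unfolding compact_space_def by blast
  have "\<bar>F x y - F x0 y\<bar> < \<epsilon>" if "x \<in> U" "y \<in> topspace Y" for x y
  proof -
    have "(x, y) \<in> W" using that \<open>topspace Y \<subseteq> V\<close> \<open>U \<times> V \<subseteq> W\<close> by blast
    then show ?thesis by (auto simp: W_def)
  qed
  then show thesis using that \<open>openin X U\<close> \<open>x0 \<in> U\<close> by blast
qed

lemma sets_sigma_open: "sets (sigma (topspace X) {U. openin X U}) = sigma_sets (topspace X) {U. openin X U}"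
  by (rule sets_measure_of) (auto dest: openin_subset)

lemma space_of_sets_open:
  assumes "sets M = sigma_sets (topspace X) {U. openin X U}" shows "space M = topspace X"
  using sets_eq_imp_space_eq[of M "sigma (topspace X) {U. openin X U}"] assms sets_sigma_open[of X]
  by (simp add: space_measure_of_conv)

lemma continuous_map_measurable:
  assumes f: "continuous_map X Y f"
    and M: "sets M = sigma_sets (topspace X) {U. openin X U}"
    and N: "sets N = sigma_sets (topspace Y) {U. openin Y U}"
  shows "f \<in> measurable M N"
proof (rule measurable_sigma_sets[OF N])
  show "f \<in> space M \<rightarrow> topspace Y"
    using continuous_map_funspace[OF f] by (simp add: space_of_sets_open[OF M])
  fix U assume "U \<in> {U. openin Y U}"
  then have "openin X {x \<in> topspace X. f x \<in> U}" by (intro openin_continuous_map_preimage[OF f]) simp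
  also have "{x \<in> topspace X. f x \<in> U} = f -` U \<inter> space M" by (auto simp: space_of_sets_open[OF M])
  finally show "f -` U \<inter> space M \<in> sets M" unfolding M by (rule sigma_sets.Basic[OF CollectI])
qed (auto dest: openin_subset)

section \<open>Translations and continuous functions\<close>

context topological_group
begin

lemma continuous_map_mult_left: "g \<in> carrier G \<Longrightarrow> continuous_map T T (\<lambda>x. g \<otimes> x)"
  using continuous_map_compose[OF _ continuous_mult, of T "\<lambda>x. (g, x)"]
  by (simp add: o_def continuous_map_pairedI topspace_eq)

lemma continuous_map_compose_mult:
  assumes "continuous_map X T f" "continuous_map X T g"
  shows "continuous_map X T (\<lambda>x. f x \<otimes> g x)"
  using continuous_map_compose[OF continuous_map_pairedI[OF assms] continuous_mult] by (simp add: o_def)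

lemma continuous_map_compose_inv:
  "continuous_map X T f \<Longrightarrow> continuous_map X T (\<lambda>x. inv (f x))"
  using continuous_map_compose[OF _ continuous_inv] by (simp add: o_def)

lemma l_coset_preimage:
  assumes "g \<in> carrier G" "A \<subseteq> carrier G" shows "g <# A = {x \<in> carrier G. inv g \<otimes> x \<in> A}"
proof
  show "g <# A \<subseteq> {x \<in> carrier G. inv g \<otimes> x \<in> A}"
    using assms by (auto simp: l_coset_def m_assoc[symmetric] subset_iff)
  show "{x \<in> carrier G. inv g \<otimes> x \<in> A} \<subseteq> g <# A"
  proof
    fix x assume x: "x \<in> {x \<in> carrier G. inv g \<otimes> x \<in> A}"
    then have "x = g \<otimes> (inv g \<otimes> x)" using assms by (simp add: m_assoc[symmetric])
    then show "x \<in> g <# A" unfolding l_coset_def using x by blast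
  qed
qed

lemma openin_l_coset: "g \<in> carrier G \<Longrightarrow> openin T U \<Longrightarrow> openin T (g <# U)"
  using openin_continuous_map_preimage[OF continuous_map_mult_left[of "inv g"], of U] openin_subset[of T U]
  by (simp add: l_coset_preimage topspace_eq)

text \<open>Values outside the carrier are fixed to be 0, so that equality of functions means
  equality on the group and the L2 product becomes definite.\<close>

definition C0 :: "('a \<Rightarrow> real) set" where
  "C0 = {f. continuous_map T euclideanreal f \<and> (\<forall>x. x \<notin> carrier G \<longrightarrow> f x = 0)}"

definition ltrans :: "'a \<Rightarrow> ('a \<Rightarrow> real) \<Rightarrow> 'a \<Rightarrow> real" where
  "ltrans g f = (\<lambda>x. if x \<in> carrier G then f (inv g \<otimes> x) else 0)"

definition restr :: "('a \<Rightarrow> real) \<Rightarrow> 'a \<Rightarrow> real" where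
  "restr f = (\<lambda>x. if x \<in> carrier G then f x else 0)"

lemma restr_C0: "continuous_map T euclideanreal f \<Longrightarrow> restr f \<in> C0"
  unfolding C0_def restr_def
  by (auto intro: continuous_map_eq[of T _ f] simp: topspace_eq)

lemma C0_cont: "f \<in> C0 \<Longrightarrow> continuous_map T euclideanreal f" and C0_out: "f \<in> C0 \<Longrightarrow> x \<notin> carrier G \<Longrightarrow> f x = 0"
  by (auto simp: C0_def)

lemma C0_eqI: "f \<in> C0 \<Longrightarrow> h \<in> C0 \<Longrightarrow> (\<And>x. x \<in> carrier G \<Longrightarrow> f x = h x) \<Longrightarrow> f = h"
  unfolding C0_def fun_eq_iff by (metis (mono_tags, lifting) mem_Collect_eq)

lemma subspace_C0: "subspace C0"
  by (auto simp: C0_def subspace_def zero_fun_def plus_fun_def scaleR_fun_def intro: continuous_map_add continuous_map_real_mult)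

lemma ltrans_C0: assumes "f \<in> C0" "g \<in> carrier G" shows "ltrans g f \<in> C0"
proof -
  have "continuous_map T euclideanreal (\<lambda>x. f (inv g \<otimes> x))"
    using continuous_map_compose[OF continuous_map_mult_left C0_cont[OF assms(1)], of "inv g"] assms(2)
    by (simp add: o_def)
  from restr_C0[OF this] show ?thesis by (simp add: ltrans_def restr_def)
qed

lemma ltrans_add: "ltrans g (f + h) = ltrans g f + ltrans g h"
  and ltrans_scaleR: "ltrans g (r *\<^sub>R f) = r *\<^sub>R ltrans g f"
  by (auto simp: ltrans_def fun_eq_iff)

lemma ltrans_sum: "ltrans g (\<Sum>i\<in>I. f i) = (\<Sum>i\<in>I. ltrans g (f i))"
  by (auto simp: ltrans_def fun_eq_iff sum_fun_apply)

lemma ltrans_mult: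
  assumes "g \<in> carrier G" "h \<in> carrier G" shows "ltrans g (ltrans h f) = ltrans (g \<otimes> h) f"
  using assms by (auto simp: ltrans_def fun_eq_iff inv_mult_group m_assoc)

lemma ltrans_one: "f \<in> C0 \<Longrightarrow> ltrans \<one> f = f"
  by (auto simp: ltrans_def fun_eq_iff C0_def)

end

text \<open>Only finiteness, nontriviality and left invariance of the measure are recorded. These
  are what is established for the marginal measure to which the locale is applied later; outer
  regularity appears as an explicit hypothesis where it is used.\<close>

locale compact_group = topological_group G T for G :: "('a, 'b) monoid_scheme" (structure) and T :: "'a topology" +
  fixes M :: "'a measure"
  assumes compact_T: "compact_space T" and second_countable_T: "second_countable T"
    and sets_M: "sets M = sigma_sets (topspace T) {U. openin T U}"
    and finite_M: "emeasure M (space M) \<noteq> \<infinity>" and nonzero_M: "emeasure M (space M) \<noteq> 0"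
    and inv_M: "g \<in> carrier G \<Longrightarrow> A \<in> sets M \<Longrightarrow> emeasure M (g <# A) = emeasure M A"
begin

lemma space_M: "space M = carrier G"
  using space_of_sets_open[OF sets_M] topspace_eq by simp

sublocale finite_measure M by (rule finite_measureI) (use finite_M in simp)

lemma open_sets_M: "openin T U \<Longrightarrow> U \<in> sets M"
  unfolding sets_M by (rule sigma_sets.Basic) simp

lemma closed_sets_M: "closedin T C \<Longrightarrow> C \<in> sets M"
proof -
  assume C: "closedin T C"
  then have "C = space M - (topspace T - C)" using closedin_subset[OF C] by (auto simp: space_M topspace_eq)
  moreover have "topspace T - C \<in> sets M" using C by (intro open_sets_M) (simp add: closedin_def)
  ultimately show ?thesis by (metis sets.compl_sets)
qed

lemma continuous_measurable: "continuous_map T euclideanreal f \<Longrightarrow> f \<in> borel_measurable M"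
proof (rule borel_measurableI)
  fix S :: "real set" assume f: "continuous_map T euclideanreal f" and "open S"
  then have "openin T {x \<in> topspace T. f x \<in> S}" by (intro openin_continuous_map_preimage[OF f]) simp
  also have "{x \<in> topspace T. f x \<in> S} = f -` S \<inter> space M" by (auto simp: space_M topspace_eq)
  finally show "f -` S \<inter> space M \<in> sets M" by (rule open_sets_M)
qed

lemma continuous_bounded:
  assumes "continuous_map T euclideanreal f" obtains C where "C \<ge> 0" "\<And>x. x \<in> carrier G \<Longrightarrow> \<bar>f x\<bar> \<le> C"
proof -
  have "compactin euclideanreal (f ` topspace T)"
    using assms compact_T image_compactin compact_space_def by blast
  then have "bounded (f ` carrier G)" by (simp add: topspace_eq compact_imp_bounded)
  then obtain C where "\<And>x. x \<in> carrier G \<Longrightarrow> \<bar>f x\<bar> \<le> C" by (auto simp: bounded_iff)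
  then show thesis using one_closed by (intro that[of C]) (auto intro: order_trans[OF abs_ge_zero])
qed

lemma continuous_integrable: "continuous_map T euclideanreal f \<Longrightarrow> integrable M f"
proof -
  assume f: "continuous_map T euclideanreal f"
  obtain C where "\<And>x. x \<in> carrier G \<Longrightarrow> \<bar>f x\<bar> \<le> C" using continuous_bounded[OF f] by metis
  then show ?thesis
    by (intro integrable_const_bound[of _ C] continuous_measurable f) (auto simp: space_M)
qed

lemma translation_measurable: "g \<in> carrier G \<Longrightarrow> (\<lambda>x. g \<otimes> x) \<in> measurable M M"
  by (rule continuous_map_measurable[OF continuous_map_mult_left sets_M sets_M])

lemma translation_distr: "g \<in> carrier G \<Longrightarrow> distr M M (\<lambda>x. g \<otimes> x) = M"
proof (rule measure_eqI)
  assume g: "g \<in> carrier G"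
  fix A assume "A \<in> sets (distr M M (\<lambda>x. g \<otimes> x))"
  then have A: "A \<in> sets M" by simp
  have "emeasure (distr M M (\<lambda>x. g \<otimes> x)) A = emeasure M ((\<lambda>x. g \<otimes> x) -` A \<inter> space M)"
    using A g by (intro emeasure_distr translation_measurable)
  also have "(\<lambda>x. g \<otimes> x) -` A \<inter> space M = inv g <# A"
    using sets.sets_into_space[OF A] g by (subst l_coset_preimage) (auto simp: space_M)
  also have "emeasure M \<dots> = emeasure M A" using g A by (intro inv_M) auto
  finally show "emeasure (distr M M (\<lambda>x. g \<otimes> x)) A = emeasure M A" .
qed simp

lemma integral_translate:
  assumes "g \<in> carrier G" "continuous_map T euclideanreal f"
  shows "(\<integral>x. f (g \<otimes> x) \<partial>M) = (\<integral>x. f x \<partial>M)"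
  using integral_distr[OF translation_measurable[OF assms(1)] continuous_measurable[OF assms(2)]]
    translation_distr[OF assms(1)] by simp

text \<open>Finitely many translates of \<open>U\<close> cover the compact group, so a null
  \<open>U\<close> would make the whole measure zero.\<close>

lemma open_positive:
  assumes "openin T U" "U \<noteq> {}" shows "emeasure M U > 0"
proof (rule ccontr)
  assume "\<not> emeasure M U > 0"
  then have 0: "emeasure M U = 0" by simp
  have UG: "U \<subseteq> carrier G" using assms(1) openin_subset topspace_eq by blast
  obtain u where u: "u \<in> U" using assms(2) by blast
  define \<U> where "\<U> = (\<lambda>g. g <# U) ` carrier G"
  have "\<exists>\<F>. finite \<F> \<and> \<F> \<subseteq> \<U> \<and> topspace T \<subseteq> \<Union>\<F>"
  proof (rule compactinD[of T "topspace T"])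
    show "compactin T (topspace T)" using compact_T by (simp add: compact_space_def)
    show "openin T S" if "S \<in> \<U>" for S using that openin_l_coset assms(1) by (auto simp: \<U>_def)
    show "topspace T \<subseteq> \<Union>\<U>"
    proof
      fix x assume "x \<in> topspace T"
      then have x: "x \<in> carrier G" by (simp add: topspace_eq)
      have "x = (x \<otimes> inv u) \<otimes> u" using x u UG by (simp add: m_assoc subset_iff)
      then have "x \<in> (x \<otimes> inv u) <# U" using u by (auto simp: l_coset_def)
      then show "x \<in> \<Union>\<U>" using x u UG by (auto simp: \<U>_def)
    qed
  qed
  then obtain \<F> where F: "finite \<F>" "\<F> \<subseteq> \<U>" "topspace T \<subseteq> \<Union>\<F>" by blast
  have "S \<in> null_sets M" if "S \<in> \<F>" for S
  proof -
    have "S \<in> (\<lambda>g. g <# U) ` carrier G" using that F(2) unfolding \<U>_def by (rule subsetD[rotated])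
    then obtain g where g: "S = g <# U" "g \<in> carrier G" by (rule imageE)
    then show ?thesis using inv_M[OF g(2) open_sets_M[OF assms(1)]] 0 open_sets_M[OF openin_l_coset[OF g(2) assms(1)]]
      by (simp add: null_sets_def)
  qed
  then have "\<Union>\<F> \<in> null_sets M" using F(1) by (intro null_sets.finite_Union) auto
  then have "emeasure M (space M) = 0"
    using F(3) by (metis emeasure_eq_0 null_setsD1 null_setsD2 space_M topspace_eq)
  then show False using nonzero_M by simp
qed

definition ip :: "('a \<Rightarrow> real) \<Rightarrow> ('a \<Rightarrow> real) \<Rightarrow> real" where
  "ip f h = (\<integral>x. f x * h x \<partial>M)"

lemma C0_mult_integrable: "f \<in> C0 \<Longrightarrow> h \<in> C0 \<Longrightarrow> integrable M (\<lambda>x. f x * h x)"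
  by (intro continuous_integrable continuous_map_real_mult C0_cont)

lemma integral_zero_imp_zero:
  assumes f: "continuous_map T euclideanreal f" "\<And>x. x \<in> carrier G \<Longrightarrow> 0 \<le> f x" "(\<integral>x. f x \<partial>M) = 0"
    and x: "x \<in> carrier G"
  shows "f x = 0"
proof (rule ccontr)
  assume "f x \<noteq> 0"
  define U where "U = {x \<in> topspace T. f x \<in> {0<..}}"
  have "openin T U" unfolding U_def by (rule openin_continuous_map_preimage[OF f(1)]) simp
  moreover have "U \<noteq> {}" using x f(2)[OF x] \<open>f x \<noteq> 0\<close> by (auto simp: U_def topspace_eq)
  ultimately have "emeasure M U > 0" by (rule open_positive)
  have "AE x in M. 0 \<le> f x" using f(2) by (intro AE_I2) (simp add: space_M)
  then have "AE x in M. f x = 0"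
    using integral_nonneg_eq_0_iff_AE[OF continuous_integrable[OF f(1)]] f(2,3) by (auto simp: space_M)
  then have "U \<in> null_sets M"
    using open_sets_M[OF \<open>openin T U\<close>] by (subst AE_iff_null_sets) (auto simp: U_def elim: eventually_mono)
  then show False using \<open>emeasure M U > 0\<close> by (simp add: null_sets_def)
qed

sublocale ip: inner_form ip C0
proof
  show "subspace C0" by (rule subspace_C0)
  show "ip f h = ip h f" for f h by (simp add: ip_def mult.commute)
  show "ip (f + k) h = ip f h + ip k h" if "f \<in> C0" "k \<in> C0" "h \<in> C0" for f k h
    unfolding ip_def using C0_mult_integrable that by (simp add: distrib_right)
  show "ip (r *\<^sub>R f) h = r * ip f h" for r f h by (simp add: ip_def mult.assoc)
  show "0 \<le> ip f f" for f by (simp add: ip_def)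
  show "f = 0" if f: "f \<in> C0" "ip f f = 0" for f
  proof
    fix x
    show "f x = 0 x"
    proof (cases "x \<in> carrier G")
      case True
      have "f x * f x = 0"
        by (rule integral_zero_imp_zero[OF _ _ _ True])
          (use f in \<open>auto simp: ip_def intro: continuous_map_real_mult C0_cont\<close>)
      then show ?thesis by simp
    qed (use f in \<open>simp add: C0_def\<close>)
  qed
qed

lemma ip_ltrans:
  assumes "g \<in> carrier G" "f \<in> C0" "h \<in> C0" shows "ip (ltrans g f) (ltrans g h) = ip f h"
proof -
  have "ip (ltrans g f) (ltrans g h) = (\<integral>x. f (inv g \<otimes> x) * h (inv g \<otimes> x) \<partial>M)"
    unfolding ip_def ltrans_def by (rule Bochner_Integration.integral_cong) (auto simp: space_M)
  also have "\<dots> = ip f h" unfolding ip_def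
    using integral_translate[of "inv g" "\<lambda>x. f x * h x"] assms
    by (simp add: continuous_map_real_mult C0_cont)
  finally show ?thesis .
qed

lemma ip_ltrans_adjoint:
  assumes "g \<in> carrier G" "f \<in> C0" "h \<in> C0" shows "ip (ltrans g f) h = ip f (ltrans (inv g) h)"
  using ip_ltrans[of g f "ltrans (inv g) h"] assms by (simp add: ltrans_C0 ltrans_mult ltrans_one)

end

lemma continuous_map_realI:
  assumes "\<And>x \<epsilon>. x \<in> topspace X \<Longrightarrow> \<epsilon> > 0 \<Longrightarrow> \<exists>U. openin X U \<and> x \<in> U \<and> (\<forall>y\<in>U. \<bar>f y - f x\<bar> < \<epsilon>)"
  shows "continuous_map X euclideanreal f"
  using assms
  by (auto simp: Met_TC.continuous_map_to_metric dist_real_def abs_minus_commute simp flip: mtopology_is_euclidean)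

section \<open>Integral estimates and the Arzela-Ascoli theorem\<close>

context compact_group
begin

definition vol :: real where "vol = measure M (space M)"

lemma vol_pos: "vol > 0"
  unfolding vol_def zero_less_measure_iff using nonzero_M by (auto simp: emeasure_eq_measure)

text \<open>By second countability an open set of the product is a countable union of open
  rectangles. Fubini's theorem requires measurability for the product sigma-algebra.\<close>

lemma continuous_pair_measurable:
  assumes F: "continuous_map (prod_topology T T) euclideanreal F"
  shows "F \<in> borel_measurable (M \<Otimes>\<^sub>M M)"
proof (rule borel_measurableI)
  fix S :: "real set" assume "open S"
  define W where "W = {p \<in> topspace (prod_topology T T). F p \<in> S}"
  have W: "openin (prod_topology T T) W"
    unfolding W_def by (rule openin_continuous_map_preimage[OF F]) (use \<open>open S\<close> in simp)
  obtain \<B> where B: "countable \<B>" "\<And>V. V \<in> \<B> \<Longrightarrow> openin T V"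
    "\<And>U x. openin T U \<Longrightarrow> x \<in> U \<Longrightarrow> \<exists>V\<in>\<B>. x \<in> V \<and> V \<subseteq> U"
    using second_countable_T unfolding second_countable_def by metis
  define R where "R = {p \<in> \<B> \<times> \<B>. fst p \<times> snd p \<subseteq> W}"
  have "countable R" unfolding R_def using B(1) by (intro countable_Collect countable_SIGMA) auto
  have "W = (\<Union>p\<in>R. fst p \<times> snd p)"
  proof
    show "W \<subseteq> (\<Union>p\<in>R. fst p \<times> snd p)"
    proof
      fix p assume p: "p \<in> W"
      then obtain U V where UV: "openin T U" "openin T V" "fst p \<in> U" "snd p \<in> V" "U \<times> V \<subseteq> W"
        using W unfolding openin_prod_topology_alt by (metis prod.collapse)
      obtain U' V' where "U' \<in> \<B>" "fst p \<in> U'" "U' \<subseteq> U" "V' \<in> \<B>" "snd p \<in> V'" "V' \<subseteq> V"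
        using B(3) UV by metis
      then have "(U', V') \<in> R" "p \<in> fst (U', V') \<times> snd (U', V')"
        using UV(5) by (auto simp: R_def mem_Times_iff)
      then show "p \<in> (\<Union>p\<in>R. fst p \<times> snd p)" by blast
    qed
  qed (auto simp: R_def)
  also have "\<dots> \<in> sets (M \<Otimes>\<^sub>M M)"
    using \<open>countable R\<close> by (rule sets.countable_UN') (auto simp: R_def intro!: pair_measureI open_sets_M B(2))
  finally have "W \<in> sets (M \<Otimes>\<^sub>M M)" .
  moreover have "F -` S \<inter> space (M \<Otimes>\<^sub>M M) = W"
    by (auto simp: W_def space_pair_measure space_M topspace_eq)
  ultimately show "F -` S \<inter> space (M \<Otimes>\<^sub>M M) \<in> sets (M \<Otimes>\<^sub>M M)" by simp
qed

lemma ip_le_of_bound: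
  assumes f: "f \<in> C0" and c: "\<And>x. x \<in> carrier G \<Longrightarrow> (f x)\<^sup>2 \<le> c" shows "ip f f \<le> c * vol"
proof -
  have "ip f f \<le> (\<integral>x. c \<partial>M)"
    unfolding ip_def using C0_mult_integrable[OF f f] c
    by (intro integral_mono) (auto simp: space_M power2_eq_square)
  then show ?thesis by (simp add: vol_def mult.commute)
qed

lemma ip_uniform_limit:
  assumes F: "\<And>k. F k \<in> C0" "f \<in> C0" "uniform_limit (carrier G) F f sequentially"
  shows "(\<lambda>k. ip (F k - f) (F k - f)) \<longlonglongrightarrow> 0" "(\<lambda>k. ip (F k) (F k)) \<longlonglongrightarrow> ip f f"
proof -
  have D: "F k - f \<in> C0" for k by (intro subspace_diff subspace_C0 F)
  show 1: "(\<lambda>k. ip (F k - f) (F k - f)) \<longlonglongrightarrow> 0"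
  proof (rule LIMSEQ_I)
    fix r :: real assume r: "r > 0"
    define \<epsilon> where "\<epsilon> = sqrt (r / (2 * vol))"
    have \<epsilon>: "\<epsilon> > 0" "\<epsilon>\<^sup>2 * vol = r / 2" using r vol_pos by (auto simp: \<epsilon>_def)
    obtain N where N: "\<And>k x. k \<ge> N \<Longrightarrow> x \<in> carrier G \<Longrightarrow> dist (F k x) (f x) < \<epsilon>"
      using F(3) \<epsilon>(1) unfolding uniform_limit_sequentially_iff by metis
    have "norm (ip (F k - f) (F k - f) - 0) < r" if "k \<ge> N" for k
    proof -
      have "ip (F k - f) (F k - f) \<le> \<epsilon>\<^sup>2 * vol"
      proof (rule ip_le_of_bound[OF D])
        fix x assume "x \<in> carrier G"
        then have "\<bar>F k x - f x\<bar> \<le> \<epsilon>" using N[OF that] by (simp add: dist_real_def less_imp_le)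
        then show "((F k - f) x)\<^sup>2 \<le> \<epsilon>\<^sup>2" using \<epsilon>(1) by (simp add: abs_le_square_iff[symmetric])
      qed
      then show ?thesis using \<epsilon>(2) r ip.nonneg[OF D, of k] by simp
    qed
    then show "\<exists>N. \<forall>k\<ge>N. norm (ip (F k - f) (F k - f) - 0) < r" by blast
  qed
  have 2: "(\<lambda>k. ip (F k - f) f) \<longlonglongrightarrow> 0"
  proof (rule Lim_null_comparison)
    have "\<bar>ip (F k - f) f\<bar> \<le> sqrt (ip (F k - f) (F k - f) * ip f f)" for k
      using ip.cauchy_schwarz[OF D[of k] F(2)] by (simp add: real_le_rsqrt)
    then show "\<forall>\<^sub>F k in sequentially. norm (ip (F k - f) f) \<le> sqrt (ip (F k - f) (F k - f) * ip f f)"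
      by simp
    show "(\<lambda>k. sqrt (ip (F k - f) (F k - f) * ip f f)) \<longlonglongrightarrow> 0"
      using tendsto_real_sqrt[OF tendsto_mult_left_zero[OF 1]] by simp
  qed
  have "ip (F k) (F k) = ip (F k - f) (F k - f) + 2 * ip (F k - f) f + ip f f" for k
  proof -
    have "ip (F k - f) (F k - f) = ip (F k) (F k - f) - ip f (F k - f)"
      by (rule ip.diff[OF F(1) F(2) D])
    also have "ip (F k) (F k - f) = ip (F k) (F k) - ip f (F k)"
      using ip.sym[OF F(1) D] ip.diff[OF F(1) F(2) F(1)] by metis
    also have "ip f (F k - f) = ip (F k - f) f" by (rule ip.sym[OF F(2) D])
    also have "ip f (F k) = ip (F k - f) f + ip f f"
      using ip.diff[OF F(1) F(2) F(2), of k] ip.sym[OF F(2) F(1), of k] by simp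
    finally show ?thesis by linarith
  qed
  then have "(\<lambda>k. ip (F k) (F k)) = (\<lambda>k. ip (F k - f) (F k - f) + 2 * ip (F k - f) f + ip f f)" by blast
  moreover have "(\<lambda>k. ip (F k - f) (F k - f) + 2 * ip (F k - f) f + ip f f) \<longlonglongrightarrow> 0 + 2 * 0 + ip f f"
    by (intro tendsto_intros 1 2)
  ultimately show "(\<lambda>k. ip (F k) (F k)) \<longlonglongrightarrow> ip f f" by simp
qed

text \<open>Arzela-Ascoli: a diagonal subsequence converges on a countable dense set, and
  equicontinuity with compactness upgrades this to a uniform Cauchy condition.\<close>

lemma equicontinuous_subsequence:
  fixes F :: "nat \<Rightarrow> 'a \<Rightarrow> real"
  assumes F: "\<And>k. F k \<in> C0" and C: "\<And>k x. x \<in> carrier G \<Longrightarrow> \<bar>F k x\<bar> \<le> C"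
    and eq: "\<And>x0 \<epsilon>. x0 \<in> carrier G \<Longrightarrow> \<epsilon> > 0 \<Longrightarrow> \<exists>U. openin T U \<and> x0 \<in> U \<and> (\<forall>x\<in>U. \<forall>k. \<bar>F k x - F k x0\<bar> < \<epsilon>)"
  obtains r f where "strict_mono (r :: nat \<Rightarrow> nat)" "f \<in> C0" "uniform_limit (carrier G) (\<lambda>k. F (r k)) f sequentially"
proof -
  obtain \<B> where B: "countable \<B>" "\<And>V. V \<in> \<B> \<Longrightarrow> openin T V"
    "\<And>U x. openin T U \<Longrightarrow> x \<in> U \<Longrightarrow> \<exists>V\<in>\<B>. x \<in> V \<and> V \<subseteq> U"
    using second_countable_T unfolding second_countable_def by metis
  \<comment> \<open>One point from each nonempty basic open set: countable and dense.\<close>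
  define D where "D = (\<lambda>V. SOME x. x \<in> V) ` {V \<in> \<B>. V \<noteq> {}}"
  have D: "countable D" unfolding D_def using B(1) by (intro countable_image countable_Collect)
  have DG: "d \<in> carrier G" if "d \<in> D" for d
  proof -
    obtain V where V: "V \<in> \<B>" "V \<noteq> {}" "d = (SOME x. x \<in> V)" using \<open>d \<in> D\<close> by (auto simp: D_def)
    then have "d \<in> V" by (simp add: some_in_eq)
    then show ?thesis using openin_subset[OF B(2)[OF V(1)]] topspace_eq by blast
  qed
  have Dd: "\<exists>d\<in>D. d \<in> U" if U: "openin T U" "x \<in> U" for U x
  proof -
    obtain V where "V \<in> \<B>" "x \<in> V" "V \<subseteq> U" using B(3)[OF U] by blast
    moreover from this have "(SOME x. x \<in> V) \<in> V" by (auto intro: someI)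
    ultimately show ?thesis by (auto simp: D_def)
  qed
  obtain r where r: "strict_mono (r :: nat \<Rightarrow> nat)"
    and conv: "\<And>d. d \<in> D \<Longrightarrow> \<exists>l. (\<lambda>k. F (r k) d) \<longlonglongrightarrow> l"
    by (rule function_convergent_subsequence[OF D, of F C]) (use C DG in auto)
  have cauchy: "\<exists>N. \<forall>k\<ge>N. \<forall>l\<ge>N. \<forall>x\<in>carrier G. \<bar>F (r k) x - F (r l) x\<bar> < \<epsilon>" if \<epsilon>: "\<epsilon> > 0" for \<epsilon>
  proof -
    \<comment> \<open>Five parts: from \<open>y\<close> to the centre \<open>x\<close> and on to the
      sample point \<open>d x\<close> for each of the two functions, and once between the two
      functions at \<open>d x\<close>.\<close>
    have "\<forall>x\<in>carrier G. \<exists>U. openin T U \<and> x \<in> U \<and> (\<forall>y\<in>U. \<forall>k. \<bar>F k y - F k x\<bar> < \<epsilon> / 5)"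
      using eq[of _ "\<epsilon> / 5"] \<epsilon> by simp
    then obtain U where U: "\<And>x. x \<in> carrier G \<Longrightarrow> openin T (U x)" "\<And>x. x \<in> carrier G \<Longrightarrow> x \<in> U x"
      "\<And>x y k. x \<in> carrier G \<Longrightarrow> y \<in> U x \<Longrightarrow> \<bar>F k y - F k x\<bar> < \<epsilon> / 5"
      by metis
    have "\<exists>\<F>. finite \<F> \<and> \<F> \<subseteq> U ` carrier G \<and> topspace T \<subseteq> \<Union>\<F>"
    proof (rule compactinD[of T "topspace T"])
      show "compactin T (topspace T)" using compact_T by (simp add: compact_space_def)
      show "openin T S" if "S \<in> U ` carrier G" for S using that U(1) by auto
      show "topspace T \<subseteq> \<Union> (U ` carrier G)" using U(2) by (auto simp: topspace_eq)
    qed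
    then obtain \<F> where F: "finite \<F>" "\<F> \<subseteq> U ` carrier G" "topspace T \<subseteq> \<Union>\<F>" by blast
    obtain X where "X \<subseteq> carrier G" "finite X" "\<F> = U ` X" using finite_subset_image[OF F(1,2)] by blast
    then have X: "finite X" "X \<subseteq> carrier G" "carrier G \<subseteq> (\<Union>x\<in>X. U x)"
      using F(3) by (auto simp: topspace_eq)
    have "\<exists>d. d \<in> D \<and> d \<in> U x" if "x \<in> X" for x
      using Dd[OF U(1)[of x] U(2)[of x]] that X(2) by auto
    then obtain d where d: "\<And>x. x \<in> X \<Longrightarrow> d x \<in> D \<and> d x \<in> U x" by metis
    have "\<forall>x\<in>X. \<exists>N. \<forall>k\<ge>N. \<forall>l\<ge>N. \<bar>F (r k) (d x) - F (r l) (d x)\<bar> < \<epsilon> / 5"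
    proof
      fix x assume "x \<in> X"
      then have "Cauchy (\<lambda>k. F (r k) (d x))" using conv d LIMSEQ_imp_Cauchy by blast
      then show "\<exists>N. \<forall>k\<ge>N. \<forall>l\<ge>N. \<bar>F (r k) (d x) - F (r l) (d x)\<bar> < \<epsilon> / 5"
        using \<epsilon> unfolding Cauchy_def dist_real_def by (meson divide_pos_pos zero_less_numeral)
    qed
    then obtain N where N: "\<And>x k l. x \<in> X \<Longrightarrow> k \<ge> N x \<Longrightarrow> l \<ge> N x \<Longrightarrow> \<bar>F (r k) (d x) - F (r l) (d x)\<bar> < \<epsilon> / 5"
      by metis
    have "\<bar>F (r k) y - F (r l) y\<bar> < \<epsilon>" if kl: "k \<ge> Max (insert 0 (N ` X))" "l \<ge> Max (insert 0 (N ` X))" and y: "y \<in> carrier G" for k l y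
    proof -
      obtain x where x: "x \<in> X" "y \<in> U x" using X(3) y by blast
      have "N x \<le> Max (insert 0 (N ` X))" using X(1) x(1) by (intro Max_ge) auto
      then have "\<bar>F (r k) (d x) - F (r l) (d x)\<bar> < \<epsilon> / 5" using N[OF x(1)] kl by auto
      moreover have "\<bar>F k y - F k x\<bar> < \<epsilon> / 5" "\<bar>F k (d x) - F k x\<bar> < \<epsilon> / 5" for k
        using U(3)[of x] x X(2) d[OF x(1)] by auto
      note this[of "r k"] this[of "r l"]
      ultimately show ?thesis by linarith
    qed
    then show ?thesis by blast
  qed
  have "\<forall>x\<in>carrier G. \<exists>l. (\<lambda>k. F (r k) x) \<longlonglongrightarrow> l"
  proof
    fix x assume x: "x \<in> carrier G"
    have "Cauchy (\<lambda>k. F (r k) x)" unfolding Cauchy_def dist_real_def using cauchy x by meson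
    then show "\<exists>l. (\<lambda>k. F (r k) x) \<longlonglongrightarrow> l" using Cauchy_convergent_iff convergent_def by blast
  qed
  then obtain f' where f': "\<And>x. x \<in> carrier G \<Longrightarrow> (\<lambda>k. F (r k) x) \<longlonglongrightarrow> f' x" by metis
  define f where "f = restr f'"
  have f: "(\<lambda>k. F (r k) x) \<longlonglongrightarrow> f x" if "x \<in> carrier G" for x using f'[OF that] that by (simp add: f_def restr_def)
  have "uniform_limit (carrier G) (\<lambda>k. F (r k)) f sequentially"
    unfolding uniform_limit_sequentially_iff
  proof (intro allI impI)
    fix \<epsilon> :: real assume "\<epsilon> > 0"
    then obtain N where N: "\<And>k l x. k \<ge> N \<Longrightarrow> l \<ge> N \<Longrightarrow> x \<in> carrier G \<Longrightarrow> \<bar>F (r k) x - F (r l) x\<bar> < \<epsilon> / 2"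
      using cauchy[of "\<epsilon> / 2"] by auto
    have "dist (F (r k) x) (f x) < \<epsilon>" if "k \<ge> N" "x \<in> carrier G" for k x
    proof -
      have "(\<lambda>l. \<bar>F (r k) x - F (r l) x\<bar>) \<longlonglongrightarrow> \<bar>F (r k) x - f x\<bar>" by (intro tendsto_intros f that)
      then have "\<bar>F (r k) x - f x\<bar> \<le> \<epsilon> / 2"
        by (rule LIMSEQ_le_const2) (use N that less_imp_le in blast)
      then show ?thesis using \<open>\<epsilon> > 0\<close> by (simp add: dist_real_def)
    qed
    then show "\<exists>N. \<forall>k\<ge>N. \<forall>x\<in>carrier G. dist (F (r k) x) (f x) < \<epsilon>" by blast
  qed
  moreover have "f \<in> C0"
    unfolding C0_def
  proof (intro CollectI conjI allI impI)
    show "f x = 0" if "x \<notin> carrier G" for x using that by (simp add: f_def restr_def)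
    have "\<exists>U. openin T U \<and> x \<in> U \<and> (\<forall>y\<in>U. \<bar>f y - f x\<bar> < \<epsilon>)" if x: "x \<in> carrier G" and \<epsilon>: "\<epsilon> > 0" for x \<epsilon>
    proof -
      obtain U where U: "openin T U" "x \<in> U" "\<forall>y\<in>U. \<forall>k. \<bar>F k y - F k x\<bar> < \<epsilon> / 2"
        using eq[of x "\<epsilon> / 2"] x \<epsilon> by auto
      have "\<bar>f y - f x\<bar> < \<epsilon>" if y: "y \<in> U" for y
      proof -
        have "y \<in> carrier G" using y U(1) openin_subset topspace_eq by blast
        then have "(\<lambda>k. \<bar>F (r k) y - F (r k) x\<bar>) \<longlonglongrightarrow> \<bar>f y - f x\<bar>" by (intro tendsto_intros f x)
        then have "\<bar>f y - f x\<bar> \<le> \<epsilon> / 2" by (rule LIMSEQ_le_const2) (use U(3) y less_imp_le in blast)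
        then show ?thesis using \<epsilon> by simp
      qed
      then show ?thesis using U by blast
    qed
    then show "continuous_map T euclideanreal f" by (intro continuous_map_realI) (auto simp: topspace_eq)
  qed
  ultimately show thesis using that r by blast
qed

end

section \<open>Eigenfunctions of convolution operators\<close>

text \<open>The operator \<open>conv\<close> has kernel \<open>\<phi> (inv y \<otimes> x)\<close>.
  Dependence on \<open>inv y \<otimes> x\<close> alone makes it commute with left translations, and
  \<open>\<phi>_inv\<close> makes it symmetric.\<close>

locale convolution = compact_group G T M
  for G :: "('a, 'b) monoid_scheme" (structure) and T :: "'a topology" and M :: "'a measure" +
  fixes \<phi> :: "'a \<Rightarrow> real"
  assumes \<phi>: "\<phi> \<in> C0" and \<phi>_inv: "x \<in> carrier G \<Longrightarrow> \<phi> (inv x) = \<phi> x"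
begin

definition kern :: "'a \<Rightarrow> 'a \<Rightarrow> real" where
  "kern x = restr (\<lambda>y. \<phi> (inv y \<otimes> x))"

definition conv :: "('a \<Rightarrow> real) \<Rightarrow> 'a \<Rightarrow> real" where
  "conv f = restr (\<lambda>x. ip f (kern x))"

definition bd :: real where "bd = (SOME C. C \<ge> 0 \<and> (\<forall>x\<in>carrier G. \<bar>\<phi> x\<bar> \<le> C))"

lemma bd: "bd \<ge> 0" "x \<in> carrier G \<Longrightarrow> \<bar>\<phi> x\<bar> \<le> bd"
proof -
  have "\<exists>C. C \<ge> 0 \<and> (\<forall>x\<in>carrier G. \<bar>\<phi> x\<bar> \<le> C)"
    by (rule continuous_bounded[OF C0_cont[OF \<phi>]]) auto
  from someI_ex[OF this] show "bd \<ge> 0" "x \<in> carrier G \<Longrightarrow> \<bar>\<phi> x\<bar> \<le> bd" by (auto simp: bd_def)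
qed

lemma kernel_continuous: "continuous_map (prod_topology T T) euclideanreal (\<lambda>(x, y). \<phi> (inv y \<otimes> x))"
proof -
  have "continuous_map (prod_topology T T) T (\<lambda>p. inv (snd p) \<otimes> fst p)"
    by (intro continuous_map_compose_mult continuous_map_compose_inv continuous_map_fst continuous_map_snd)
  from continuous_map_compose[OF this C0_cont[OF \<phi>]] show ?thesis by (simp add: o_def case_prod_unfold)
qed

lemma kern_C0: "x \<in> carrier G \<Longrightarrow> kern x \<in> C0"
proof -
  assume x: "x \<in> carrier G"
  have "continuous_map T (prod_topology T T) (\<lambda>y. (x, y))"
    using x by (intro continuous_map_pairedI) (auto simp: topspace_eq)
  from continuous_map_compose[OF this kernel_continuous]
  show ?thesis unfolding kern_def by (intro restr_C0) (simp add: o_def)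
qed

lemma kern_bound: "x \<in> carrier G \<Longrightarrow> ip (kern x) (kern x) \<le> bd\<^sup>2 * vol"
proof (rule ip_le_of_bound[OF kern_C0])
  fix y assume "x \<in> carrier G" "y \<in> carrier G"
  then show "(kern x y)\<^sup>2 \<le> bd\<^sup>2"
    using bd by (simp add: kern_def restr_def abs_le_square_iff[symmetric])
qed

lemma conv_bound: "f \<in> C0 \<Longrightarrow> x \<in> carrier G \<Longrightarrow> (conv f x)\<^sup>2 \<le> ip f f * (bd\<^sup>2 * vol)"
proof -
  assume f: "f \<in> C0" and x: "x \<in> carrier G"
  have "(conv f x)\<^sup>2 \<le> ip f f * ip (kern x) (kern x)"
    using ip.cauchy_schwarz[OF f kern_C0[OF x]] x by (simp add: conv_def restr_def)
  also have "\<dots> \<le> ip f f * (bd\<^sup>2 * vol)" by (intro mult_left_mono kern_bound x ip.nonneg f)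
  finally show ?thesis .
qed

text \<open>By Cauchy-Schwarz the variation of \<open>conv f\<close> is bounded by the L2 distance
  between \<open>kern x\<close> and \<open>kern x0\<close>, uniformly over an L2 ball. This
  expresses compactness of the operator without completing \<open>C0\<close>.\<close>

lemma conv_equicontinuous:
  assumes x0: "x0 \<in> carrier G" and \<epsilon>: "\<epsilon> > 0"
  shows "\<exists>U. openin T U \<and> x0 \<in> U \<and> (\<forall>x\<in>U. \<forall>f\<in>C0. ip f f \<le> c \<longrightarrow> \<bar>conv f x - conv f x0\<bar> < \<epsilon>)"
proof -
  \<comment> \<open>Chosen so that \<open>\<delta>^2 * vol\<close> times the enlarged bound is
    \<open>\<epsilon>^2\<close>. The added 1 keeps the denominator positive and provides the strict
    inequality below.\<close>
  define \<delta> where "\<delta> = \<epsilon> / sqrt ((\<bar>c\<bar> + 1) * vol)"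
  have pos: "(\<bar>c\<bar> + 1) * vol > 0" using vol_pos by (simp add: add_nonneg_pos)
  have \<delta>: "\<delta> > 0" "\<delta>\<^sup>2 * ((\<bar>c\<bar> + 1) * vol) = \<epsilon>\<^sup>2" using \<epsilon> pos by (auto simp: \<delta>_def power_divide)
  obtain U where U: "openin T U" "x0 \<in> U" "\<And>x y. x \<in> U \<Longrightarrow> y \<in> topspace T \<Longrightarrow> \<bar>\<phi> (inv y \<otimes> x) - \<phi> (inv y \<otimes> x0)\<bar> < \<delta>"
    using tube_uniform[OF kernel_continuous compact_T _ \<delta>(1), of x0] x0 by (auto simp: topspace_eq)
  have "\<bar>conv f x - conv f x0\<bar> < \<epsilon>" if x: "x \<in> U" and f: "f \<in> C0" "ip f f \<le> c" for x f
  proof -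
    have xG: "x \<in> carrier G" using x U(1) openin_subset topspace_eq by blast
    let ?d = "kern x - kern x0"
    have d: "?d \<in> C0" by (intro subspace_diff subspace_C0 kern_C0 xG x0)
    have "ip ?d ?d \<le> \<delta>\<^sup>2 * vol"
    proof (rule ip_le_of_bound[OF d])
      fix y assume "y \<in> carrier G"
      then show "(?d y)\<^sup>2 \<le> \<delta>\<^sup>2"
        using U(3)[OF x, of y] \<delta>(1) by (simp add: kern_def restr_def abs_le_square_iff[symmetric] topspace_eq less_imp_le)
    qed
    have "conv f x - conv f x0 = ip f (kern x) - ip f (kern x0)"
      using xG x0 by (simp add: conv_def restr_def)
    also have "\<dots> = ip ?d f"
      using ip.diff[OF kern_C0[OF xG] kern_C0[OF x0] f(1)] ip.sym[OF f(1) kern_C0] xG x0 by simp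
    finally have "(conv f x - conv f x0)\<^sup>2 \<le> ip ?d ?d * ip f f"
      using ip.cauchy_schwarz[OF d f(1)] by simp
    also have "\<dots> \<le> (\<delta>\<^sup>2 * vol) * \<bar>c\<bar>"
      using \<open>ip ?d ?d \<le> \<delta>\<^sup>2 * vol\<close> f(2) ip.nonneg[OF d] ip.nonneg[OF f(1)] by (intro mult_mono) auto
    also have "\<dots> < (\<delta>\<^sup>2 * vol) * (\<bar>c\<bar> + 1)" using \<delta>(1) vol_pos by (intro mult_strict_left_mono) auto
    also have "\<dots> = \<epsilon>\<^sup>2" using \<delta>(2) by (simp add: mult_ac)
    finally have "\<bar>conv f x - conv f x0\<bar>\<^sup>2 < \<epsilon>\<^sup>2" by simp
    then show ?thesis by (rule power2_less_imp_less) (use \<epsilon> in simp)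
  qed
  then show ?thesis using U by blast
qed

lemma conv_C0: "f \<in> C0 \<Longrightarrow> conv f \<in> C0"
  unfolding C0_def
proof (intro CollectI conjI allI impI)
  assume "f \<in> {f. continuous_map T euclideanreal f \<and> (\<forall>x. x \<notin> carrier G \<longrightarrow> f x = 0)}"
  then have f: "f \<in> C0" by (simp add: C0_def)
  show "continuous_map T euclideanreal (conv f)"
  proof (rule continuous_map_realI)
    fix x and \<epsilon> :: real assume "x \<in> topspace T" "\<epsilon> > 0"
    then show "\<exists>U. openin T U \<and> x \<in> U \<and> (\<forall>y\<in>U. \<bar>conv f y - conv f x\<bar> < \<epsilon>)"
      using conv_equicontinuous[of x \<epsilon> "ip f f"] f by (auto simp: topspace_eq)
  qed
qed (simp add: conv_def restr_def)

lemma conv_add: "f \<in> C0 \<Longrightarrow> h \<in> C0 \<Longrightarrow> conv (f + h) = conv f + conv h"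
  by (rule ext) (simp add: conv_def restr_def ip.add kern_C0)

lemma conv_scaleR: "f \<in> C0 \<Longrightarrow> conv (r *\<^sub>R f) = r *\<^sub>R conv f"
  by (rule ext) (simp add: conv_def restr_def ip.scale kern_C0)

lemma conv_diff: "f \<in> C0 \<Longrightarrow> h \<in> C0 \<Longrightarrow> conv (f - h) = conv f - conv h"
  by (rule ext) (simp add: conv_def restr_def ip.diff kern_C0)

text \<open>Fubini's theorem exchanges the integrals, and \<open>\<phi>_inv\<close> makes the kernel
  symmetric.\<close>

lemma conv_sym: assumes f: "f \<in> C0" and h: "h \<in> C0" shows "ip (conv f) h = ip f (conv h)"
proof -
  interpret P: pair_sigma_finite M M ..
  define F where "F x y = f y * \<phi> (inv y \<otimes> x) * h x" for x y
  have cont: "continuous_map (prod_topology T T) euclideanreal (\<lambda>p. F (fst p) (snd p))"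
  proof -
    have "continuous_map (prod_topology T T) euclideanreal (\<lambda>p. f (snd p))"
      using continuous_map_compose[OF continuous_map_snd C0_cont[OF f]] by (simp add: o_def)
    moreover have "continuous_map (prod_topology T T) euclideanreal (\<lambda>p. h (fst p))"
      using continuous_map_compose[OF continuous_map_fst C0_cont[OF h]] by (simp add: o_def)
    moreover have "continuous_map (prod_topology T T) euclideanreal (\<lambda>p. \<phi> (inv (snd p) \<otimes> fst p))"
      using kernel_continuous by (simp add: case_prod_unfold)
    ultimately show ?thesis unfolding F_def by (intro continuous_map_real_mult)
  qed
  obtain Cf Ch where C: "\<And>x. x \<in> carrier G \<Longrightarrow> \<bar>f x\<bar> \<le> Cf" "\<And>x. x \<in> carrier G \<Longrightarrow> \<bar>h x\<bar> \<le> Ch" "Cf \<ge> 0" "Ch \<ge> 0"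
    using continuous_bounded[OF C0_cont[OF f]] continuous_bounded[OF C0_cont[OF h]] by metis
  have "integrable (M \<Otimes>\<^sub>M M) (\<lambda>p. F (fst p) (snd p))"
  proof (rule finite_measure.integrable_const_bound[of _ _ "Cf * bd * Ch"])
    show "finite_measure (M \<Otimes>\<^sub>M M)" by (rule finite_measure_pair_measure) unfold_locales
    show "AE p in M \<Otimes>\<^sub>M M. norm (F (fst p) (snd p)) \<le> Cf * bd * Ch"
    proof (rule AE_I2)
      fix p assume "p \<in> space (M \<Otimes>\<^sub>M M)"
      then have p: "fst p \<in> carrier G" "snd p \<in> carrier G" by (auto simp: space_pair_measure space_M)
      have "\<bar>f (snd p)\<bar> * \<bar>\<phi> (inv (snd p) \<otimes> fst p)\<bar> * \<bar>h (fst p)\<bar> \<le> Cf * bd * Ch"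
        using p C bd by (intro mult_mono) auto
      then show "norm (F (fst p) (snd p)) \<le> Cf * bd * Ch" by (simp add: F_def abs_mult)
    qed
    show "(\<lambda>p. F (fst p) (snd p)) \<in> borel_measurable (M \<Otimes>\<^sub>M M)" by (rule continuous_pair_measurable[OF cont])
  qed
  then have int: "integrable (M \<Otimes>\<^sub>M M) (case_prod F)" by (simp add: case_prod_unfold)
  have "ip (conv f) h = (\<integral>x. (\<integral>y. F x y \<partial>M) \<partial>M)"
  proof -
    have "conv f x * h x = (\<integral>y. F x y \<partial>M)" if "x \<in> carrier G" for x
    proof -
      have "(\<integral>y. F x y \<partial>M) = (\<integral>y. f y * kern x y * h x \<partial>M)"
        by (rule Bochner_Integration.integral_cong) (auto simp: F_def kern_def restr_def space_M)
      then show ?thesis using that by (simp add: conv_def restr_def ip_def)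
    qed
    then show ?thesis unfolding ip_def by (intro Bochner_Integration.integral_cong) (auto simp: space_M)
  qed
  also have "\<dots> = (\<integral>y. (\<integral>x. F x y \<partial>M) \<partial>M)" by (rule P.Fubini_integral[OF int, symmetric])
  also have "\<dots> = ip f (conv h)"
  proof -
    have "f y * conv h y = (\<integral>x. F x y \<partial>M)" if y: "y \<in> carrier G" for y
    proof -
      have eq: "\<phi> (inv y \<otimes> x) = \<phi> (inv x \<otimes> y)" if "x \<in> carrier G" for x
        using \<phi>_inv[of "inv x \<otimes> y"] that y by (simp add: inv_mult_group)
      have "(\<integral>x. F x y \<partial>M) = (\<integral>x. f y * (h x * kern y x) \<partial>M)"
        by (rule Bochner_Integration.integral_cong) (auto simp: F_def kern_def restr_def space_M eq)
      then show ?thesis using y by (simp add: conv_def restr_def ip_def)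
    qed
    then show ?thesis unfolding ip_def by (intro Bochner_Integration.integral_cong) (auto simp: space_M)
  qed
  finally show ?thesis .
qed

lemma conv_ltrans: assumes g: "g \<in> carrier G" and f: "f \<in> C0" shows "conv (ltrans g f) = ltrans g (conv f)"
proof
  fix x
  show "conv (ltrans g f) x = ltrans g (conv f) x"
  proof (cases "x \<in> carrier G")
    case True
    have "ltrans (inv g) (kern x) = kern (inv g \<otimes> x)"
      using g True by (auto simp: fun_eq_iff ltrans_def kern_def restr_def inv_mult_group m_assoc)
    then show ?thesis
      using True g ip_ltrans_adjoint[OF g f kern_C0[OF True]] by (simp add: conv_def restr_def ltrans_def)
  qed (simp add: conv_def restr_def ltrans_def)
qed

lemma ip_conv_le: "f \<in> C0 \<Longrightarrow> ip (conv f) (conv f) \<le> ip f f * (bd\<^sup>2 * vol) * vol"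
  by (rule ip_le_of_bound[OF conv_C0 conv_bound])

text \<open>The spectral theorem for compact symmetric operators on an incomplete space. A
  maximizing sequence \<open>f k\<close> for the quadratic form of the square of \<open>conv\<close>
  need not converge, but its images \<open>h k\<close> have a uniformly convergent subsequence,
  whose limit is the eigenfunction. The square is used because its form is nonnegative, so the
  supremum is an eigenvalue without a distinction of signs.\<close>

lemma eigenfunction_exists:
  assumes W: "subspace W" "W \<subseteq> C0" and cl: "\<And>F f. (\<And>k. F k \<in> W) \<Longrightarrow> f \<in> C0 \<Longrightarrow>
      uniform_limit (carrier G) F f sequentially \<Longrightarrow> f \<in> W"
    and inv: "\<And>f. f \<in> W \<Longrightarrow> conv f \<in> W" and f0: "f0 \<in> W" "conv f0 \<noteq> 0"
  obtains c g where "c > 0" "g \<in> W" "g \<noteq> 0" "conv (conv g) = c *\<^sub>R g"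
proof -
  have WC: "f \<in> C0" if "f \<in> W" for f using that W(2) by blast
  define S where "S = {ip (conv f) (conv f) | f. f \<in> W \<and> ip f f = 1}"
  have S_le: "s \<le> bd\<^sup>2 * vol * vol" if "s \<in> S" for s using that ip_conv_le WC by (force simp: S_def)
  then have bdd: "bdd_above S" by (meson bdd_aboveI)
  define m where "m = Sup S"
  have unit: "\<exists>h\<in>W. \<exists>c>0. ip h h = 1 \<and> f = c *\<^sub>R h" if f: "f \<in> W" "f \<noteq> 0" for f
  proof -
    have p: "ip f f > 0" using ip.nonneg[OF WC[OF f(1)]] ip.pos[OF WC[OF f(1)]] f(2) by fastforce
    define h where "h = (1 / sqrt (ip f f)) *\<^sub>R f"
    have h: "h \<in> W" unfolding h_def by (intro subspace_scale W f)
    have "ip h h = (1 / sqrt (ip f f)) * ip h f"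
      using ip.scale[OF WC[OF f(1)] WC[OF h], of "1 / sqrt (ip f f)"] ip.sym[OF WC[OF f(1)] WC[OF h]]
      unfolding h_def[symmetric] by simp
    also have "ip h f = (1 / sqrt (ip f f)) * ip f f" unfolding h_def by (rule ip.scale[OF WC[OF f(1)] WC[OF f(1)]])
    finally have "ip h h = 1" using p by (simp add: field_simps)
    moreover have "f = sqrt (ip f f) *\<^sub>R h" using p by (simp add: h_def)
    ultimately show ?thesis using h p by (meson real_sqrt_gt_zero)
  qed
  have ip_scale2: "ip (c *\<^sub>R f) (c *\<^sub>R f) = c\<^sup>2 * ip f f" if "f \<in> C0" for c f
    by (simp add: ip_def power2_eq_square mult_ac flip: integral_mult_right_zero)
  have m_bound: "ip (conv f) (conv f) \<le> m * ip f f" if f: "f \<in> W" for f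
  proof (cases "f = 0")
    case True
    then show ?thesis using conv_scaleR[of 0 0] subspace_0[OF subspace_C0] by (simp add: ip_def)
  next
    case False
    obtain h c where h: "h \<in> W" "c > 0" "ip h h = 1" "f = c *\<^sub>R h" using unit[OF f False] by blast
    have "ip (conv h) (conv h) \<le> m" unfolding m_def by (rule cSup_upper[OF _ bdd]) (use h in \<open>auto simp: S_def\<close>)
    then have "c\<^sup>2 * ip (conv h) (conv h) \<le> c\<^sup>2 * m" by (intro mult_left_mono) auto
    then show ?thesis
      using h ip_scale2 WC conv_C0 by (simp add: conv_scaleR mult.commute)
  qed
  have m_pos: "m > 0"
  proof -
    have "f0 \<noteq> 0" using f0(2) conv_scaleR[of 0 0] subspace_0[OF subspace_C0] by auto
    have "0 < ip (conv f0) (conv f0)"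
      using ip.nonneg[OF conv_C0[OF WC[OF f0(1)]]] ip.pos[OF conv_C0[OF WC[OF f0(1)]]] f0(2) by fastforce
    also have "\<dots> \<le> m * ip f0 f0" by (rule m_bound[OF f0(1)])
    finally show ?thesis using ip.nonneg[OF WC[OF f0(1)]] by (simp add: zero_less_mult_iff)
  qed
  have ne: "S \<noteq> {}"
  proof -
    have "f0 \<noteq> 0" using f0(2) conv_scaleR[of 0 0] subspace_0[OF subspace_C0] by auto
    then show ?thesis using unit[OF f0(1)] by (auto simp: S_def)
  qed
  have "\<exists>f\<in>W. ip f f = 1 \<and> m - 1 / real (Suc k) < ip (conv f) (conv f)" for k
  proof -
    have "m - 1 / real (Suc k) < Sup S" by (simp add: m_def)
    then obtain s where "s \<in> S" "m - 1 / real (Suc k) < s" using less_cSup_iff[OF ne bdd] by blast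
    then show ?thesis by (auto simp: S_def)
  qed
  then obtain f where f: "\<And>k. f k \<in> W" "\<And>k. ip (f k) (f k) = 1" "\<And>k. m - 1 / real (Suc k) < ip (conv (f k)) (conv (f k))"
    by metis
  have fC: "f k \<in> C0" for k using f(1) WC by blast
  define h where "h k = conv (f k)" for k
  have hW: "h k \<in> W" and hC: "h k \<in> C0" for k using f(1) inv WC by (auto simp: h_def)
  obtain r H where r: "strict_mono (r :: nat \<Rightarrow> nat)" "H \<in> C0" "uniform_limit (carrier G) (\<lambda>k. h (r k)) H sequentially"
  proof (rule equicontinuous_subsequence[of h "sqrt (bd\<^sup>2 * vol)"])
    show "h k \<in> C0" for k by (rule hC)
    show "\<bar>h k x\<bar> \<le> sqrt (bd\<^sup>2 * vol)" if "x \<in> carrier G" for k x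
      using conv_bound[OF fC[of k] that] f(2) by (intro real_le_rsqrt) (simp add: h_def)
    show "\<exists>U. openin T U \<and> x0 \<in> U \<and> (\<forall>x\<in>U. \<forall>k. \<bar>h k x - h k x0\<bar> < \<epsilon>)" if "x0 \<in> carrier G" "\<epsilon> > 0" for x0 \<epsilon>
    proof -
      obtain U where "openin T U" "x0 \<in> U" "\<forall>x\<in>U. \<forall>f\<in>C0. ip f f \<le> 1 \<longrightarrow> \<bar>conv f x - conv f x0\<bar> < \<epsilon>"
        using conv_equicontinuous[OF \<open>x0 \<in> carrier G\<close> \<open>\<epsilon> > 0\<close>, of 1] by blast
      then show ?thesis using fC f(2) unfolding h_def by (intro exI[of _ U]) simp
    qed
  qed auto
  have HW: "H \<in> W" by (rule cl[OF _ r(2,3)]) (rule hW)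
  define u where "u k = conv (h k) - m *\<^sub>R f k" for k
  have uC: "u k \<in> C0" for k unfolding u_def by (intro subspace_diff subspace_scale subspace_C0 conv_C0 hC fC)
  \<comment> \<open>Expand the square, move one \<open>conv\<close> across by symmetry, and apply
    \<open>m_bound\<close> to \<open>h k\<close>. What remains is
    \<open>m * (m - ip (h k) (h k))\<close>, small by the choice of \<open>f k\<close>.\<close>
  have u_small: "ip (u k) (u k) \<le> m / real (Suc k)" for k
  proof -
    let ?a = "conv (h k)" and ?b = "m *\<^sub>R f k"
    have bC: "?b \<in> C0" by (intro subspace_scale subspace_C0 fC)
    have aC: "?a \<in> C0" by (intro conv_C0 hC)
    have "ip (u k) (u k) = ip ?a (u k) - ip ?b (u k)" unfolding u_def by (rule ip.diff) (use aC bC uC u_def in auto)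
    also have "ip ?a (u k) = ip (u k) ?a" by (rule ip.sym[OF aC uC])
    also have "ip (u k) ?a = ip ?a ?a - ip ?b ?a" unfolding u_def by (rule ip.diff[OF aC bC aC])
    also have "ip ?b (u k) = ip (u k) ?b" by (rule ip.sym[OF bC uC])
    also have "ip (u k) ?b = ip ?a ?b - ip ?b ?b" unfolding u_def by (rule ip.diff[OF aC bC bC])
    also have "ip ?a ?b = ip ?b ?a" by (rule ip.sym[OF aC bC])
    also have "ip ?b ?a = m * ip (f k) ?a" by (rule ip.scale[OF fC aC])
    also have "ip (f k) ?a = ip (h k) (h k)" unfolding h_def by (rule conv_sym[OF fC conv_C0[OF fC], symmetric])
    also have "ip ?b ?b = m\<^sup>2" using ip_scale2[OF fC] f(2) by simp
    finally have "ip (u k) (u k) = ip ?a ?a - 2 * m * ip (h k) (h k) + m\<^sup>2" by simp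
    also have "ip ?a ?a \<le> m * ip (h k) (h k)" by (rule m_bound[OF hW])
    finally have "ip (u k) (u k) \<le> m * (m - ip (h k) (h k))" by (simp add: power2_eq_square algebra_simps)
    also have "\<dots> \<le> m * (1 / real (Suc k))" using f(3)[of k] m_pos by (intro mult_left_mono) (auto simp: h_def)
    finally show ?thesis by simp
  qed
  have conv_lim: "(\<lambda>k. conv (v k) x) \<longlonglongrightarrow> 0" if v: "\<And>k. v k \<in> C0" "(\<lambda>k. ip (v k) (v k)) \<longlonglongrightarrow> 0" and x: "x \<in> carrier G" for v x
  proof (rule Lim_null_comparison)
    show "\<forall>\<^sub>F k in sequentially. norm (conv (v k) x) \<le> sqrt (ip (v k) (v k) * (bd\<^sup>2 * vol))"
      using conv_bound[OF v(1) x] by (simp add: real_le_rsqrt)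
    show "(\<lambda>k. sqrt (ip (v k) (v k) * (bd\<^sup>2 * vol))) \<longlonglongrightarrow> 0"
      using tendsto_real_sqrt[OF tendsto_mult_left_zero[OF v(2)]] by simp
  qed
  have ipH: "(\<lambda>k. ip (h (r k) - H) (h (r k) - H)) \<longlonglongrightarrow> 0" "(\<lambda>k. ip (h (r k)) (h (r k))) \<longlonglongrightarrow> ip H H"
    using ip_uniform_limit[OF hC r(2,3)] by auto
  \<comment> \<open>Applying \<open>conv\<close> once more to the approximate eigenvalue relation
    leaves only the convergent \<open>h\<close>: \<open>conv (u k)\<close> is
    \<open>conv (conv (h k)) - m *\<^sub>R h k\<close>.\<close>
  have eig: "conv (conv H) x = m * H x" if x: "x \<in> carrier G" for x
  proof -
    have dC: "h k - H \<in> C0" for k by (intro subspace_diff subspace_C0 hC r)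
    have "(\<lambda>k. ip (conv (h (r k) - H)) (conv (h (r k) - H))) \<longlonglongrightarrow> 0"
    proof (rule tendsto_sandwich[OF _ _ tendsto_const])
      show "\<forall>\<^sub>F k in sequentially. 0 \<le> ip (conv (h (r k) - H)) (conv (h (r k) - H))"
        using ip.nonneg[OF conv_C0[OF dC]] by simp
      show "\<forall>\<^sub>F k in sequentially. ip (conv (h (r k) - H)) (conv (h (r k) - H)) \<le> ip (h (r k) - H) (h (r k) - H) * (bd\<^sup>2 * vol) * vol"
        using ip_conv_le[OF dC] by simp
      show "(\<lambda>k. ip (h (r k) - H) (h (r k) - H) * (bd\<^sup>2 * vol) * vol) \<longlonglongrightarrow> 0"
        by (intro tendsto_mult_left_zero ipH)
    qed
    from conv_lim[OF conv_C0[OF dC] this x]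
    have "(\<lambda>k. conv (conv (h (r k) - H)) x) \<longlonglongrightarrow> 0" .
    then have 1: "(\<lambda>k. conv (conv (h (r k))) x - conv (conv H) x) \<longlonglongrightarrow> 0"
      by (simp add: conv_diff hC r conv_C0)
    have "(\<lambda>k. m * (1 / real (Suc k))) \<longlonglongrightarrow> m * 0"
      by (intro tendsto_mult tendsto_const lim_1_over_n[THEN LIMSEQ_Suc])
    then have m0: "(\<lambda>k. m / real (Suc k)) \<longlonglongrightarrow> 0" by simp
    have u0: "(\<lambda>k. ip (u k) (u k)) \<longlonglongrightarrow> 0"
    proof (rule tendsto_sandwich[OF _ _ tendsto_const m0])
      show "\<forall>\<^sub>F k in sequentially. 0 \<le> ip (u k) (u k)" using ip.nonneg[OF uC] by simp
      show "\<forall>\<^sub>F k in sequentially. ip (u k) (u k) \<le> m / real (Suc k)"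
        by (rule always_eventually) (use u_small in blast)
    qed
    have "(\<lambda>k. ip (u (r k)) (u (r k))) \<longlonglongrightarrow> 0"
      by (rule LIMSEQ_subseq_LIMSEQ[OF u0 r(1), unfolded o_def])
    from conv_lim[OF uC this x] have "(\<lambda>k. conv (u (r k)) x) \<longlonglongrightarrow> 0" .
    then have 2: "(\<lambda>k. conv (conv (h (r k))) x - m * h (r k) x) \<longlonglongrightarrow> 0"
      unfolding u_def by (simp add: conv_diff conv_scaleR conv_C0 hC fC subspace_scale[OF subspace_C0] h_def[symmetric])
    have 3: "(\<lambda>k. h (r k) x) \<longlonglongrightarrow> H x" using tendsto_uniform_limitI[OF r(3) x] .
    have "(\<lambda>k. (conv (conv (h (r k))) x - m * h (r k) x) - (conv (conv (h (r k))) x - conv (conv H) x) + m * h (r k) x)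
        \<longlonglongrightarrow> 0 - 0 + m * H x"
      by (intro tendsto_intros 1 2 3)
    then show ?thesis by (simp add: LIMSEQ_const_iff)
  qed
  have "conv (conv H) = m *\<^sub>R H"
    by (rule C0_eqI) (auto intro!: conv_C0 r subspace_scale[OF subspace_C0] eig)
  \<comment> \<open>The squared norms of the \<open>h k\<close> approach \<open>m > 0\<close>, and
    uniform convergence preserves them.\<close>
  moreover have "H \<noteq> 0"
  proof
    assume "H = 0"
    then have "ip H H = 0" by (simp add: ip_def)
    have m1: "(\<lambda>k. m - 1 / real (Suc k)) \<longlonglongrightarrow> m - 0"
      by (intro tendsto_diff tendsto_const lim_1_over_n[THEN LIMSEQ_Suc])
    have "(\<lambda>k. m - 1 / real (Suc (r k))) \<longlonglongrightarrow> m"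
      using LIMSEQ_subseq_LIMSEQ[OF m1 r(1)] unfolding o_def by simp
    then have "m \<le> ip H H"
      by (rule LIMSEQ_le[OF _ ipH(2)]) (use f(3) less_imp_le in \<open>auto simp: h_def\<close>)
    then show False using m_pos \<open>ip H H = 0\<close> by simp
  qed
  ultimately show thesis using that m_pos HW by blast
qed

text \<open>A Hilbert-Schmidt bound: at each \<open>x\<close> the values \<open>conv (u i) x\<close>
  are the coefficients of \<open>kern x\<close>, so Bessel's inequality bounds their sum of squares.
  Integrating over \<open>x\<close> bounds the sum of the eigenvalues.\<close>

lemma eigen_onf_bound:
  assumes u: "onf ip C0 d u" and \<epsilon>: "\<epsilon> > 0" and eig: "\<And>i. i < d \<Longrightarrow> conv (conv (u i)) = c i *\<^sub>R u i \<and> \<epsilon> \<le> c i"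
  shows "real d * \<epsilon> \<le> bd\<^sup>2 * vol * vol"
proof -
  have uC: "u i \<in> C0" if "i < d" for i using u that by (auto simp: onf_def)
  have "real d * \<epsilon> = (\<Sum>i<d. \<epsilon>)" by simp
  also have "\<dots> \<le> (\<Sum>i<d. ip (conv (u i)) (conv (u i)))"
  proof (rule sum_mono)
    fix i assume "i \<in> {..<d}"
    then have i: "i < d" by simp
    have "ip (conv (u i)) (conv (u i)) = ip (u i) (c i *\<^sub>R u i)"
      using conv_sym[OF uC[OF i] conv_C0[OF uC[OF i]]] eig[OF i] by simp
    also have "\<dots> = c i * ip (u i) (u i)" by (simp add: ip_def mult_ac flip: integral_mult_right_zero)
    also have "\<dots> = c i" using u i by (simp add: onf_def)
    finally show "\<epsilon> \<le> ip (conv (u i)) (conv (u i))" using eig[OF i] by simp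
  qed
  also have "\<dots> = (\<integral>x. (\<Sum>i<d. conv (u i) x * conv (u i) x) \<partial>M)"
    unfolding ip_def by (rule Bochner_Integration.integral_sum[symmetric]) (use uC conv_C0 C0_mult_integrable in auto)
  also have "\<dots> \<le> (\<integral>x. bd\<^sup>2 * vol \<partial>M)"
  proof (rule integral_mono)
    show "integrable M (\<lambda>x. \<Sum>i<d. conv (u i) x * conv (u i) x)"
      by (intro Bochner_Integration.integrable_sum C0_mult_integrable conv_C0 uC) auto
    fix x assume "x \<in> space M"
    then have x: "x \<in> carrier G" by (simp add: space_M)
    have "(\<Sum>i<d. conv (u i) x * conv (u i) x) = (\<Sum>i<d. (ip (kern x) (u i))\<^sup>2)"
      using x ip.sym[OF uC kern_C0[OF x]] by (intro sum.cong) (auto simp: conv_def restr_def power2_eq_square)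
    also have "\<dots> \<le> ip (kern x) (kern x)" by (rule ip.bessel[OF u kern_C0[OF x]])
    also have "\<dots> \<le> bd\<^sup>2 * vol" by (rule kern_bound[OF x])
    finally show "(\<Sum>i<d. conv (u i) x * conv (u i) x) \<le> bd\<^sup>2 * vol" .
  qed simp
  also have "\<dots> = bd\<^sup>2 * vol * vol" by (simp add: vol_def mult.commute)
  finally show ?thesis .
qed

end

section \<open>Zero sets of representative functions\<close>

text \<open>Provides the finite spanning set which shows that products of representative functions
  are representative.\<close>

lemma span_mult:
  fixes f h :: "'c \<Rightarrow> real"
  assumes "f \<in> span B" "h \<in> span C" shows "f * h \<in> span ((\<lambda>(b, c). b * c) ` (B \<times> C))"
proof -
  let ?P = "span ((\<lambda>(b, c). b * c) ` (B \<times> C))"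
  have 1: "b * h \<in> ?P" if b: "b \<in> B" for b
    using assms(2)
  proof (induction rule: span_induct)
    case base
    show ?case
    proof (rule subspaceI)
      show "0 \<in> {h. b * h \<in> ?P}" by (simp add: span_zero)
      show "x + y \<in> {h. b * h \<in> ?P}" if "x \<in> {h. b * h \<in> ?P}" "y \<in> {h. b * h \<in> ?P}" for x y
        using that by (simp add: distrib_left span_add)
      show "c *\<^sub>R x \<in> {h. b * h \<in> ?P}" if "x \<in> {h. b * h \<in> ?P}" for c x
      proof -
        have "b * (c *\<^sub>R x) = c *\<^sub>R (b * x)" by (simp add: fun_eq_iff)
        then show ?thesis using that by (simp add: span_scale)
      qed
    qed
  next
    case (step c)
    then show ?case using b by (auto intro: span_base)
  qed
  show ?thesis
    using assms(1)
  proof (induction rule: span_induct)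
    case base
    show ?case
    proof (rule subspaceI)
      show "0 \<in> {f. f * h \<in> ?P}" by (simp add: span_zero)
      show "x + y \<in> {f. f * h \<in> ?P}" if "x \<in> {f. f * h \<in> ?P}" "y \<in> {f. f * h \<in> ?P}" for x y
        using that by (simp add: distrib_right span_add)
      show "c *\<^sub>R x \<in> {f. f * h \<in> ?P}" if "x \<in> {f. f * h \<in> ?P}" for c x
      proof -
        have "(c *\<^sub>R x) * h = c *\<^sub>R (x * h)" by (simp add: fun_eq_iff)
        then show ?thesis using that by (simp add: span_scale)
      qed
    qed
  next
    case (step b)
    then show ?case by (rule 1)
  qed
qed

context topological_group
begin

definition representative :: "('a \<Rightarrow> real) \<Rightarrow> bool" where
  "representative f \<longleftrightarrow> f \<in> C0 \<and> (\<exists>B. finite B \<and> (\<forall>g\<in>carrier G. ltrans g f \<in> span B))"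

lemma representative_const: "representative (restr (\<lambda>_. c))"
  unfolding representative_def
  by (intro conjI restr_C0 exI[of _ "{restr (\<lambda>_. c)}"]) (auto simp: ltrans_def restr_def fun_eq_iff intro!: span_base)

lemma representative_add: "representative f \<Longrightarrow> representative h \<Longrightarrow> representative (f + h)"
  unfolding representative_def
proof (elim conjE exE, intro conjI exI ballI)
  fix B C g
  assume B: "finite B" "\<forall>g\<in>carrier G. ltrans g f \<in> span B" and C: "finite C" "\<forall>g\<in>carrier G. ltrans g h \<in> span C"
  show "f + h \<in> C0" if "f \<in> C0" "h \<in> C0" using that by (intro subspace_add subspace_C0)
  show "finite (B \<union> C)" using B C by simp
  show "ltrans g (f + h) \<in> span (B \<union> C)" if "g \<in> carrier G"
    unfolding ltrans_add using B C that span_mono[of B "B \<union> C"] span_mono[of C "B \<union> C"] by (intro span_add) auto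
qed

lemma representative_mult: "representative f \<Longrightarrow> representative h \<Longrightarrow> representative (f * h)"
  unfolding representative_def
proof (elim conjE exE, intro conjI exI ballI)
  fix B C g
  assume B: "finite B" "\<forall>g\<in>carrier G. ltrans g f \<in> span B" and C: "finite C" "\<forall>g\<in>carrier G. ltrans g h \<in> span C"
  show "f * h \<in> C0" if "f \<in> C0" "h \<in> C0"
    using that by (auto simp: C0_def times_fun_def intro: continuous_map_real_mult)
  show "finite ((\<lambda>(b, c). b * c) ` (B \<times> C))" using B C by simp
  have "ltrans g (f * h) = ltrans g f * ltrans g h" by (auto simp: ltrans_def fun_eq_iff)
  then show "ltrans g (f * h) \<in> span ((\<lambda>(b, c). b * c) ` (B \<times> C))" if "g \<in> carrier G"
    using B C that by (simp add: span_mult)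
qed

lemma representative_scaleR: assumes "representative f" shows "representative (c *\<^sub>R f)"
proof -
  have "c *\<^sub>R f = restr (\<lambda>_. c) * f"
    using assms by (auto simp: representative_def C0_def restr_def fun_eq_iff)
  then show ?thesis using representative_mult[OF representative_const assms] by simp
qed

lemma representative_diff: assumes "representative f" "representative h" shows "representative (f - h)"
  using representative_add[OF assms(1) representative_scaleR[OF assms(2), of "-1"]] by simp

end

context compact_group
begin

definition zeros :: "('a \<Rightarrow> real) set \<Rightarrow> 'a set" where
  "zeros S = {x \<in> carrier G. \<forall>q\<in>S. q x = 0}"

lemma zeros_closed: "S \<subseteq> C0 \<Longrightarrow> closedin T (zeros S)"
proof -
  assume S: "S \<subseteq> C0"
  have "closedin T {x \<in> topspace T. q x \<in> {0}}" if "q \<in> S" for q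
    by (rule closedin_continuous_map_preimage[of T euclideanreal]) (use S that in \<open>auto intro: C0_cont\<close>)
  then have "closedin T (\<Inter>(insert (topspace T) ((\<lambda>q. {x \<in> topspace T. q x \<in> {0}}) ` S)))"
    by (intro closedin_Inter) auto
  also have "\<Inter>(insert (topspace T) ((\<lambda>q. {x \<in> topspace T. q x \<in> {0}}) ` S)) = zeros S"
    by (auto simp: zeros_def topspace_eq)
  finally show ?thesis .
qed

lemma zeros_span: "x \<in> zeros S \<Longrightarrow> q \<in> span S \<Longrightarrow> q x = 0"
proof -
  assume x: "x \<in> zeros S" and "q \<in> span S"
  from this(2) show "q x = 0"
    by (induction rule: span_induct) (use x in \<open>auto simp: zeros_def subspace_def\<close>)
qed

lemma zeros_ltrans: "g \<in> carrier G \<Longrightarrow> zeros (ltrans g ` S) = g <# zeros S"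
  by (subst l_coset_preimage) (auto simp: zeros_def ltrans_def)

lemma l_coset_sets: "g \<in> carrier G \<Longrightarrow> A \<in> sets M \<Longrightarrow> g <# A \<in> sets M"
proof -
  assume g: "g \<in> carrier G" and A: "A \<in> sets M"
  have "(\<lambda>x. inv g \<otimes> x) -` A \<inter> space M \<in> sets M"
    using translation_measurable[of "inv g"] g A by (auto intro: measurable_sets)
  also have "(\<lambda>x. inv g \<otimes> x) -` A \<inter> space M = g <# A"
    using sets.sets_into_space[OF A] g by (subst l_coset_preimage) (auto simp: space_M)
  finally show ?thesis .
qed

lemma l_coset_Int: "g \<in> carrier G \<Longrightarrow> A \<subseteq> carrier G \<Longrightarrow> B \<subseteq> carrier G \<Longrightarrow> g <# (A \<inter> B) = (g <# A) \<inter> (g <# B)"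
proof -
  assume "g \<in> carrier G" "A \<subseteq> carrier G" "B \<subseteq> carrier G"
  moreover from this have "A \<inter> B \<subseteq> carrier G" by blast
  ultimately show ?thesis by (auto simp: l_coset_preimage)
qed

lemma l_coset_cancel:
  assumes "g \<in> carrier G" "A \<subseteq> carrier G" shows "inv g <# (g <# A) = A" "g <# (inv g <# A) = A"
  using assms by (simp_all add: lcos_m_assoc lcos_mult_one)

text \<open>Translates of a zero set \<open>Z\<close> of positive measure with the largest possible number of independent
  equations either coincide with it or meet it in a null set.  Hence its stabilizer is an open
  subgroup.\<close>

lemma representative_zero_set_null:
  assumes conn: "connected_space T"
    and outer: "\<And>A. A \<in> sets M \<Longrightarrow> emeasure M A = (INF U\<in>{U. openin T U \<and> A \<subseteq> U}. emeasure M U)"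
    and f: "representative f" and x0: "x0 \<in> carrier G" "f x0 \<noteq> 0"
  shows "{x \<in> carrier G. f x = 0} \<in> null_sets M"
proof (rule ccontr)
  assume nn: "{x \<in> carrier G. f x = 0} \<notin> null_sets M"
  have fC: "f \<in> C0" using f by (simp add: representative_def)
  obtain B where B: "finite B" "\<And>g. g \<in> carrier G \<Longrightarrow> ltrans g f \<in> span B"
    using f by (auto simp: representative_def)
  define Q where "Q = span ((\<lambda>g. ltrans g f) ` carrier G)"
  have QB: "Q \<subseteq> span B" unfolding Q_def by (rule span_minimal) (use B in auto)
  have QC: "Q \<subseteq> C0" unfolding Q_def by (rule span_minimal) (use fC ltrans_C0 subspace_C0 in auto)
  have Qf: "f \<in> Q" unfolding Q_def
    by (rule span_base, rule image_eqI[of _ _ \<one>]) (use fC in \<open>auto simp: ltrans_one\<close>)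
  have Q_ltrans: "ltrans g q \<in> Q" if g: "g \<in> carrier G" and "q \<in> Q" for g q
    using that(2) unfolding Q_def
  proof (induction rule: span_induct)
    case base
    show ?case
      using ltrans_scaleR[of g 0 f]
      by (auto simp: subspace_def ltrans_add ltrans_scaleR span_add span_scale span_zero)
  next
    case (step q)
    then obtain h where "h \<in> carrier G" "q = ltrans h f" by blast
    then show ?case using g by (auto intro!: span_base imageI simp: ltrans_mult)
  qed
  \<comment> \<open>Keeping \<open>f\<close> in the span ensures that the common zeros of
    \<open>S\<close> remain zeros of \<open>f\<close>; the size of \<open>S\<close> is bounded
    because all translates of \<open>f\<close> lie in the span of \<open>B\<close>.\<close>
  define good where "good S \<longleftrightarrow> S \<subseteq> Q \<and> independent S \<and> f \<in> span S \<and> zeros S \<notin> null_sets M" for S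
  have good_le: "finite S \<and> card S \<le> card B" if "good S" for S
    using independent_span_bound[OF B(1), of S] that QB by (auto simp: good_def)
  have "good {f}"
  proof -
    have "f \<noteq> 0" using x0 by auto
    then show ?thesis using nn Qf by (auto simp: good_def zeros_def span_base dependent_single)
  qed
  define k where "k = (GREATEST k. \<exists>S. good S \<and> card S = k)"
  have "\<exists>S. good S \<and> card S = k"
    unfolding k_def by (rule GreatestI_ex_nat[where b = "card B"]) (use \<open>good {f}\<close> good_le in blast)+
  then obtain S where S: "good S" "card S = k" by blast
  have max: "card S' \<le> card S" if "good S'" for S'
    unfolding S(2) k_def by (rule Greatest_le_nat[where b = "card B"]) (use that good_le in blast)+
  have SQ: "S \<subseteq> Q" "independent S" "f \<in> span S" and finS: "finite S" using S good_le by (auto simp: good_def)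
  define Z where "Z = zeros S"
  have Zcl: "closedin T Z" unfolding Z_def by (rule zeros_closed) (use SQ QC in blast)
  have Zs: "Z \<in> sets M" by (rule closed_sets_M[OF Zcl])
  have ZG: "Z \<subseteq> carrier G" by (auto simp: Z_def zeros_def)
  have Zpos: "measure M Z > 0"
    using S(1) Zs by (auto simp: good_def Z_def null_sets_def emeasure_eq_measure zero_less_measure_iff)
  have gZs: "g <# Z \<in> sets M" if "g \<in> carrier G" for g using l_coset_sets[OF that Zs] .
  have meas: "measure M (g <# A) = measure M A" if "g \<in> carrier G" "A \<in> sets M" for g A
    using inv_M[OF that] by (simp add: measure_def)
  have sub: "Z \<subseteq> g <# Z" if g: "g \<in> carrier G" and m: "measure M (Z \<inter> (g <# Z)) \<noteq> 0" for g
  proof -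
    have "ltrans g ` S \<subseteq> span S"
    proof (rule ccontr)
      assume "\<not> ltrans g ` S \<subseteq> span S"
      then obtain q where q: "q \<in> S" "ltrans g q \<notin> span S" by auto
      let ?S = "insert (ltrans g q) S"
      have "Z \<inter> (g <# Z) \<subseteq> zeros ?S"
        unfolding Z_def zeros_ltrans[OF g, symmetric] using q by (auto simp: zeros_def)
      moreover have "zeros ?S \<in> sets M"
        by (rule closed_sets_M[OF zeros_closed]) (use SQ QC Q_ltrans[OF g] q in blast)
      moreover have "Z \<inter> (g <# Z) \<notin> null_sets M"
        using m Zs gZs[OF g] by (auto simp: null_sets_def emeasure_eq_measure)
      ultimately have "zeros ?S \<notin> null_sets M" using null_sets_subset Zs gZs[OF g] by blast
      moreover have "independent ?S" using independent_insertI[OF q(2) SQ(2)] .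
      moreover have "f \<in> span ?S" using SQ(3) span_mono[of S ?S] by blast
      moreover have "?S \<subseteq> Q" using SQ(1) Q_ltrans[OF g] q by blast
      ultimately have "good ?S" by (simp add: good_def)
      moreover have "ltrans g q \<notin> S" using q(2) span_base by blast
      ultimately show False using max[of ?S] finS by simp
    qed
    then show ?thesis
      unfolding Z_def zeros_ltrans[OF g, symmetric] using zeros_span[of _ S] by (auto simp: zeros_def[of "ltrans g ` S"] zeros_def[of S])
  qed
  define H where "H = {g \<in> carrier G. g <# Z = Z}"
  have H_iff: "g \<in> H \<longleftrightarrow> measure M (Z \<inter> (g <# Z)) \<noteq> 0" if g: "g \<in> carrier G" for g
  proof
    assume "g \<in> H" then show "measure M (Z \<inter> (g <# Z)) \<noteq> 0" using Zpos by (simp add: H_def)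
  next
    assume m: "measure M (Z \<inter> (g <# Z)) \<noteq> 0"
    have gZG: "g <# Z \<subseteq> carrier G" using sets.sets_into_space[OF gZs[OF g]] by (simp add: space_M)
    have "measure M (Z \<inter> (inv g <# Z)) = measure M (g <# (Z \<inter> (inv g <# Z)))"
      by (rule meas[symmetric]) (use g Zs gZs in auto)
    also have "g <# (Z \<inter> (inv g <# Z)) = (g <# Z) \<inter> Z"
      using l_coset_Int[OF g ZG, of "inv g <# Z"] sets.sets_into_space[OF gZs[of "inv g"]] g l_coset_cancel[OF g ZG]
      by (simp add: space_M)
    finally have "measure M (Z \<inter> (inv g <# Z)) \<noteq> 0" using m by (simp add: Int_commute)
    then have "Z \<subseteq> inv g <# Z" using sub[of "inv g"] g by simp
    then have "g <# Z \<subseteq> g <# (inv g <# Z)" by (auto simp: l_coset_def)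
    then have "g <# Z \<subseteq> Z" using l_coset_cancel[OF g ZG] by simp
    then show "g \<in> H" using sub[OF g m] g by (auto simp: H_def)
  qed
  have H_mult: "g \<otimes> h \<in> H" if "g \<in> H" "h \<in> H" for g h
    using that ZG by (auto simp: H_def lcos_m_assoc[symmetric])
  have H_inv: "inv g \<in> H" if "g \<in> H" for g
    using that l_coset_cancel[of g Z] ZG by (auto simp: H_def)
  obtain N where N: "openin T N" "\<one> \<in> N" "N \<subseteq> H"
  proof -
    \<comment> \<open>Outer regularity yields an open \<open>U\<close> around \<open>Z\<close> of
      measure less than twice that of \<open>Z\<close>. For \<open>g\<close> near the unit both
      \<open>Z\<close> and its translate fit into \<open>U\<close>, so they must overlap in positive
      measure.\<close>
    have "emeasure M Z < emeasure M Z + emeasure M Z"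
      using Zpos by (simp add: emeasure_eq_measure ennreal_plus[symmetric] ennreal_less_iff del: ennreal_plus)
    then obtain U where U: "openin T U" "Z \<subseteq> U" "emeasure M U < emeasure M Z + emeasure M Z"
      by (subst (asm) (1) outer[OF Zs]) (auto simp: INF_less_iff)
    have mU: "measure M U < 2 * measure M Z"
      using U(3) Zpos by (simp add: emeasure_eq_measure ennreal_plus[symmetric] ennreal_less_iff del: ennreal_plus)
    define W where "W = {p \<in> topspace (prod_topology T T). (case p of (x, y) \<Rightarrow> x \<otimes> y) \<in> U}"
    have "openin (prod_topology T T) W" unfolding W_def by (rule openin_continuous_map_preimage[OF continuous_mult U(1)])
    moreover have "compactin T Z" using closedin_compact_space[OF compact_T Zcl] .
    moreover have "{\<one>} \<times> Z \<subseteq> W" using ZG U(2) by (force simp: W_def topspace_eq subset_iff)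
    ultimately obtain N V where NV: "openin T N" "openin T V" "\<one> \<in> N" "Z \<subseteq> V" "N \<times> V \<subseteq> W"
      using tube_lemma_right[of T T W Z \<one>] by (auto simp: topspace_eq)
    have "g \<in> H" if g: "g \<in> N" for g
    proof -
      have gG: "g \<in> carrier G" using g NV(1) openin_subset topspace_eq by blast
      have "g \<otimes> z \<in> U" if "z \<in> Z" for z
      proof -
        have "(g, z) \<in> W" using NV(4,5) g that by blast
        then show ?thesis by (simp add: W_def)
      qed
      then have "g <# Z \<subseteq> U" by (auto simp: l_coset_def)
      then have "measure M (Z \<union> (g <# Z)) \<le> measure M U"
        using U by (intro finite_measure_mono open_sets_M) auto
      moreover have "measure M (Z \<union> (g <# Z)) = measure M Z + measure M (g <# Z) - measure M (Z \<inter> (g <# Z))"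
        using Zs gZs[OF gG] by (intro measure_Un3) (auto simp: fmeasurable_def emeasure_eq_measure)
      ultimately have "measure M (Z \<inter> (g <# Z)) \<noteq> 0" using mU meas[OF gG Zs] by simp
      then show ?thesis using H_iff[OF gG] by simp
    qed
    then show thesis using that NV by blast
  qed
  have NG: "N \<subseteq> carrier G" using N(1) openin_subset topspace_eq by blast
  have HG: "H \<subseteq> carrier G" by (auto simp: H_def)
  have mem: "h \<in> h <# N" if "h \<in> carrier G" for h using N(2) that by (force simp: l_coset_def)
  have "openin T H"
  proof (subst openin_subopen, intro ballI)
    fix h assume h: "h \<in> H"
    then have "h <# N \<subseteq> H" using N(3) H_mult by (auto simp: l_coset_def)
    then show "\<exists>U. openin T U \<and> h \<in> U \<and> U \<subseteq> H" using openin_l_coset[of h N] N(1) mem h HG by blast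
  qed
  moreover have "openin T (topspace T - H)"
  proof (subst openin_subopen, intro ballI)
    fix h assume h: "h \<in> topspace T - H"
    then have hG: "h \<in> carrier G" by (simp add: topspace_eq)
    have "h <# N \<subseteq> topspace T - H"
    proof
      fix y assume "y \<in> h <# N"
      then obtain u where u: "u \<in> N" "y = h \<otimes> u" by (auto simp: l_coset_def)
      have "h = y \<otimes> inv u" using u hG NG by (simp add: m_assoc subset_iff)
      then have "y \<notin> H" using H_mult[OF _ H_inv, of y u] u N(3) h by auto
      then show "y \<in> topspace T - H" using u hG NG by (auto simp: topspace_eq)
    qed
    then show "\<exists>U. openin T U \<and> h \<in> U \<and> U \<subseteq> topspace T - H" using openin_l_coset[OF hG N(1)] mem[OF hG] by blast
  qed
  ultimately have "H = {} \<or> H = topspace T"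
    using conn HG unfolding connected_space_clopen_in closedin_def by (simp add: topspace_eq)
  then have H: "H = carrier G" using N(2,3) by (auto simp: topspace_eq)
  \<comment> \<open>A nonempty set stable under all translations is the whole group, so it contains
    \<open>x0\<close>, although \<open>f x0 \<noteq> 0\<close>.\<close>
  have "Z \<noteq> {}" using Zpos by auto
  then obtain z where z: "z \<in> Z" by blast
  have zG: "z \<in> carrier G" using z ZG by blast
  have "x0 \<otimes> inv z \<in> H" using x0 zG H by simp
  then have "(x0 \<otimes> inv z) <# Z = Z" by (simp add: H_def)
  moreover have "(x0 \<otimes> inv z) \<otimes> z \<in> (x0 \<otimes> inv z) <# Z" using z by (auto simp: l_coset_def)
  ultimately have "x0 \<in> Z" using x0 zG by (simp add: m_assoc)
  then have "f x0 = 0" using zeros_span[of x0 S f] SQ(3) by (simp add: Z_def)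
  then show False using x0 by simp
qed

end

section \<open>Finite-dimensional representations on functions\<close>

context group
begin

text \<open>Letters are named by truth values and not by group elements, so a word is independent of
  the pair at which it is evaluated and there are only countably many words.\<close>

definition gword :: "'a \<Rightarrow> 'a \<Rightarrow> (bool \<times> bool) list \<Rightarrow> 'a" where
  "gword x y w = foldr (\<lambda>(c, \<epsilon>) g. (if \<epsilon> then (if c then x else y) else inv (if c then x else y)) \<otimes> g) w \<one>"

lemma gword_simps [simp]:
  "gword x y [] = \<one>"
  "gword x y ((c, \<epsilon>) # w) = (if \<epsilon> then (if c then x else y) else inv (if c then x else y)) \<otimes> gword x y w"
  by (simp_all add: gword_def)

lemma gword_closed [simp]: "x \<in> carrier G \<Longrightarrow> y \<in> carrier G \<Longrightarrow> gword x y w \<in> carrier G"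
  by (induction w) auto

end

locale function_rep = compact_group G T M
  for G :: "('a, 'b) monoid_scheme" (structure) and T :: "'a topology" and M :: "'a measure" +
  fixes V :: "('a \<Rightarrow> real) set" and n :: nat and b :: "nat \<Rightarrow> 'a \<Rightarrow> real"
  assumes conn: "connected_space T" and V: "subspace V" "V \<subseteq> C0"
    and V_ltrans: "g \<in> carrier G \<Longrightarrow> f \<in> V \<Longrightarrow> ltrans g f \<in> V"
    and onf_b: "onf ip V n b" and max_b: "\<not> onf ip V (Suc n) u"
begin

lemma VC: "f \<in> V \<Longrightarrow> f \<in> C0" using V by blast

lemma bV: "i < n \<Longrightarrow> b i \<in> V" and bC: "i < n \<Longrightarrow> b i \<in> C0"
  using onf_b V by (auto simp: onf_def)

lemma b_orth: "i < n \<Longrightarrow> j < n \<Longrightarrow> ip (b i) (b j) = (if i = j then 1 else 0)"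
  using onf_b by (auto simp: onf_def)

sublocale ipV: inner_form ip V
proof
  show "subspace V" by (rule V)
  show "ip x y = ip y x" if "x \<in> V" "y \<in> V" for x y using that by (intro ip.sym VC)
  show "ip (x + y) z = ip x z + ip y z" if "x \<in> V" "y \<in> V" "z \<in> V" for x y z
    using that by (intro ip.add VC)
  show "ip (r *\<^sub>R x) z = r * ip x z" if "x \<in> V" "z \<in> V" for x z r
    using that by (intro ip.scale VC)
  show "0 \<le> ip x x" if "x \<in> V" for x using that by (intro ip.nonneg VC)
  show "x = 0" if "x \<in> V" "ip x x = 0" for x using that by (intro ip.pos VC)
qed

lemma expand: "f \<in> V \<Longrightarrow> f = (\<Sum>i<n. ip f (b i) *\<^sub>R b i)"
  by (rule ipV.maximal_onf_expands[OF onf_b max_b])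

lemma V_eqI:
  assumes "f \<in> V" "h \<in> V" "\<And>i. i < n \<Longrightarrow> ip f (b i) = ip h (b i)" shows "f = h"
proof -
  have "f = (\<Sum>i<n. ip f (b i) *\<^sub>R b i)" by (rule expand[OF assms(1)])
  also have "\<dots> = (\<Sum>i<n. ip h (b i) *\<^sub>R b i)" by (intro sum.cong) (auto simp: assms(3))
  also have "\<dots> = h" by (rule expand[OF assms(2), symmetric])
  finally show ?thesis .
qed

definition rho :: "'a \<Rightarrow> nat \<Rightarrow> nat \<Rightarrow> real" where
  "rho g i j = ip (ltrans g (b j)) (b i)"

lemma coords:
  assumes "g \<in> carrier G" "f \<in> V" "i < n"
  shows "ip (ltrans g f) (b i) = (\<Sum>j<n. rho g i j * ip f (b j))"
proof -
  have "ltrans g f = (\<Sum>j<n. ip f (b j) *\<^sub>R ltrans g (b j))"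
    by (subst expand[OF assms(2)]) (simp add: ltrans_sum ltrans_scaleR)
  then have "ip (ltrans g f) (b i) = (\<Sum>j<n. ip f (b j) * ip (ltrans g (b j)) (b i))"
    using ipV.sum_left[of n "\<lambda>j. ltrans g (b j)" "b i" "\<lambda>j. ip f (b j)"] V_ltrans assms bV by simp
  then show ?thesis by (simp add: rho_def mult.commute)
qed

lemma rho_mult:
  assumes "g \<in> carrier G" "h \<in> carrier G" "i < n" "j < n"
  shows "rho (g \<otimes> h) i j = (\<Sum>k<n. rho g i k * rho h k j)"
  using coords[OF assms(1) V_ltrans[OF assms(2) bV[OF assms(4)]] assms(3)] assms
  by (simp add: rho_def ltrans_mult)

lemma rho_one: "i < n \<Longrightarrow> j < n \<Longrightarrow> rho \<one> i j = (if i = j then 1 else 0)"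
  by (simp add: rho_def ltrans_one bC b_orth eq_commute)

lemma rho_inv:
  assumes "g \<in> carrier G" "i < n" "j < n" shows "rho (inv g) i j = rho g j i"
  using ip_ltrans_adjoint[of "inv g" "b j" "b i"] assms ip.sym[OF bC ltrans_C0[OF bC]]
    bC[OF assms(2)] bC[OF assms(3)]
  by (simp add: rho_def)

lemma rho_continuous:
  assumes ij: "i < n" "j < n" shows "continuous_map T euclideanreal (\<lambda>g. rho g i j)"
proof (rule continuous_map_realI)
  fix g0 and \<epsilon> :: real assume "g0 \<in> topspace T" and \<epsilon>: "\<epsilon> > 0"
  then have g0: "g0 \<in> carrier G" by (simp add: topspace_eq)
  define \<delta> where "\<delta> = \<epsilon> / sqrt (2 * vol)"
  have \<delta>: "\<delta> > 0" "\<delta>\<^sup>2 * vol = \<epsilon>\<^sup>2 / 2" using \<epsilon> vol_pos by (auto simp: \<delta>_def power_divide)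
  have "continuous_map (prod_topology T T) T (\<lambda>p. inv (fst p) \<otimes> snd p)"
    by (intro continuous_map_compose_mult continuous_map_compose_inv continuous_map_fst continuous_map_snd)
  from continuous_map_compose[OF this C0_cont[OF bC[OF ij(2)]]]
  have "continuous_map (prod_topology T T) euclideanreal (\<lambda>(g, x). b j (inv g \<otimes> x))"
    by (simp add: o_def case_prod_unfold)
  from tube_uniform[OF this compact_T \<open>g0 \<in> topspace T\<close> \<delta>(1)]
  obtain U where U: "openin T U" "g0 \<in> U"
    "\<And>g x. g \<in> U \<Longrightarrow> x \<in> topspace T \<Longrightarrow> \<bar>b j (inv g \<otimes> x) - b j (inv g0 \<otimes> x)\<bar> < \<delta>" by blast
  have "\<bar>rho g i j - rho g0 i j\<bar> < \<epsilon>" if g: "g \<in> U" for g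
  proof -
    have gG: "g \<in> carrier G" using g U(1) openin_subset topspace_eq by blast
    let ?d = "ltrans g (b j) - ltrans g0 (b j)"
    have C: "ltrans g (b j) \<in> C0" "ltrans g0 (b j) \<in> C0" using gG g0 ij bC ltrans_C0 by auto
    have d: "?d \<in> C0" by (intro subspace_diff subspace_C0 C)
    have "ip ?d ?d \<le> \<delta>\<^sup>2 * vol"
    proof (rule ip_le_of_bound[OF d])
      fix x assume "x \<in> carrier G"
      then show "(?d x)\<^sup>2 \<le> \<delta>\<^sup>2"
        using U(3)[OF g, of x] \<delta>(1) by (simp add: ltrans_def abs_le_square_iff[symmetric] topspace_eq less_imp_le)
    qed
    moreover have "rho g i j - rho g0 i j = ip ?d (b i)"
      unfolding rho_def by (rule ip.diff[OF C bC[OF ij(1)], symmetric])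
    ultimately have "(rho g i j - rho g0 i j)\<^sup>2 \<le> \<delta>\<^sup>2 * vol"
      using ip.cauchy_schwarz[OF d bC[OF ij(1)]] b_orth[OF ij(1) ij(1)] by simp
    also have "\<dots> < \<epsilon>\<^sup>2" unfolding \<delta>(2) using zero_less_power[OF \<epsilon>, of 2] by linarith
    finally have "\<bar>rho g i j - rho g0 i j\<bar>\<^sup>2 < \<epsilon>\<^sup>2" by simp
    then show ?thesis by (rule power2_less_imp_less) (use \<epsilon> in simp)
  qed
  then show "\<exists>U. openin T U \<and> g0 \<in> U \<and> (\<forall>g\<in>U. \<bar>rho g i j - rho g0 i j\<bar> < \<epsilon>)" using U by blast
qed

definition R :: "'a \<Rightarrow> fmat" where "R g = Mat n (\<lambda>i j. of_real (rho g i j))"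

lemma bnd_R [simp]: "bnd n (R g)" by (simp add: R_def)

lemma R_mult: "g \<in> carrier G \<Longrightarrow> h \<in> carrier G \<Longrightarrow> R (g \<otimes> h) = R g * R h"
  by (rule fmat_eqI) (auto simp: R_def ent_times[OF bnd_Mat] rho_mult)

lemma R_one: "R \<one> = Idm n"
  by (rule fmat_eqI) (auto simp: R_def Idm_def rho_one)

lemma R_inv: "g \<in> carrier G \<Longrightarrow> R (inv g) = adj (R g)"
  by (rule fmat_eqI) (auto simp: R_def rho_inv)

lemma R_continuous: "continuous_map T euclidean R"
  unfolding continuous_map_atin limitin_canonical_iff
proof
  fix g assume g: "g \<in> topspace T"
  show "(R \<longlongrightarrow> R g) (atin T g)"
  proof (rule tendsto_fmatI[of n])
    show "((\<lambda>k. ent (R k) i j) \<longlongrightarrow> ent (R g) i j) (atin T g)" for i j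
    proof (cases "i < n \<and> j < n")
      case True
      then have "((\<lambda>k. rho k i j) \<longlongrightarrow> rho g i j) (atin T g)"
        using rho_continuous[of i j] g unfolding continuous_map_atin limitin_canonical_iff by blast
      then show ?thesis using True by (simp add: R_def tendsto_of_real)
    qed (auto simp: R_def)
  qed auto
qed

sublocale U: unitary_group n "R ` carrier G"
proof
  have "compactin euclidean (R ` topspace T)"
    using image_compactin[OF _ R_continuous] compact_T compact_space_def by blast
  then show "compact (R ` carrier G)" by (simp add: topspace_eq)
  have "connectedin euclidean (R ` topspace T)"
    using connectedin_continuous_map_image[OF R_continuous] conn connectedin_topspace by blast
  then show "connected (R ` carrier G)" by (simp add: topspace_eq connectedin_iff_connected)
  show "Idm n \<in> R ` carrier G" using R_one one_closed by (metis imageI)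
  show "k * l \<in> R ` carrier G" if "k \<in> R ` carrier G" "l \<in> R ` carrier G" for k l
    using that by (auto simp: R_mult[symmetric])
  show "adj k \<in> R ` carrier G" if "k \<in> R ` carrier G" for k
    using that by (auto simp: R_inv[symmetric])
  show "adj k * k = Idm n" "k * adj k = Idm n" if "k \<in> R ` carrier G" for k
    using that by (auto simp: R_inv[symmetric] R_mult[symmetric] R_one)
qed auto

text \<open>The coordinate vector repeated in all \<open>n\<close> columns, so that the results on
  matrices fixed by left multiplication apply to functions.\<close>

definition vec_of :: "('a \<Rightarrow> real) \<Rightarrow> fmat" where
  "vec_of f = Mat n (\<lambda>i _. of_real (ip f (b i)))"

lemma R_vec_of: "g \<in> carrier G \<Longrightarrow> f \<in> V \<Longrightarrow> R g * vec_of f = vec_of (ltrans g f)"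
  by (rule fmat_eqI) (auto simp: R_def vec_of_def ent_times[OF bnd_Mat] coords)

lemma vec_of_inj: assumes "f \<in> V" "h \<in> V" "vec_of f = vec_of h" shows "f = h"
proof (rule V_eqI[OF assms(1,2)])
  fix i assume "i < n"
  then show "ip f (b i) = ip h (b i)"
    using arg_cong[OF assms(3), of "\<lambda>A. ent A i i"] by (simp add: vec_of_def)
qed

lemma generic_pair:
  obtains x y where "x \<in> carrier G" "y \<in> carrier G"
    "\<And>f g. f \<in> V \<Longrightarrow> ltrans x f = f \<Longrightarrow> ltrans y f = f \<Longrightarrow> g \<in> carrier G \<Longrightarrow> ltrans g f = f"
proof -
  obtain k l where kl: "k \<in> R ` carrier G" "l \<in> R ` carrier G"
    "\<And>v m. bnd n v \<Longrightarrow> k * v = v \<Longrightarrow> l * v = v \<Longrightarrow> m \<in> R ` carrier G \<Longrightarrow> m * v = v"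
    using U.generic_pair_fixed_vectors by blast
  then obtain x y where xy: "x \<in> carrier G" "y \<in> carrier G" "k = R x" "l = R y" by blast
  show thesis
  proof (rule that[OF xy(1,2)])
    fix f g assume f: "f \<in> V" "ltrans x f = f" "ltrans y f = f" and g: "g \<in> carrier G"
    have "R g * vec_of f = vec_of f"
      by (rule kl(3)) (use f g xy in \<open>auto simp: R_vec_of, simp add: vec_of_def\<close>)
    then have "vec_of (ltrans g f) = vec_of f" using R_vec_of[OF g f(1)] by simp
    then show "ltrans g f = f" by (intro vec_of_inj V_ltrans f g)
  qed
qed

text \<open>The Gram determinant of the equations \<open>ltrans x f = f\<close> and \<open>ltrans y f = f\<close> on \<open>V\<close>.\<close>

definition dev :: "'a \<Rightarrow> nat \<Rightarrow> nat \<Rightarrow> real" where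
  "dev g i j = rho g i j - (if i = j then 1 else 0)"

definition gram :: "'a \<Rightarrow> 'a \<Rightarrow> nat \<Rightarrow> nat \<Rightarrow> real" where
  "gram x y i j = (\<Sum>k<n. dev x k i * dev x k j + dev y k i * dev y k j)"

definition gram_det :: "'a \<Rightarrow> 'a \<Rightarrow> real" where
  "gram_det x y = Determinant.det (Matrix.mat n n (\<lambda>(i, j). gram x y i j))"

lemma dev_coords:
  assumes "g \<in> carrier G" "f \<in> V" "i < n"
  shows "(\<Sum>j<n. dev g i j * ip f (b j)) = ip (ltrans g f) (b i) - ip f (b i)"
proof -
  have "(\<Sum>j<n. dev g i j * ip f (b j)) = (\<Sum>j<n. rho g i j * ip f (b j)) - (\<Sum>j<n. if j = i then ip f (b i) else 0)"
    unfolding dev_def sum_subtractf[symmetric] by (intro sum.cong) (auto simp: left_diff_distrib)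
  then show ?thesis using assms by (simp add: coords)
qed

text \<open>The Gram matrix is the sum of the transposes of the two \<open>dev\<close> matrices
  times these matrices, and \<open>dev\<close> measures how far a function is moved.\<close>

lemma gram_apply:
  assumes x: "x \<in> carrier G" and y: "y \<in> carrier G" and f: "f \<in> V"
  shows "(\<Sum>j<n. gram x y i j * ip f (b j)) = (\<Sum>k<n. dev x k i * (ip (ltrans x f) (b k) - ip f (b k))
      + dev y k i * (ip (ltrans y f) (b k) - ip f (b k)))"
proof -
  have "(\<Sum>j<n. gram x y i j * ip f (b j))
      = (\<Sum>j<n. \<Sum>k<n. (dev x k i * dev x k j + dev y k i * dev y k j) * ip f (b j))"
    unfolding gram_def sum_distrib_right ..
  also have "\<dots> = (\<Sum>k<n. \<Sum>j<n. (dev x k i * dev x k j + dev y k i * dev y k j) * ip f (b j))" by (rule sum.swap)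
  also have "\<dots> = (\<Sum>k<n. dev x k i * (\<Sum>j<n. dev x k j * ip f (b j)) + dev y k i * (\<Sum>j<n. dev y k j * ip f (b j)))"
    by (intro sum.cong refl) (simp add: sum_distrib_left sum.distrib[symmetric] algebra_simps)
  finally show ?thesis using x y f by (simp add: dev_coords)
qed

lemma gram_mult_vec:
  "i < n \<Longrightarrow> vec_index (Matrix.mat n n (\<lambda>(i, j). gram x y i j) *\<^sub>v Matrix.vec n c) i = (\<Sum>j<n. gram x y i j * c j)"
  by (simp add: scalar_prod_def lessThan_atLeast0)

lemma gram_det_zero:
  assumes x: "x \<in> carrier G" and y: "y \<in> carrier G" and f: "f \<in> V" "f \<noteq> 0" "ltrans x f = f" "ltrans y f = f"
  shows "gram_det x y = 0"
proof -
  let ?A = "Matrix.mat n n (\<lambda>(i, j). gram x y i j)" and ?v = "Matrix.vec n (\<lambda>i. ip f (b i))"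
  have "?A *\<^sub>v ?v = 0\<^sub>v n"
  proof (rule eq_vecI)
    fix i assume "i < dim_vec (0\<^sub>v n :: real vec)"
    then have "i < n" by simp
    then show "vec_index (?A *\<^sub>v ?v) i = vec_index (0\<^sub>v n) i"
      unfolding gram_mult_vec[OF \<open>i < n\<close>] gram_apply[OF x y f(1)] using f(3,4) by simp
  qed simp
  moreover have "?v \<noteq> 0\<^sub>v n"
  proof
    assume 0: "?v = 0\<^sub>v n"
    have "ip f (b i) = 0" if "i < n" for i
      using arg_cong[OF 0, of "\<lambda>v. vec_index v i"] that by simp
    then have "f = 0" by (subst expand[OF f(1)]) simp
    then show False using f(2) by simp
  qed
  ultimately show ?thesis
    unfolding gram_det_def by (subst det_0_iff_vec_prod_zero_field[of _ n]) (auto intro!: exI[of _ ?v])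
qed

text \<open>For a generic pair a kernel vector of the Gram matrix is the coordinate vector of a
  function fixed by both elements, hence by the whole group, hence zero.\<close>

lemma gram_det_nonzero:
  assumes no_fix: "\<And>f. f \<in> V \<Longrightarrow> (\<And>g. g \<in> carrier G \<Longrightarrow> ltrans g f = f) \<Longrightarrow> f = 0"
  shows "\<exists>x\<in>carrier G. \<exists>y\<in>carrier G. gram_det x y \<noteq> 0"
proof -
  obtain x y where xy: "x \<in> carrier G" "y \<in> carrier G"
    "\<And>f g. f \<in> V \<Longrightarrow> ltrans x f = f \<Longrightarrow> ltrans y f = f \<Longrightarrow> g \<in> carrier G \<Longrightarrow> ltrans g f = f"
    using generic_pair by blast
  let ?A = "Matrix.mat n n (\<lambda>(i, j). gram x y i j)"
  have "gram_det x y \<noteq> 0"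
  proof
    assume "gram_det x y = 0"
    then obtain v where v: "v \<in> carrier_vec n" "v \<noteq> 0\<^sub>v n" "?A *\<^sub>v v = 0\<^sub>v n"
      unfolding gram_det_def by (subst (asm) det_0_iff_vec_prod_zero_field[of _ n]) auto
    define f where "f = (\<Sum>i<n. vec_index v i *\<^sub>R b i)"
    have f: "f \<in> V" unfolding f_def by (rule ipV.sum_in) (rule bV)
    have c: "ip f (b i) = vec_index v i" if "i < n" for i
    proof -
      have "ip f (b i) = (\<Sum>j<n. vec_index v j * ip (b j) (b i))"
        unfolding f_def by (rule ipV.sum_left) (use bV that in auto)
      also have "\<dots> = (\<Sum>j<n. if j = i then vec_index v i else 0)"
        using that by (intro sum.cong) (auto simp: b_orth)
      finally show ?thesis using that by simp
    qed
    have vv: "v = Matrix.vec n (\<lambda>i. ip f (b i))" using v(1) c by (intro eq_vecI) auto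
    have 0: "(\<Sum>j<n. gram x y i j * ip f (b j)) = 0" if "i < n" for i
    proof -
      have "(\<Sum>j<n. gram x y i j * ip f (b j)) = vec_index (?A *\<^sub>v Matrix.vec n (\<lambda>i. ip f (b i))) i"
        by (rule gram_mult_vec[OF that, symmetric])
      then show ?thesis unfolding vv[symmetric] v(3) using that by simp
    qed
    define p where "p k = ip (ltrans x f) (b k) - ip f (b k)" for k
    define q where "q k = ip (ltrans y f) (b k) - ip f (b k)" for k
    \<comment> \<open>The quadratic form of the Gram matrix is the sum of the squared coordinates of
      the displacements of \<open>f\<close> under \<open>x\<close> and \<open>y\<close>.\<close>
    have "0 = (\<Sum>i<n. ip f (b i) * (\<Sum>j<n. gram x y i j * ip f (b j)))" using 0 by simp
    also have "\<dots> = (\<Sum>i<n. \<Sum>k<n. ip f (b i) * (dev x k i * p k + dev y k i * q k))"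
      unfolding gram_apply[OF xy(1,2) f] p_def q_def by (simp add: sum_distrib_left)
    also have "\<dots> = (\<Sum>k<n. \<Sum>i<n. ip f (b i) * (dev x k i * p k + dev y k i * q k))" by (rule sum.swap)
    also have "\<dots> = (\<Sum>k<n. (\<Sum>i<n. dev x k i * ip f (b i)) * p k + (\<Sum>i<n. dev y k i * ip f (b i)) * q k)"
      by (intro sum.cong refl) (simp add: sum_distrib_left sum.distrib distrib_left mult_ac)
    also have "\<dots> = (\<Sum>k<n. (p k)\<^sup>2 + (q k)\<^sup>2)"
      by (intro sum.cong refl) (simp add: dev_coords xy f p_def q_def power2_eq_square)
    finally have "(\<Sum>k<n. (p k)\<^sup>2 + (q k)\<^sup>2) = 0" by simp
    then have pq: "(p k)\<^sup>2 + (q k)\<^sup>2 = 0" if "k < n" for k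
      using that by (subst (asm) sum_nonneg_eq_0_iff) auto
    have "p k = 0" "q k = 0" if "k < n" for k using pq[OF that] by (auto simp: sum_power2_eq_zero_iff)
    then have "ltrans x f = f" "ltrans y f = f"
      by (auto intro!: V_eqI V_ltrans f xy simp: p_def q_def)
    then have "f = 0" using no_fix[OF f xy(3)[OF f]] by blast
    then have "vec_index v i = 0" if "i < n" for i using c[OF that] by (simp add: ip_def)
    then have "v = 0\<^sub>v n" using v(1) by (intro eq_vecI) auto
    then show False using v(2) by simp
  qed
  then show ?thesis using xy by blast
qed

lemma R_gword:
  assumes "x \<in> carrier G" "y \<in> carrier G"
  shows "R (gword x y w) = word_prod n (letters (R x) (adj (R x)) (R y) (adj (R y))) w"
proof (induction w)
  case (Cons l w)
  obtain c \<epsilon> where l: "l = (c, \<epsilon>)" by fastforce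
  show ?case using assms Cons by (auto simp: l R_mult R_inv letters_def)
qed (simp add: R_one)

lemma nonabelian_rep_no_law:
  assumes "g \<in> carrier G" "h \<in> carrier G" "R g * R h \<noteq> R h * R g" and w: "reduced_word w" "w \<noteq> []"
  shows "\<exists>x\<in>carrier G. \<exists>y\<in>carrier G. R (gword x y w) \<noteq> Idm n"
  using U.nonabelian_no_law[of "R g" "R h" w] assms by (auto simp: R_gword)

end

section \<open>Eigenspaces as representations\<close>

context convolution
begin

text \<open>Mean zero excludes the nonzero constants, the functions fixed by the whole group. It is
  preserved by translations.\<close>

definition eigenspace :: "real \<Rightarrow> ('a \<Rightarrow> real) set" where
  "eigenspace c = {f \<in> C0. (\<integral>x. f x \<partial>M) = 0 \<and> conv (conv f) = c *\<^sub>R f}"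

lemma integral_plus: "f \<in> C0 \<Longrightarrow> h \<in> C0 \<Longrightarrow> integral\<^sup>L M (f + h) = integral\<^sup>L M f + integral\<^sup>L M h"
  unfolding plus_fun_def by (intro Bochner_Integration.integral_add continuous_integrable C0_cont)

lemma integral_scaleR_fun: "integral\<^sup>L M (r *\<^sub>R f) = r * integral\<^sup>L M f" for f :: "'a \<Rightarrow> real"
  unfolding scaleR_fun_def by simp

lemma eigenspace_subspace: "subspace (eigenspace c)"
proof (rule subspaceI)
  have "conv 0 = 0" using conv_scaleR[of 0 0] subspace_0[OF subspace_C0] by simp
  moreover have "integral\<^sup>L M (0 :: 'a \<Rightarrow> real) = 0" unfolding zero_fun_def by simp
  ultimately show "0 \<in> eigenspace c" unfolding eigenspace_def using subspace_0[OF subspace_C0] by simp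
  show "f + h \<in> eigenspace c" if "f \<in> eigenspace c" "h \<in> eigenspace c" for f h
    using that by (auto simp: eigenspace_def conv_add conv_C0 subspace_add[OF subspace_C0] integral_plus scaleR_add_right)
  show "r *\<^sub>R f \<in> eigenspace c" if "f \<in> eigenspace c" for r f
    using that by (auto simp: eigenspace_def conv_scaleR conv_C0 subspace_scale[OF subspace_C0] integral_scaleR_fun mult.commute)
qed

lemma integral_ltrans: "g \<in> carrier G \<Longrightarrow> f \<in> C0 \<Longrightarrow> (\<integral>x. ltrans g f x \<partial>M) = (\<integral>x. f x \<partial>M)"
proof -
  assume g: "g \<in> carrier G" and f: "f \<in> C0"
  have "(\<integral>x. ltrans g f x \<partial>M) = (\<integral>x. f (inv g \<otimes> x) \<partial>M)"
    by (rule Bochner_Integration.integral_cong) (auto simp: ltrans_def space_M)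
  then show ?thesis using integral_translate[of "inv g" f] g f by (simp add: C0_cont)
qed

lemma eigenspace_ltrans: "g \<in> carrier G \<Longrightarrow> f \<in> eigenspace c \<Longrightarrow> ltrans g f \<in> eigenspace c"
  by (auto simp: eigenspace_def ltrans_C0 integral_ltrans conv_ltrans conv_C0 ltrans_scaleR)

text \<open>Positivity of \<open>c\<close> makes the eigenspace finite-dimensional by the
  Hilbert-Schmidt bound.\<close>

lemma eigenspace_function_rep:
  assumes "c > 0" "connected_space T"
  obtains n b where "function_rep G T M (eigenspace c) n b"
proof -
  have "d \<le> nat \<lceil>bd\<^sup>2 * vol * vol / c\<rceil>" if u: "onf ip (eigenspace c) d u" for d u
  proof -
    have "onf ip C0 d u" using u by (auto simp: onf_def eigenspace_def)
    then have "real d * c \<le> bd\<^sup>2 * vol * vol"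
      by (rule eigen_onf_bound[OF _ assms(1), where c = "\<lambda>_. c"]) (use u in \<open>auto simp: onf_def eigenspace_def\<close>)
    then have "real d \<le> bd\<^sup>2 * vol * vol / c" using assms by (simp add: pos_le_divide_eq)
    then show ?thesis by linarith
  qed
  then obtain n b where "onf ip (eigenspace c) n b" "\<And>u. \<not> onf ip (eigenspace c) (Suc n) u"
    using maximal_onf_exists[of ip "eigenspace c"] by metis
  moreover have "eigenspace c \<subseteq> C0" by (auto simp: eigenspace_def)
  ultimately have "function_rep G T M (eigenspace c) n b"
    using assms(2) eigenspace_subspace eigenspace_ltrans by unfold_locales auto
  then show thesis using that by blast
qed

lemma eigenspace_no_fixed:
  assumes f: "f \<in> eigenspace c" and fx: "\<And>g. g \<in> carrier G \<Longrightarrow> ltrans g f = f" shows "f = 0"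
proof -
  have fC: "f \<in> C0" using f by (simp add: eigenspace_def)
  have c: "f x = f \<one>" if x: "x \<in> carrier G" for x
    using fun_cong[OF fx[OF x], of x] x by (simp add: ltrans_def)
  have "(\<integral>x. f x \<partial>M) = (\<integral>x. f \<one> \<partial>M)"
    by (intro Bochner_Integration.integral_cong refl c) (simp add: space_M)
  then have "f \<one> * vol = 0" using f by (auto simp: eigenspace_def vol_def)
  then have "f \<one> = 0" using vol_pos by simp
  then have "f x = 0" if "x \<in> carrier G" for x using c[OF that] by simp
  then show ?thesis using fC by (auto simp: C0_def fun_eq_iff)
qed

text \<open>Unit eigenfunctions for distinct eigenvalues are orthogonal, so the Hilbert-Schmidt
  bound leaves only finitely many eigenvalues above any \<open>\<epsilon> > 0\<close>.\<close>

lemma countable_eigenvalues: "countable {c. c > 0 \<and> (\<exists>f\<in>C0. f \<noteq> 0 \<and> conv (conv f) = c *\<^sub>R f)}" (is "countable ?E")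
proof -
  have ip_unit: "\<exists>h\<in>C0. ip h h = 1 \<and> conv (conv h) = c *\<^sub>R h" if f: "f \<in> C0" "f \<noteq> 0" "conv (conv f) = c *\<^sub>R f" for f c
  proof -
    have p: "ip f f > 0" using ip.nonneg[OF f(1)] ip.pos[OF f(1)] f(2) by fastforce
    define h where "h = (1 / sqrt (ip f f)) *\<^sub>R f"
    have h: "h \<in> C0" unfolding h_def by (intro subspace_scale subspace_C0 f)
    have "ip h h = (1 / sqrt (ip f f)) * (1 / sqrt (ip f f)) * ip f f"
      by (simp add: h_def ip_def mult_ac flip: integral_mult_right_zero)
    then have "ip h h = 1" using p by simp
    moreover have "conv (conv h) = c *\<^sub>R h" unfolding h_def by (simp add: conv_scaleR conv_C0 f)
    ultimately show ?thesis using h by blast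
  qed
  have fin: "finite {c \<in> ?E. \<epsilon> \<le> c}" if \<epsilon>: "\<epsilon> > 0" for \<epsilon>
  proof (rule ccontr)
    assume inf: "infinite {c \<in> ?E. \<epsilon> \<le> c}"
    \<comment> \<open>One more than the Hilbert-Schmidt bound allows.\<close>
    define N where "N = nat \<lceil>bd\<^sup>2 * vol * vol / \<epsilon>\<rceil> + 1"
    obtain X where X: "X \<subseteq> {c \<in> ?E. \<epsilon> \<le> c}" "finite X" "card X = N"
      using infinite_arbitrarily_large[OF inf, of N] by blast
    obtain \<sigma> where \<sigma>: "bij_betw \<sigma> {..<N} X"
      using ex_bij_betw_nat_finite[OF X(2)] unfolding X(3) lessThan_atLeast0 by blast
    have \<sigma>X: "\<sigma> i \<in> X" if "i < N" for i using bij_betwE[OF \<sigma>] that by simp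
    have "\<exists>h. i < N \<longrightarrow> h \<in> C0 \<and> ip h h = 1 \<and> conv (conv h) = \<sigma> i *\<^sub>R h" for i
    proof (cases "i < N")
      case True
      then obtain f where "f \<in> C0" "f \<noteq> 0" "conv (conv f) = \<sigma> i *\<^sub>R f" using \<sigma>X X(1) by blast
      from ip_unit[OF this] show ?thesis by blast
    qed simp
    then obtain h where h: "\<And>i. i < N \<Longrightarrow> h i \<in> C0" "\<And>i. i < N \<Longrightarrow> ip (h i) (h i) = 1"
      "\<And>i. i < N \<Longrightarrow> conv (conv (h i)) = \<sigma> i *\<^sub>R h i"
      by metis
    have ge: "\<epsilon> \<le> \<sigma> i" if "i < N" for i using \<sigma>X[OF that] X(1) by blast
    have orth: "ip (h i) (h j) = 0" if ij: "i < N" "j < N" "i \<noteq> j" for i j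
    proof -
      have "\<sigma> i * ip (h i) (h j) = ip (conv (conv (h i))) (h j)"
        using ip.scale[OF h(1)[OF ij(1)] h(1)[OF ij(2)]] h(3)[OF ij(1)] by simp
      also have "\<dots> = ip (h i) (conv (conv (h j)))"
        using conv_sym conv_C0 h(1) ij by simp
      also have "\<dots> = \<sigma> j * ip (h i) (h j)"
        using ip.scale[OF h(1)[OF ij(2)] h(1)[OF ij(1)], of "\<sigma> j"] h(3)[OF ij(2)]
          ip.sym[OF h(1)[OF ij(1)] h(1)[OF ij(2)]] ip.sym[OF h(1)[OF ij(1)] conv_C0[OF conv_C0[OF h(1)[OF ij(2)]]]]
        by simp
      finally have "(\<sigma> i - \<sigma> j) * ip (h i) (h j) = 0" by (simp add: left_diff_distrib)
      moreover have "\<sigma> i \<noteq> \<sigma> j" using \<sigma> ij by (auto simp: bij_betw_def inj_on_def)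
      ultimately show ?thesis by simp
    qed
    have "onf ip C0 N h" using h(1,2) orth by (auto simp: onf_def)
    then have "real N * \<epsilon> \<le> bd\<^sup>2 * vol * vol"
      by (rule eigen_onf_bound[OF _ \<epsilon>, where c = \<sigma>]) (use h(3) ge in auto)
    then have "real N \<le> bd\<^sup>2 * vol * vol / \<epsilon>" using \<epsilon> by (simp add: pos_le_divide_eq)
    then show False unfolding N_def by linarith
  qed
  have "?E \<subseteq> (\<Union>k::nat. {c \<in> ?E. 1 / real (Suc k) \<le> c})"
  proof
    fix c assume c: "c \<in> ?E"
    then obtain k where "1 / real (Suc k) < c" using nat_approx_posE by (metis (mono_tags, lifting) mem_Collect_eq)
    then show "c \<in> (\<Union>k::nat. {c \<in> ?E. 1 / real (Suc k) \<le> c})" using c by (auto intro: less_imp_le)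
  qed
  moreover have "countable (\<Union>k::nat. {c \<in> ?E. 1 / real (Suc k) \<le> c})"
    by (rule countable_UN[OF countableI_type countable_finite[OF fin]]) simp
  ultimately show ?thesis by (rule countable_subset)
qed

end

section \<open>Product groups and bump functions\<close>

lemma second_countable_prod:
  assumes "second_countable X" "second_countable Y" shows "second_countable (prod_topology X Y)"
proof -
  obtain \<A> where A: "countable \<A>" "\<And>V. V \<in> \<A> \<Longrightarrow> openin X V"
    "\<And>U x. openin X U \<Longrightarrow> x \<in> U \<Longrightarrow> \<exists>V\<in>\<A>. x \<in> V \<and> V \<subseteq> U"
    using assms(1) unfolding second_countable_def by metis
  obtain \<B> where B: "countable \<B>" "\<And>V. V \<in> \<B> \<Longrightarrow> openin Y V"
    "\<And>U x. openin Y U \<Longrightarrow> x \<in> U \<Longrightarrow> \<exists>V\<in>\<B>. x \<in> V \<and> V \<subseteq> U"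
    using assms(2) unfolding second_countable_def by metis
  show ?thesis
    unfolding second_countable_def
  proof (intro exI[of _ "(\<lambda>(A, B). A \<times> B) ` (\<A> \<times> \<B>)"] conjI allI impI)
    show "countable ((\<lambda>(A, B). A \<times> B) ` (\<A> \<times> \<B>))" using A(1) B(1) by (intro countable_image countable_SIGMA) auto
    show "\<forall>V\<in>(\<lambda>(A, B). A \<times> B) ` (\<A> \<times> \<B>). openin (prod_topology X Y) V"
      using A(2) B(2) by (auto simp: openin_prod_Times_iff)
    fix W p assume "openin (prod_topology X Y) W \<and> p \<in> W"
    moreover obtain x y where p: "p = (x, y)" by fastforce
    ultimately obtain U V where UV: "openin X U" "openin Y V" "x \<in> U" "y \<in> V" "U \<times> V \<subseteq> W"
      unfolding openin_prod_topology_alt by blast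
    obtain U' where U': "U' \<in> \<A>" "x \<in> U'" "U' \<subseteq> U" using A(3)[OF UV(1,3)] by blast
    obtain V' where V': "V' \<in> \<B>" "y \<in> V'" "V' \<subseteq> V" using B(3)[OF UV(2,4)] by blast
    have "U' \<times> V' \<in> (\<lambda>(A, B). A \<times> B) ` (\<A> \<times> \<B>)" using U'(1) V'(1) by auto
    moreover have "p \<in> U' \<times> V'" "U' \<times> V' \<subseteq> W" using U' V' UV(5) p by auto
    ultimately show "\<exists>V\<in>(\<lambda>(A, B). A \<times> B) ` (\<A> \<times> \<B>). p \<in> V \<and> V \<subseteq> W" by blast
  qed
qed

context topological_group
begin

lemma topological_group_prod: "topological_group (G \<times>\<times> G) (prod_topology T T)"
proof -
  interpret P: group "G \<times>\<times> G" by (rule DirProd_group) (rule is_group)+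
  have car: "carrier (G \<times>\<times> G) = carrier G \<times> carrier G" by (simp add: DirProd_def)
  show ?thesis
  proof
    show "topspace (prod_topology T T) = carrier (G \<times>\<times> G)" by (simp add: car topspace_eq)
    have "continuous_map (prod_topology (prod_topology T T) (prod_topology T T)) (prod_topology T T)
        (\<lambda>p. (fst (fst p) \<otimes> fst (snd p), snd (fst p) \<otimes> snd (snd p)))"
      by (intro continuous_map_pairedI continuous_map_compose_mult
          continuous_map_compose[OF continuous_map_fst continuous_map_fst, unfolded o_def]
          continuous_map_compose[OF continuous_map_snd continuous_map_fst, unfolded o_def]
          continuous_map_compose[OF continuous_map_fst continuous_map_snd, unfolded o_def]
          continuous_map_compose[OF continuous_map_snd continuous_map_snd, unfolded o_def])
    moreover have "(\<lambda>p. (fst (fst p) \<otimes> fst (snd p), snd (fst p) \<otimes> snd (snd p)))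
        = (\<lambda>(x, y). x \<otimes>\<^bsub>G \<times>\<times> G\<^esub> y)"
      by (auto simp: fun_eq_iff DirProd_def)
    ultimately show "continuous_map (prod_topology (prod_topology T T) (prod_topology T T)) (prod_topology T T)
        (\<lambda>(x, y). x \<otimes>\<^bsub>G \<times>\<times> G\<^esub> y)" by simp
    have "continuous_map (prod_topology T T) (prod_topology T T) (\<lambda>p. (inv (fst p), inv (snd p)))"
      by (intro continuous_map_pairedI continuous_map_compose_inv continuous_map_fst continuous_map_snd)
    then show "continuous_map (prod_topology T T) (prod_topology T T) (\<lambda>x. inv\<^bsub>G \<times>\<times> G\<^esub> x)"
      by (rule continuous_map_eq) (auto simp: topspace_eq inv_DirProd[OF is_group is_group])
    show "Hausdorff_space (prod_topology T T)" using Hausdorff by (simp add: Hausdorff_space_prod_topology)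
  qed
qed

end

section \<open>Bump functions and the choice of eigenfunctions\<close>

context compact_group
begin

text \<open>After a translation the value of the convolution at \<open>x0\<close> is the integral of
  \<open>f (x0 \<otimes> z) * \<phi> z\<close>. The factor \<open>\<sigma>\<close> stands for the
  sign of \<open>f\<close> near \<open>x0\<close> and makes the integrand nonnegative, with a
  positive value at \<open>\<one>\<close>.\<close>

lemma conv_nonzero:
  assumes "convolution G T M \<phi>" "\<And>x. 0 \<le> \<phi> x" "\<phi> \<one> > 0"
    and f: "f \<in> C0" and x0: "x0 \<in> carrier G"
    and pos: "\<And>z. z \<in> carrier G \<Longrightarrow> \<phi> z \<noteq> 0 \<Longrightarrow> 0 < \<sigma> * f (x0 \<otimes> z)"
  shows "convolution.conv G M \<phi> f \<noteq> 0"
proof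
  interpret convolution G T M \<phi> by (rule assms(1))
  assume 0: "conv f = 0"
  define F where "F y = f y * \<phi> (inv x0 \<otimes> y)" for y
  have "continuous_map T euclideanreal (\<lambda>y. \<phi> (inv x0 \<otimes> y))"
    using continuous_map_compose[OF continuous_map_mult_left C0_cont[OF \<phi>], of "inv x0"] x0 by (simp add: o_def)
  from continuous_map_real_mult[OF C0_cont[OF f] this] have Fc: "continuous_map T euclideanreal F"
    unfolding F_def .
  have "conv f x0 = (\<integral>y. F y \<partial>M)"
  proof -
    have eq: "\<phi> (inv y \<otimes> x0) = \<phi> (inv x0 \<otimes> y)" if "y \<in> carrier G" for y
      using \<phi>_inv[of "inv x0 \<otimes> y"] that x0 by (simp add: inv_mult_group)
    have "ip f (kern x0) = (\<integral>y. F y \<partial>M)"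
      unfolding ip_def by (rule Bochner_Integration.integral_cong) (auto simp: F_def kern_def restr_def space_M eq)
    then show ?thesis using x0 by (simp add: conv_def restr_def)
  qed
  then have "(\<integral>y. F y \<partial>M) = 0" using 0 by simp
  then have "(\<integral>z. F (x0 \<otimes> z) \<partial>M) = 0" using integral_translate[OF x0 Fc] by simp
  then have int0: "(\<integral>z. \<sigma> * F (x0 \<otimes> z) \<partial>M) = 0" by simp
  have Fz: "F (x0 \<otimes> z) = f (x0 \<otimes> z) * \<phi> z" if "z \<in> carrier G" for z
    using that x0 by (simp add: F_def m_assoc[symmetric])
  have "\<sigma> * F (x0 \<otimes> \<one>) = 0"
  proof (rule integral_zero_imp_zero[where f = "\<lambda>z. \<sigma> * F (x0 \<otimes> z)", OF _ _ int0])
    show "continuous_map T euclideanreal (\<lambda>z. \<sigma> * F (x0 \<otimes> z))"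
      using continuous_map_compose[OF continuous_map_mult_left[OF x0] Fc]
      by (intro continuous_map_real_mult) (auto simp: o_def)
    fix z assume z: "z \<in> carrier G"
    show "0 \<le> \<sigma> * F (x0 \<otimes> z)"
    proof (cases "\<phi> z = 0")
      case False
      then have "0 \<le> (\<sigma> * f (x0 \<otimes> z)) * \<phi> z" using pos[OF z] assms(2)[of z] by (simp add: less_imp_le)
      then show ?thesis by (simp add: Fz[OF z] mult.assoc)
    qed (simp add: Fz[OF z])
  qed simp
  moreover have "0 < (\<sigma> * f (x0 \<otimes> \<one>)) * \<phi> \<one>" using pos[of \<one>] assms(3) by simp
  ultimately show False unfolding Fz[OF one_closed] mult.assoc by (metis less_irrefl)
qed

lemma normal_T: "normal_space T"
  using compact_Hausdorff_or_regular_imp_normal_space compact_T Hausdorff by blast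

lemma separating_function:
  assumes U: "openin T U" "x \<in> U"
  obtains u where "continuous_map T euclideanreal u" "u x = 1" "\<And>y. y \<in> carrier G \<Longrightarrow> y \<notin> U \<Longrightarrow> u y = 0"
proof -
  have x: "x \<in> topspace T" using U openin_subset by blast
  have "closedin T {x}" using Hausdorff x by (simp add: closedin_Hausdorff_singleton)
  moreover have "closedin T (topspace T - U)" using U by (simp add: closedin_diff)
  moreover have "disjnt {x} (topspace T - U)" using U by (auto simp: disjnt_def)
  ultimately obtain u where "continuous_map T euclideanreal u" "u ` {x} \<subseteq> {1}" "u ` (topspace T - U) \<subseteq> {0}"
    using Urysohn_lemma_alt[OF normal_T] by blast
  moreover have "u y = 0" if "y \<in> carrier G" "y \<notin> U" for y
    using calculation(3) that topspace_eq by blast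
  ultimately show thesis using that by blast
qed

text \<open>One bump for each basic neighbourhood of \<open>\<one>\<close>. A nonzero continuous
  function keeps its sign near some \<open>x0\<close>, and a bump with small enough support detects
  this.\<close>

lemma countable_bumps:
  obtains \<Phi> where "countable \<Phi>" "\<And>\<phi>. \<phi> \<in> \<Phi> \<Longrightarrow> convolution G T M \<phi>"
    "\<And>f. f \<in> C0 \<Longrightarrow> f \<noteq> 0 \<Longrightarrow> \<exists>\<phi>\<in>\<Phi>. convolution.conv G M \<phi> f \<noteq> 0"
proof -
  obtain \<B> where B: "countable \<B>" "\<And>V. V \<in> \<B> \<Longrightarrow> openin T V"
    "\<And>U x. openin T U \<Longrightarrow> x \<in> U \<Longrightarrow> \<exists>V\<in>\<B>. x \<in> V \<and> V \<subseteq> U"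
    using second_countable_T unfolding second_countable_def by metis
  have "\<exists>\<phi>. \<one> \<in> V \<longrightarrow> convolution G T M \<phi> \<and> (\<forall>x. 0 \<le> \<phi> x) \<and> \<phi> \<one> > 0
      \<and> (\<forall>z\<in>carrier G. \<phi> z \<noteq> 0 \<longrightarrow> z \<in> V)" if V: "V \<in> \<B>" for V
  proof (cases "\<one> \<in> V")
    case True
    obtain u where u: "continuous_map T euclideanreal u" "u \<one> = 1" "\<And>y. y \<in> carrier G \<Longrightarrow> y \<notin> V \<Longrightarrow> u y = 0"
      using separating_function[OF B(2)[OF V] True] by blast
    \<comment> \<open>The product over \<open>x\<close> and \<open>inv x\<close> makes the bump
      symmetric, the square makes it nonnegative, and the support stays in \<open>V\<close>.\<close>
    define \<phi> where "\<phi> = restr (\<lambda>x. (u x * u (inv x))\<^sup>2)"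
    have "\<phi> \<in> C0" unfolding \<phi>_def power2_eq_square
      using continuous_map_compose[OF continuous_inv u(1)]
      by (intro restr_C0 continuous_map_real_mult u) (auto simp: o_def)
    then have "convolution G T M \<phi>"
      by unfold_locales (auto simp: \<phi>_def restr_def mult.commute)
    moreover have "\<phi> \<one> > 0" using u(2) by (simp add: \<phi>_def restr_def)
    moreover have "z \<in> V" if "z \<in> carrier G" "\<phi> z \<noteq> 0" for z
      using that u(3)[of z] by (auto simp: \<phi>_def restr_def)
    moreover have "0 \<le> \<phi> x" for x by (simp add: \<phi>_def restr_def)
    ultimately show ?thesis by blast
  qed simp
  then obtain \<phi> where p: "\<And>V. V \<in> \<B> \<Longrightarrow> \<one> \<in> V \<Longrightarrow> convolution G T M (\<phi> V) \<and> (\<forall>x. 0 \<le> \<phi> V x) \<and> \<phi> V \<one> > 0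
      \<and> (\<forall>z\<in>carrier G. \<phi> V z \<noteq> 0 \<longrightarrow> z \<in> V)"
    by metis
  show thesis
  proof (rule that[of "\<phi> ` {V \<in> \<B>. \<one> \<in> V}"])
    show "countable (\<phi> ` {V \<in> \<B>. \<one> \<in> V})" using B(1) by (intro countable_image countable_Collect)
    show "convolution G T M \<psi>" if "\<psi> \<in> \<phi> ` {V \<in> \<B>. \<one> \<in> V}" for \<psi> using that p by auto
    fix f assume f: "f \<in> C0" "f \<noteq> 0"
    obtain x0 where x0: "x0 \<in> carrier G" "f x0 \<noteq> 0" using f by (auto simp: C0_def fun_eq_iff)
    define U where "U = {z \<in> topspace T. f x0 * f (x0 \<otimes> z) \<in> {0<..}}"
    have "continuous_map T euclideanreal (\<lambda>z. f x0 * f (x0 \<otimes> z))"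
      using continuous_map_compose[OF continuous_map_mult_left[OF x0(1)] C0_cont[OF f(1)]]
      by (intro continuous_map_real_mult) (auto simp: o_def)
    then have "openin T U" unfolding U_def by (rule openin_continuous_map_preimage) simp
    moreover have "\<one> \<in> U" using x0 by (auto simp: U_def topspace_eq zero_less_mult_iff)
    ultimately obtain V where V: "V \<in> \<B>" "\<one> \<in> V" "V \<subseteq> U" using B(3) by blast
    have "convolution.conv G M (\<phi> V) f \<noteq> 0"
      by (rule conv_nonzero[where \<sigma> = "f x0" and ?x0.0 = x0]) (use p[OF V(1,2)] V(3) f x0 in \<open>auto simp: U_def\<close>)
    then show "\<exists>\<psi>\<in>\<phi> ` {V \<in> \<B>. \<one> \<in> V}. convolution.conv G M \<psi> f \<noteq> 0" using V by blast
  qed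
qed

lemma ip_limit_zero:
  assumes F: "\<And>k. F k \<in> C0" "f \<in> C0" "uniform_limit (carrier G) F f sequentially" and h: "h \<in> C0" and 0: "\<And>k. ip (F k) h = 0"
  shows "ip f h = 0"
proof -
  have "(ip f h)\<^sup>2 \<le> ip (F k - f) (F k - f) * ip h h" for k
  proof -
    have "ip (F k - f) h = - ip f h" using ip.diff[OF F(1) F(2) h] 0 by simp
    then show ?thesis using ip.cauchy_schwarz[OF subspace_diff[OF subspace_C0 F(1) F(2)] h, of k] by simp
  qed
  moreover have "(\<lambda>k. ip (F k - f) (F k - f) * ip h h) \<longlonglongrightarrow> 0"
    by (intro tendsto_mult_left_zero ip_uniform_limit F)
  ultimately have "(ip f h)\<^sup>2 \<le> 0" by (intro LIMSEQ_le_const) auto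
  then show ?thesis by simp
qed

lemma ltrans_limit:
  assumes F: "\<And>k. ltrans g (F k) = F k" "f \<in> C0" "uniform_limit (carrier G) F f sequentially" and g: "g \<in> carrier G"
  shows "ltrans g f = f"
proof (rule C0_eqI[OF ltrans_C0[OF F(2) g] F(2)])
  fix x assume x: "x \<in> carrier G"
  have "(\<lambda>k. F k (inv g \<otimes> x)) \<longlonglongrightarrow> f (inv g \<otimes> x)"
    by (rule tendsto_uniform_limitI[OF F(3)]) (use g x in simp)
  moreover have "F k (inv g \<otimes> x) = F k x" for k using fun_cong[OF F(1)[of k], of x] x by (simp add: ltrans_def)
  moreover have "(\<lambda>k. F k x) \<longlonglongrightarrow> f x" by (rule tendsto_uniform_limitI[OF F(3) x])
  ultimately show "ltrans g f x = f x" using x LIMSEQ_unique by (simp add: ltrans_def)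
qed

abbreviation one_fun :: "'a \<Rightarrow> real" where "one_fun \<equiv> restr (\<lambda>_. 1)"

lemma one_fun: "one_fun \<in> C0" by (intro restr_C0) simp

lemma ip_one: "f \<in> C0 \<Longrightarrow> ip f one_fun = (\<integral>x. f x \<partial>M)"
  unfolding ip_def by (rule Bochner_Integration.integral_cong) (auto simp: restr_def space_M)

lemma ltrans_one_fun: "g \<in> carrier G \<Longrightarrow> ltrans g one_fun = one_fun"
  by (auto simp: ltrans_def restr_def fun_eq_iff)

text \<open>The functions orthogonal to all functions fixed by \<open>c\<close> form a closed space that is invariant under
  convolution and contains no nonzero function fixed by \<open>c\<close>, so any eigenfunction in it will do.\<close>

lemma eigenfunction_moved:
  assumes \<Phi>: "\<And>\<phi>. \<phi> \<in> \<Phi> \<Longrightarrow> convolution G T M \<phi>"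
    "\<And>f. f \<in> C0 \<Longrightarrow> f \<noteq> 0 \<Longrightarrow> \<exists>\<phi>\<in>\<Phi>. convolution.conv G M \<phi> f \<noteq> 0"
    and c: "c \<in> carrier G" "c \<noteq> \<one>"
  obtains \<phi> r f where "\<phi> \<in> \<Phi>" "r > 0" "f \<in> convolution.eigenspace G T M \<phi> r" "ltrans c f \<noteq> f"
proof -
  define W where "W = {f \<in> C0. \<forall>h\<in>C0. ltrans c h = h \<longrightarrow> ip f h = 0}"
  have W: "subspace W" "W \<subseteq> C0"
    using subspace_C0 by (auto simp: W_def subspace_def ip.add ip.scale ip.zero)
  have "openin T (topspace T - {inv c})"
    using Hausdorff c by (intro openin_diff openin_topspace) (auto simp: closedin_Hausdorff_singleton topspace_eq)
  moreover have "\<one> \<noteq> inv c" using c by (metis inv_inv inv_one)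
  ultimately obtain u where u: "continuous_map T euclideanreal u" "u \<one> = 1" "u (inv c) = 0"
    using separating_function[of "topspace T - {inv c}" \<one>] c by (auto simp: topspace_eq)
  define v where "v = restr u"
  have v: "v \<in> C0" unfolding v_def by (rule restr_C0[OF u(1)])
  \<comment> \<open>Translation by \<open>c\<close> is orthogonal, so differences of this form are
    orthogonal to all functions fixed by \<open>c\<close>. Separating \<open>\<one>\<close> from
    \<open>inv c\<close> makes this one nonzero.\<close>
  define f0 where "f0 = v - ltrans c v"
  have f0C: "f0 \<in> C0" unfolding f0_def using v c by (intro subspace_diff subspace_C0 ltrans_C0)
  have "f0 \<one> = 1" using u c by (simp add: f0_def v_def ltrans_def restr_def)
  then have f0: "f0 \<noteq> 0" by auto
  have f0W: "f0 \<in> W"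
    unfolding W_def
  proof (intro CollectI conjI ballI impI f0C)
    fix h assume h: "h \<in> C0" "ltrans c h = h"
    have "ltrans (inv c) h = h"
      using ltrans_mult[of "inv c" c h] h c by (simp add: ltrans_one)
    then have "ip (ltrans c v) h = ip v h" using ip_ltrans_adjoint[OF c(1) v h(1)] by simp
    then show "ip f0 h = 0" unfolding f0_def using ip.diff[OF v ltrans_C0[OF v c(1)] h(1)] by simp
  qed
  obtain \<phi> where p: "\<phi> \<in> \<Phi>" "convolution.conv G M \<phi> f0 \<noteq> 0" using \<Phi>(2)[OF f0C f0] by blast
  interpret convolution G T M \<phi> by (rule \<Phi>(1)[OF p(1)])
  obtain r g where g: "r > 0" "g \<in> W" "g \<noteq> 0" "conv (conv g) = r *\<^sub>R g"
  proof (rule eigenfunction_exists[OF W _ _ f0W p(2)])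
    show "f \<in> W" if "\<And>k. F k \<in> W" "f \<in> C0" "uniform_limit (carrier G) F f sequentially" for F f
      using that ip_limit_zero[of F f] by (auto simp: W_def)
    show "conv f \<in> W" if f: "f \<in> W" for f
      unfolding W_def
    proof (intro CollectI conjI ballI impI conv_C0)
      show "f \<in> C0" using f by (simp add: W_def)
      fix h assume h: "h \<in> C0" "ltrans c h = h"
      have "ltrans c (conv h) = conv h" using conv_ltrans[OF c(1) h(1)] h(2) by simp
      then show "ip (conv f) h = 0" using f conv_sym[OF _ h(1), of f] conv_C0[OF h(1)] by (simp add: W_def)
    qed
  qed auto
  have gC: "g \<in> C0" using g W by blast
  \<comment> \<open>Constants are fixed by \<open>c\<close>, so membership in \<open>W\<close>
    already forces mean zero.\<close>
  have "ip g one_fun = 0" using g(2) one_fun ltrans_one_fun[OF c(1)] by (simp add: W_def)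
  then have "g \<in> eigenspace r" using g gC by (simp add: eigenspace_def ip_one)
  moreover have "ltrans c g \<noteq> g"
  proof
    assume "ltrans c g = g"
    then have "ip g g = 0" using g(2) gC by (simp add: W_def)
    then show False using ip.pos[OF gC] g(3) by simp
  qed
  ultimately show thesis using that p(1) g(1) by blast
qed

text \<open>The supremum of \<open>u\<^sup>2\<close> over the orbits of the generated subgroup is a continuous nonconstant invariant
  function, and the invariant functions of mean zero are again invariant under convolution.\<close>

lemma eigenfunction_fixed:
  assumes \<Phi>: "\<And>\<phi>. \<phi> \<in> \<Phi> \<Longrightarrow> convolution G T M \<phi>"
    "\<And>f. f \<in> C0 \<Longrightarrow> f \<noteq> 0 \<Longrightarrow> \<exists>\<phi>\<in>\<Phi>. convolution.conv G M \<phi> f \<noteq> 0"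
    and ab: "a \<in> carrier G" "b \<in> carrier G"
    and nd: "Abstract_Topology.closure_of T (generate G {a, b}) \<noteq> carrier G"
  obtains \<phi> r f where "\<phi> \<in> \<Phi>" "r > 0" "f \<in> convolution.eigenspace G T M \<phi> r" "f \<noteq> 0" "ltrans a f = f" "ltrans b f = f"
proof -
  define \<Gamma> where "\<Gamma> = generate G {a, b}"
  have \<Gamma>: "subgroup \<Gamma> G" unfolding \<Gamma>_def by (rule generate_is_subgroup) (use ab in auto)
  have \<Gamma>G: "\<Gamma> \<subseteq> carrier G" and \<Gamma>1: "\<one> \<in> \<Gamma>" and \<Gamma>m: "\<And>g h. g \<in> \<Gamma> \<Longrightarrow> h \<in> \<Gamma> \<Longrightarrow> g \<otimes> h \<in> \<Gamma>"
    and \<Gamma>i: "\<And>g. g \<in> \<Gamma> \<Longrightarrow> inv g \<in> \<Gamma>"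
    using \<Gamma> by (auto simp: subgroup_def)
  have ab\<Gamma>: "a \<in> \<Gamma>" "b \<in> \<Gamma>" by (auto simp: \<Gamma>_def intro: generate.incl)
  obtain x0 where x0: "x0 \<in> carrier G" "x0 \<notin> Abstract_Topology.closure_of T \<Gamma>"
    using nd closure_of_subset_topspace[of T \<Gamma>] by (auto simp: \<Gamma>_def topspace_eq)
  then obtain U where U: "openin T U" "x0 \<in> U" "U \<inter> \<Gamma> = {}" by (auto simp: in_closure_of topspace_eq)
  obtain u where u: "continuous_map T euclideanreal u" "u x0 = 1" "\<And>y. y \<in> carrier G \<Longrightarrow> y \<notin> U \<Longrightarrow> u y = 0"
    using separating_function[OF U(1,2)] by blast
  \<comment> \<open>The generated subgroup need not be compact, but the functions
    \<open>(u (h \<otimes> x))^2\<close> are equicontinuous over all \<open>h\<close> in the compact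
    group, so the supremum is continuous.\<close>
  define s where "s x = (SUP h\<in>\<Gamma>. (u (h \<otimes> x))\<^sup>2)" for x
  obtain C where C: "\<And>x. x \<in> carrier G \<Longrightarrow> \<bar>(u x)\<^sup>2\<bar> \<le> C"
    using continuous_bounded[of "\<lambda>x. (u x)\<^sup>2"] u(1) by (metis continuous_map_real_pow)
  have bdd: "bdd_above ((\<lambda>h. (u (h \<otimes> x))\<^sup>2) ` \<Gamma>)" if "x \<in> carrier G" for x
    by (rule bdd_aboveI2[of _ _ C]) (use C[of "_ \<otimes> x"] that \<Gamma>G in \<open>auto simp: subset_iff\<close>)
  have "continuous_map (prod_topology T T) T (\<lambda>p. snd p \<otimes> fst p)"
    by (intro continuous_map_compose_mult continuous_map_fst continuous_map_snd)
  from continuous_map_compose[OF this continuous_map_real_pow[OF u(1), of 2]]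
  have Fc: "continuous_map (prod_topology T T) euclideanreal (\<lambda>(x, h). (u (h \<otimes> x))\<^sup>2)"
    by (simp add: o_def case_prod_unfold)
  have sc: "continuous_map T euclideanreal s"
  proof (rule continuous_map_realI)
    fix x and \<epsilon> :: real assume x: "x \<in> topspace T" and \<epsilon>: "\<epsilon> > 0"
    then have xG: "x \<in> carrier G" by (simp add: topspace_eq)
    obtain N where N: "openin T N" "x \<in> N" "\<And>y h. y \<in> N \<Longrightarrow> h \<in> topspace T \<Longrightarrow> \<bar>(u (h \<otimes> y))\<^sup>2 - (u (h \<otimes> x))\<^sup>2\<bar> < \<epsilon> / 2"
      using tube_uniform[OF Fc compact_T x, of "\<epsilon> / 2"] \<epsilon> by auto
    have "\<bar>s y - s x\<bar> < \<epsilon>" if y: "y \<in> N" for y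
    proof -
      have yG: "y \<in> carrier G" using y N(1) openin_subset topspace_eq by blast
      have close: "\<bar>(u (h \<otimes> y))\<^sup>2 - (u (h \<otimes> x))\<^sup>2\<bar> < \<epsilon> / 2" if "h \<in> \<Gamma>" for h
        using N(3)[OF y, of h] that \<Gamma>G by (auto simp: topspace_eq)
      have "s y \<le> s x + \<epsilon> / 2"
        unfolding s_def[of y]
      proof (rule cSUP_least)
        fix h assume h: "h \<in> \<Gamma>"
        have "(u (h \<otimes> x))\<^sup>2 \<le> s x" unfolding s_def by (rule cSUP_upper[OF h bdd[OF xG]])
        then show "(u (h \<otimes> y))\<^sup>2 \<le> s x + \<epsilon> / 2" using close[OF h] by linarith
      qed (use \<Gamma>1 in blast)
      moreover have "s x \<le> s y + \<epsilon> / 2"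
        unfolding s_def[of x]
      proof (rule cSUP_least)
        fix h assume h: "h \<in> \<Gamma>"
        have "(u (h \<otimes> y))\<^sup>2 \<le> s y" unfolding s_def by (rule cSUP_upper[OF h bdd[OF yG]])
        then show "(u (h \<otimes> x))\<^sup>2 \<le> s y + \<epsilon> / 2" using close[OF h] by linarith
      qed (use \<Gamma>1 in blast)
      ultimately show ?thesis using \<epsilon> by (simp add: abs_le_iff)
    qed
    then show "\<exists>U. openin T U \<and> x \<in> U \<and> (\<forall>y\<in>U. \<bar>s y - s x\<bar> < \<epsilon>)" using N by blast
  qed
  define w where "w = restr s"
  have w: "w \<in> C0" unfolding w_def by (rule restr_C0[OF sc])
  have w_inv: "ltrans g w = w" if g: "g \<in> \<Gamma>" for g
  proof -
    have gG: "g \<in> carrier G" using g \<Gamma>G by blast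
    have "s (inv g \<otimes> x) = s x" if x: "x \<in> carrier G" for x
    proof -
      have "(\<lambda>h. (u (h \<otimes> (inv g \<otimes> x)))\<^sup>2) ` \<Gamma> = (\<lambda>h. (u (h \<otimes> x))\<^sup>2) ` \<Gamma>"
      proof
        show "(\<lambda>h. (u (h \<otimes> (inv g \<otimes> x)))\<^sup>2) ` \<Gamma> \<subseteq> (\<lambda>h. (u (h \<otimes> x))\<^sup>2) ` \<Gamma>"
        proof
          fix r assume "r \<in> (\<lambda>h. (u (h \<otimes> (inv g \<otimes> x)))\<^sup>2) ` \<Gamma>"
          then obtain h where h: "h \<in> \<Gamma>" "r = (u (h \<otimes> (inv g \<otimes> x)))\<^sup>2" by blast
          then have "r = (u ((h \<otimes> inv g) \<otimes> x))\<^sup>2" using gG x \<Gamma>G by (simp add: m_assoc subset_iff)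
          then show "r \<in> (\<lambda>h. (u (h \<otimes> x))\<^sup>2) ` \<Gamma>" using \<Gamma>m[OF h(1) \<Gamma>i[OF g]] by blast
        qed
        show "(\<lambda>h. (u (h \<otimes> x))\<^sup>2) ` \<Gamma> \<subseteq> (\<lambda>h. (u (h \<otimes> (inv g \<otimes> x)))\<^sup>2) ` \<Gamma>"
        proof
          fix r assume "r \<in> (\<lambda>h. (u (h \<otimes> x))\<^sup>2) ` \<Gamma>"
          then obtain h where h: "h \<in> \<Gamma>" "r = (u (h \<otimes> x))\<^sup>2" by blast
          then have "(h \<otimes> g) \<otimes> (inv g \<otimes> x) = h \<otimes> x"
            using gG x \<Gamma>G by (simp add: m_assoc subset_iff) (simp add: m_assoc[symmetric])
          then have "r = (u ((h \<otimes> g) \<otimes> (inv g \<otimes> x)))\<^sup>2" using h(2) by simp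
          then show "r \<in> (\<lambda>h. (u (h \<otimes> (inv g \<otimes> x)))\<^sup>2) ` \<Gamma>" using \<Gamma>m[OF h(1) g] by blast
        qed
      qed
      then show ?thesis by (simp add: s_def)
    qed
    then show ?thesis using gG by (auto simp: w_def ltrans_def restr_def fun_eq_iff)
  qed
  define mean where "mean = (\<integral>x. w x \<partial>M) / vol"
  define f0 where "f0 = w - mean *\<^sub>R one_fun"
  have f0C: "f0 \<in> C0" unfolding f0_def by (intro subspace_diff subspace_scale subspace_C0 w one_fun)
  have one_one: "ip one_fun one_fun = vol"
  proof -
    have "(\<integral>x. one_fun x \<partial>M) = (\<integral>x. 1 \<partial>M)"
      by (rule Bochner_Integration.integral_cong) (auto simp: restr_def space_M)
    then show ?thesis by (simp add: ip_one[OF one_fun] vol_def)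
  qed
  have f0_mean: "ip f0 one_fun = 0"
    unfolding f0_def using ip.diff[OF w subspace_scale[OF subspace_C0 one_fun] one_fun] ip.scale[OF one_fun one_fun]
      vol_pos by (simp add: one_one ip_one[OF w] mean_def)
  \<comment> \<open>\<open>u\<close> vanishes on the subgroup, which is the orbit of
    \<open>\<one>\<close>, while \<open>u x0 = 1\<close>: the invariant function is not constant and
    survives the subtraction of its mean.\<close>
  have "s \<one> = 0"
  proof -
    have "(\<lambda>h. (u (h \<otimes> \<one>))\<^sup>2) ` \<Gamma> = {0}" using u(3) U(3) \<Gamma>G \<Gamma>1 by force
    then show ?thesis by (simp add: s_def)
  qed
  moreover have "1 \<le> s x0"
    unfolding s_def using cSUP_upper[OF \<Gamma>1 bdd[OF x0(1)]] u(2) x0(1) by simp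
  ultimately have "f0 \<one> \<noteq> f0 x0" using x0(1) by (simp add: f0_def w_def restr_def)
  then have f0: "f0 \<noteq> 0" by auto
  define W where "W = {f \<in> C0. ip f one_fun = 0 \<and> ltrans a f = f \<and> ltrans b f = f}"
  have z: "ltrans g 0 = 0" for g by (auto simp: ltrans_def fun_eq_iff)
  have W: "subspace W" "W \<subseteq> C0"
    using subspace_C0 by (auto simp: W_def subspace_def ip.add ip.scale ip.zero one_fun ltrans_add ltrans_scaleR z)
  have f0W: "f0 \<in> W"
  proof -
    have "ltrans g f0 = f0" if "g \<in> \<Gamma>" for g
    proof -
      have "ltrans g f0 = ltrans g w - mean *\<^sub>R ltrans g one_fun" by (auto simp: f0_def ltrans_def fun_eq_iff)
      then show ?thesis using w_inv[OF that] ltrans_one_fun \<Gamma>G that by (auto simp: f0_def)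
    qed
    then show ?thesis using f0C f0_mean ab\<Gamma> by (simp add: W_def)
  qed
  obtain \<phi> where p: "\<phi> \<in> \<Phi>" "convolution.conv G M \<phi> f0 \<noteq> 0" using \<Phi>(2)[OF f0C f0] by blast
  interpret convolution G T M \<phi> by (rule \<Phi>(1)[OF p(1)])
  \<comment> \<open>Convolution commutes with translations, so it maps constants to constants; by
    symmetry it then preserves mean zero.\<close>
  have conv_one: "\<exists>r. conv one_fun = r *\<^sub>R one_fun"
  proof -
    have "conv one_fun = (conv one_fun \<one>) *\<^sub>R one_fun"
    proof (rule C0_eqI)
      fix x assume x: "x \<in> carrier G"
      have "ltrans x (conv one_fun) = conv one_fun"
        using conv_ltrans[OF x one_fun] ltrans_one_fun[OF x] by simp
      from fun_cong[OF this, of x] show "conv one_fun x = (conv one_fun \<one> *\<^sub>R one_fun) x"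
        using x by (simp add: ltrans_def restr_def)
    qed (auto intro!: conv_C0 one_fun subspace_scale[OF subspace_C0])
    then show ?thesis by blast
  qed
  obtain r g where g: "r > 0" "g \<in> W" "g \<noteq> 0" "conv (conv g) = r *\<^sub>R g"
  proof (rule eigenfunction_exists[OF W _ _ f0W p(2)])
    show "f \<in> W" if F: "\<And>k. F k \<in> W" "f \<in> C0" "uniform_limit (carrier G) F f sequentially" for F f
      using F(1) ip_limit_zero[OF _ F(2,3) one_fun] ltrans_limit[OF _ F(2,3) ab(1)] ltrans_limit[OF _ F(2,3) ab(2)] F(2)
      by (simp add: W_def)
    show "conv f \<in> W" if f: "f \<in> W" for f
    proof -
      have fC: "f \<in> C0" using f by (simp add: W_def)
      obtain r where r: "conv one_fun = r *\<^sub>R one_fun" using conv_one by blast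
      have "ip (conv f) one_fun = ip f (r *\<^sub>R one_fun)" using conv_sym[OF fC one_fun] r by simp
      also have "\<dots> = r * ip f one_fun" by (simp add: ip_def mult_ac flip: integral_mult_right_zero)
      finally have "ip (conv f) one_fun = 0" using f by (simp add: W_def)
      then show ?thesis
        using f conv_C0[OF fC] conv_ltrans[OF ab(1) fC] conv_ltrans[OF ab(2) fC] by (simp add: W_def)
    qed
  qed auto
  have "g \<in> C0" "ip g one_fun = 0" using g(2) by (auto simp: W_def)
  then have "g \<in> eigenspace r" using g(4) ip_one[of g] by (simp add: eigenspace_def)
  then show thesis using that[OF p(1) g(1)] g by (simp add: W_def)
qed

end

section \<open>Pairs of group elements\<close>

text \<open>Words in the set of generators correspond to words over truth values by testing equality
  with \<open>a\<close>, which preserves reducedness.\<close>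

lemma (in group) free_group_of_rank_2:
  assumes ab: "a \<in> carrier G" "b \<in> carrier G"
    and w: "\<And>w. reduced_word w \<Longrightarrow> w \<noteq> [] \<Longrightarrow> gword a b w \<noteq> \<one>"
  shows "free_group_of_rank (subgroup_generated G {a, b}) 2"
proof -
  let ?H = "subgroup_generated G {a, b}"
  \<comment> \<open>The reduced word used here evaluates to \<open>a \<otimes> inv b\<close>, so
    distinctness of the generators is itself an instance of the hypothesis.\<close>
  have "a \<noteq> b"
    using w[of "[(True, True), (False, False)]"] ab by (auto simp: reduced_word_def)
  have sub: "{a, b} \<subseteq> carrier G" using ab by simp
  have carH: "carrier ?H = generate G {a, b}"
    using sub by (simp add: carrier_subgroup_generated Int_absorb1)
  have val: "word_value ?H u = gword a b (map (\<lambda>(x, e). (x = a, e)) u)" if "fst ` set u \<subseteq> {a, b}" for u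
    using that
  proof (induction u)
    case Nil
    then show ?case by (simp add: word_value_def)
  next
    case (Cons l u)
    obtain x e where l: "l = (x, e)" by fastforce
    have x: "x = a \<or> x = b" using Cons.prems l by auto
    then have "x \<in> carrier ?H" unfolding carH by (auto intro: generate.incl)
    then have "inv\<^bsub>?H\<^esub> x = inv x" by simp
    moreover have "word_value ?H (l # u) = (if e then x else inv\<^bsub>?H\<^esub> x) \<otimes> word_value ?H u"
      by (simp add: word_value_def l)
    ultimately show ?case using Cons x \<open>a \<noteq> b\<close> by (auto simp: l)
  qed
  have red: "reduced_word (map (\<lambda>(x, e). (x = a, e)) u)" if "fst ` set u \<subseteq> {a, b}" "reduced_word u" for u
    using that(2) unfolding reduced_word_def successively_map
  proof (rule successively_mono)
    fix p q assume "p \<in> set u" "q \<in> set u"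
    then have "fst p \<in> {a, b}" "fst q \<in> {a, b}" using that(1) by (auto simp: image_subset_iff)
    then show "(case p of (x, e) \<Rightarrow> \<lambda>(y, f). \<not> (x = y \<and> e \<noteq> f)) q \<Longrightarrow>
        (case case p of (x, e) \<Rightarrow> (x = a, e) of (x, e) \<Rightarrow> \<lambda>(y, f). \<not> (x = y \<and> e \<noteq> f))
          (case q of (x, e) \<Rightarrow> (x = a, e))"
      by (cases p; cases q) auto
  qed
  have "word_value ?H u \<noteq> \<one>\<^bsub>?H\<^esub>" if "fst ` set u \<subseteq> {a, b}" "reduced_word u" "u \<noteq> []" for u
    using w[OF red[OF that(1,2)]] val[OF that(1)] that(3) by simp
  moreover have "generate ?H {a, b} = carrier ?H"
  proof -
    have "?H = G\<lparr>carrier := generate G {a, b}\<rparr>"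
      using sub by (simp add: subgroup_generated_def Int_absorb1)
    then show ?thesis
      unfolding carH by (auto simp only: intro!: generate_consistent generate_is_subgroup[OF sub] generate.incl)
  qed
  moreover have "{a, b} \<subseteq> carrier ?H" unfolding carH by (auto intro: generate.incl)
  ultimately have "free_basis ?H {a, b}" unfolding free_basis_def by blast
  then show ?thesis
    unfolding free_group_of_rank_def using \<open>a \<noteq> b\<close> by (intro conjI exI[of _ "{a, b}"]) auto
qed

text \<open>Two instances of \<open>compact_group\<close> coexist: \<open>L\<close> on the product
  group with \<open>\<mu>\<close>, where null sets are measured, and an unqualified one on
  \<open>G\<close>, where the representations arise.\<close>

locale haar_pair = topological_group G T for G :: "('a, 'b) monoid_scheme" (structure) and T :: "'a topology" +
  fixes \<mu> :: "('a \<times> 'a) measure"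
  assumes sct: "second_countable T" and conn_T: "connected_space T" and cpt: "compact_space T"
    and haar: "haar_measure (G \<times>\<times> G) (prod_topology T T) \<mu>"
begin

lemma sets_\<mu>: "sets \<mu> = sigma_sets (topspace (prod_topology T T)) {U. openin (prod_topology T T) U}"
  and nonzero_\<mu>: "emeasure \<mu> (space \<mu>) \<noteq> 0"
  and inv_\<mu>: "g \<in> carrier (G \<times>\<times> G) \<Longrightarrow> A \<in> sets \<mu> \<Longrightarrow> emeasure \<mu> (g <#\<^bsub>G \<times>\<times> G\<^esub> A) = emeasure \<mu> A"
  and compact_\<mu>: "compactin (prod_topology T T) K \<Longrightarrow> emeasure \<mu> K < \<infinity>"
  and outer_regular: "A \<in> sets \<mu> \<Longrightarrow> emeasure \<mu> A = (INF U\<in>{U. openin (prod_topology T T) U \<and> A \<subseteq> U}. emeasure \<mu> U)"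
  using haar unfolding haar_measure_def by blast+

lemma space_\<mu>: "space \<mu> = carrier G \<times> carrier G"
  using space_of_sets_open[OF sets_\<mu>] topspace_eq by simp

lemma compact_prod: "compact_space (prod_topology T T)"
  using cpt by (simp add: compact_space_def compactin_Times)

lemma connected_prod: "connected_space (prod_topology T T)"
  using conn_T connectedin_Times[of T T "topspace T" "topspace T"] by (simp flip: connectedin_topspace)

sublocale L: compact_group "G \<times>\<times> G" "prod_topology T T" \<mu>
proof -
  interpret P: topological_group "G \<times>\<times> G" "prod_topology T T" by (rule topological_group_prod)
  show "compact_group (G \<times>\<times> G) (prod_topology T T) \<mu>"
  proof
    have "emeasure \<mu> (topspace (prod_topology T T)) < \<infinity>"
      using compact_prod unfolding compact_space_def by (rule compact_\<mu>)
    then show "emeasure \<mu> (space \<mu>) \<noteq> \<infinity>" by (simp add: space_\<mu> topspace_eq)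
  qed (rule compact_prod second_countable_prod[OF sct sct] sets_\<mu> nonzero_\<mu> inv_\<mu>; assumption)+
qed

text \<open>The marginal of \<open>\<mu>\<close> on the first factor: an invariant measure on
  \<open>G\<close> derived from the given measure on the product.\<close>

definition \<nu> :: "'a measure" where
  "\<nu> = distr \<mu> (sigma (topspace T) {U. openin T U}) fst"

lemma sets_\<nu>: "sets \<nu> = sigma_sets (topspace T) {U. openin T U}"
  unfolding \<nu>_def sets_distr by (rule sets_sigma_open)

lemma space_\<nu>: "space \<nu> = carrier G"
  using space_of_sets_open[OF sets_\<nu>] topspace_eq by simp

lemma emeasure_\<nu>: "A \<in> sets \<nu> \<Longrightarrow> emeasure \<nu> A = emeasure \<mu> (A \<times> carrier G)"
  and Times_sets: "A \<in> sets \<nu> \<Longrightarrow> A \<times> carrier G \<in> sets \<mu>"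
proof -
  assume A: "A \<in> sets \<nu>"
  have meas: "fst \<in> measurable \<mu> (sigma (topspace T) {U. openin T U})"
    by (rule continuous_map_measurable[OF continuous_map_fst sets_\<mu> sets_sigma_open])
  have A': "A \<in> sets (sigma (topspace T) {U. openin T U})" using A by (simp add: \<nu>_def)
  have eq: "fst -` A \<inter> space \<mu> = A \<times> carrier G"
    using sets.sets_into_space[OF A] by (auto simp: space_\<mu> space_\<nu>)
  show "emeasure \<nu> A = emeasure \<mu> (A \<times> carrier G)"
    unfolding \<nu>_def emeasure_distr[OF meas A'] eq ..
  show "A \<times> carrier G \<in> sets \<mu>" using measurable_sets[OF meas A'] unfolding eq .
qed

sublocale compact_group G T \<nu>
proof
  have total: "emeasure \<nu> (space \<nu>) = emeasure \<mu> (space \<mu>)"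
    using emeasure_\<nu>[OF sets.top] by (simp add: space_\<nu> space_\<mu>)
  show "emeasure \<nu> (space \<nu>) \<noteq> \<infinity>" "emeasure \<nu> (space \<nu>) \<noteq> 0"
    unfolding total using L.finite_M L.nonzero_M by auto
  fix g A assume g: "g \<in> carrier G" and A: "A \<in> sets \<nu>"
  have "(\<lambda>x. inv g \<otimes> x) \<in> measurable \<nu> \<nu>"
    using g by (intro continuous_map_measurable[OF continuous_map_mult_left sets_\<nu> sets_\<nu>]) simp
  from measurable_sets[OF this A] have gA: "g <# A \<in> sets \<nu>"
    using l_coset_preimage[OF g, of A] sets.sets_into_space[OF A]
    by (simp add: space_\<nu> vimage_def Int_def conj_commute)
  have "(g, \<one>) <#\<^bsub>G \<times>\<times> G\<^esub> (A \<times> carrier G) = (g <# A) \<times> carrier G"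
    by (force simp: l_coset_def)
  then have "emeasure \<mu> ((g <# A) \<times> carrier G) = emeasure \<mu> (A \<times> carrier G)"
    using L.inv_M[of "(g, \<one>)", OF _ Times_sets[OF A]] g by simp
  then show "emeasure \<nu> (g <# A) = emeasure \<nu> A" by (simp add: emeasure_\<nu> A gA)
qed (rule cpt sct sets_\<nu>)+

text \<open>Representative functions on the product group in curried form; they are closed under
  polynomial operations.\<close>

definition prep :: "('a \<Rightarrow> 'a \<Rightarrow> real) \<Rightarrow> bool" where
  "prep F \<longleftrightarrow> L.representative (L.restr (\<lambda>(x, y). F x y))"

lemma prep_cong:
  assumes "\<And>x y. x \<in> carrier G \<Longrightarrow> y \<in> carrier G \<Longrightarrow> F x y = H x y"
  shows "prep F \<longleftrightarrow> prep H"
proof -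
  have "L.restr (\<lambda>(x, y). F x y) = L.restr (\<lambda>(x, y). H x y)"
    by (auto simp: L.restr_def fun_eq_iff assms)
  then show ?thesis by (simp add: prep_def)
qed

lemma prep_const: "prep (\<lambda>x y. c)"
  using L.representative_const[of c] by (simp add: prep_def case_prod_unfold)

lemma prep_add: "prep F \<Longrightarrow> prep H \<Longrightarrow> prep (\<lambda>x y. F x y + H x y)"
  unfolding prep_def
  by (drule (1) L.representative_add, erule back_subst[where P = L.representative]) (auto simp: L.restr_def fun_eq_iff)

lemma prep_diff: "prep F \<Longrightarrow> prep H \<Longrightarrow> prep (\<lambda>x y. F x y - H x y)"
  unfolding prep_def
  by (drule (1) L.representative_diff, erule back_subst[where P = L.representative]) (auto simp: L.restr_def fun_eq_iff)

lemma prep_mult: "prep F \<Longrightarrow> prep H \<Longrightarrow> prep (\<lambda>x y. F x y * H x y)"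
  unfolding prep_def
  by (drule (1) L.representative_mult, erule back_subst[where P = L.representative]) (auto simp: L.restr_def fun_eq_iff)

lemma prep_sum: "(\<And>i. i \<in> I \<Longrightarrow> prep (F i)) \<Longrightarrow> prep (\<lambda>x y. \<Sum>i\<in>I. F i x y)"
  by (induction I rule: infinite_finite_induct) (auto intro: prep_const prep_add)

lemma prep_prod: "(\<And>i. i \<in> I \<Longrightarrow> prep (F i)) \<Longrightarrow> prep (\<lambda>x y. \<Prod>i\<in>I. F i x y)"
  by (induction I rule: infinite_finite_induct) (auto intro: prep_const prep_mult)

lemma prep_zero_set:
  assumes F: "prep F"
  shows "closedin (prod_topology T T) {(x, y) \<in> carrier G \<times> carrier G. F x y = 0}"
    and "x0 \<in> carrier G \<Longrightarrow> y0 \<in> carrier G \<Longrightarrow> F x0 y0 \<noteq> 0 \<Longrightarrow>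
      {(x, y) \<in> carrier G \<times> carrier G. F x y = 0} \<in> null_sets \<mu>"
proof -
  let ?f = "L.restr (\<lambda>(x, y). F x y)"
  have eq: "{(x, y) \<in> carrier G \<times> carrier G. F x y = 0} = {p \<in> carrier (G \<times>\<times> G). ?f p = 0}"
    by (auto simp: L.restr_def)
  have "closedin (prod_topology T T) (L.zeros {?f})"
    using F by (intro L.zeros_closed) (auto simp: prep_def L.representative_def)
  then show "closedin (prod_topology T T) {(x, y) \<in> carrier G \<times> carrier G. F x y = 0}"
    unfolding eq L.zeros_def by simp
  show "{(x, y) \<in> carrier G \<times> carrier G. F x y = 0} \<in> null_sets \<mu>"
    if "x0 \<in> carrier G" "y0 \<in> carrier G" "F x0 y0 \<noteq> 0"
    unfolding eq
    by (rule L.representative_zero_set_null[OF connected_prod outer_regular F[unfolded prep_def], of "(x0, y0)"])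
      (use that in \<open>auto simp: L.restr_def\<close>)
qed

end

section \<open>Exceptional pairs as zero sets of representative functions\<close>

context haar_pair
begin

text \<open>A translate of a matrix coefficient is a combination of the coefficients in the same
  column, so finitely many of them suffice.\<close>

lemma prep_rho:
  assumes rep: "function_rep G T \<nu> V n b" and ij: "i < n" "j < n"
  shows "prep (\<lambda>x y. function_rep.rho G \<nu> b x i j)" "prep (\<lambda>x y. function_rep.rho G \<nu> b y i j)"
proof -
  interpret function_rep G T \<nu> V n b by (rule rep)
  \<comment> \<open>Both coordinate projections are treated at once; the homomorphism property is
    assumed for \<open>inv p\<close> times \<open>q\<close>, the combination that occurs in a left
    translate.\<close>
  have aux: "L.representative (L.restr (\<lambda>p. rho (\<pi> p) i j))"
    if \<pi>: "continuous_map (prod_topology T T) T \<pi>"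
      and hom: "\<And>p q. p \<in> carrier (G \<times>\<times> G) \<Longrightarrow> q \<in> carrier (G \<times>\<times> G) \<Longrightarrow> \<pi> (inv\<^bsub>G \<times>\<times> G\<^esub> p \<otimes>\<^bsub>G \<times>\<times> G\<^esub> q) = inv (\<pi> p) \<otimes> \<pi> q"
    for \<pi>
    unfolding L.representative_def
  proof (intro conjI exI ballI)
    have \<pi>G: "\<pi> p \<in> carrier G" if "p \<in> carrier (G \<times>\<times> G)" for p
      using continuous_map_funspace[OF \<pi>] that by (auto simp: topspace_eq Pi_iff)
    show "L.restr (\<lambda>p. rho (\<pi> p) i j) \<in> L.C0"
      using continuous_map_compose[OF \<pi> rho_continuous[OF ij]] by (intro L.restr_C0) (simp add: o_def)
    let ?B = "(\<lambda>k. L.restr (\<lambda>p. rho (\<pi> p) k j)) ` {..<n}"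
    show "finite ?B" by simp
    fix g assume g: "g \<in> carrier (G \<times>\<times> G)"
    have "L.ltrans g (L.restr (\<lambda>p. rho (\<pi> p) i j)) = (\<Sum>k<n. rho (inv (\<pi> g)) i k *\<^sub>R L.restr (\<lambda>p. rho (\<pi> p) k j))"
    proof
      fix p
      show "L.ltrans g (L.restr (\<lambda>p. rho (\<pi> p) i j)) p = (\<Sum>k<n. rho (inv (\<pi> g)) i k *\<^sub>R L.restr (\<lambda>p. rho (\<pi> p) k j)) p"
      proof (cases "p \<in> carrier (G \<times>\<times> G)")
        case True
        then have "L.ltrans g (L.restr (\<lambda>p. rho (\<pi> p) i j)) p = rho (inv (\<pi> g) \<otimes> \<pi> p) i j"
          unfolding L.ltrans_def L.restr_def using g hom[OF g True] L.m_closed[OF L.inv_closed[OF g] True] by simp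
        also have "\<dots> = (\<Sum>k<n. rho (inv (\<pi> g)) i k * rho (\<pi> p) k j)"
          using \<pi>G[OF g] \<pi>G[OF True] ij by (intro rho_mult) auto
        finally show ?thesis using True unfolding sum_fun_apply L.restr_def by simp
      qed (auto simp: sum_fun_apply L.restr_def L.ltrans_def)
    qed
    also have "\<dots> \<in> span ?B" by (intro span_sum span_scale span_base) auto
    finally show "L.ltrans g (L.restr (\<lambda>p. rho (\<pi> p) i j)) \<in> span ?B" .
  qed
  have "inv\<^bsub>G \<times>\<times> G\<^esub> p = (inv (fst p), inv (snd p))" if "p \<in> carrier (G \<times>\<times> G)" for p
    using that inv_DirProd[OF is_group is_group] by (cases p) auto
  then show "prep (\<lambda>x y. rho x i j)" "prep (\<lambda>x y. rho y i j)"
    using aux[OF continuous_map_fst] aux[OF continuous_map_snd]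
    by (auto simp: prep_def case_prod_unfold mult_DirProd')
qed

text \<open>Since the representation is orthogonal, an inverse letter only transposes indices, so
  the coefficients of a word are polynomials in those of the two variables.\<close>

lemma prep_gword:
  assumes rep: "function_rep G T \<nu> V n b" and ij: "i < n" "j < n"
  shows "prep (\<lambda>x y. function_rep.rho G \<nu> b (gword x y w) i j)"
proof -
  interpret function_rep G T \<nu> V n b by (rule rep)
  show ?thesis
    using ij(1)
  proof (induction w arbitrary: i)
    case Nil
    then show ?case by (simp add: prep_const)
  next
    case (Cons l w)
    obtain c \<epsilon> where l: "l = (c, \<epsilon>)" by fastforce
    define z where "z x y = (if c then x else y)" for x y :: 'a
    have z: "z x y \<in> carrier G" if "x \<in> carrier G" "y \<in> carrier G" for x y using that by (simp add: z_def)
    have pz: "prep (\<lambda>x y. rho (z x y) i k)" if "i < n" "k < n" for i k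
      using prep_rho[OF rep that] by (cases c) (simp_all add: z_def)
    have "prep (\<lambda>x y. rho (gword x y (l # w)) i j) \<longleftrightarrow>
        prep (\<lambda>x y. \<Sum>k<n. (if \<epsilon> then rho (z x y) i k else rho (z x y) k i) * rho (gword x y w) k j)"
    proof (rule prep_cong)
      fix x y assume xy: "x \<in> carrier G" "y \<in> carrier G"
      let ?h = "if \<epsilon> then z x y else inv (z x y)"
      have "rho (gword x y (l # w)) i j = rho (?h \<otimes> gword x y w) i j" by (simp add: l z_def)
      also have "\<dots> = (\<Sum>k<n. rho ?h i k * rho (gword x y w) k j)"
        using z[OF xy] xy ij Cons.prems by (intro rho_mult) auto
      also have "\<dots> = (\<Sum>k<n. (if \<epsilon> then rho (z x y) i k else rho (z x y) k i) * rho (gword x y w) k j)"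
        using z[OF xy] Cons.prems by (intro sum.cong refl) (auto simp: rho_inv)
      finally show "rho (gword x y (l # w)) i j
          = (\<Sum>k<n. (if \<epsilon> then rho (z x y) i k else rho (z x y) k i) * rho (gword x y w) k j)" .
    qed
    moreover have "prep (\<lambda>x y. \<Sum>k<n. (if \<epsilon> then rho (z x y) i k else rho (z x y) k i) * rho (gword x y w) k j)"
      using Cons pz by (intro prep_sum prep_mult) (cases \<epsilon>; simp)+
    ultimately show ?case by simp
  qed
qed

lemma prep_gram_det:
  assumes rep: "function_rep G T \<nu> V n b"
  shows "prep (function_rep.gram_det G \<nu> n b)"
proof -
  interpret function_rep G T \<nu> V n b by (rule rep)
  have dev: "prep (\<lambda>x y. dev x i j)" "prep (\<lambda>x y. dev y i j)" if "i < n" "j < n" for i j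
    unfolding dev_def by (intro prep_diff prep_rho[OF rep that] prep_const)+
  have gram: "prep (\<lambda>x y. gram x y i j)" if "i < n" "j < n" for i j
    unfolding gram_def using that by (intro prep_sum prep_add prep_mult dev) auto
  \<comment> \<open>The Leibniz formula exhibits the determinant as a polynomial in the matrix
    coefficients.\<close>
  have "gram_det = (\<lambda>x y. \<Sum>p | p permutes {0..<n}. signof p * (\<Prod>i = 0..<n. gram x y i (p i)))"
  proof (intro ext)
    fix x y
    have "(\<Prod>i = 0..<n. Matrix.mat n n (\<lambda>(i, j). gram x y i j) $$ (i, p i)) = (\<Prod>i = 0..<n. gram x y i (p i))"
      if "p permutes {0..<n}" for p
      using permutes_in_image[OF that] by (intro prod.cong) auto
    then show "gram_det x y = (\<Sum>p | p permutes {0..<n}. signof p * (\<Prod>i = 0..<n. gram x y i (p i)))"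
      unfolding gram_det_def Determinant.det_def by (auto intro!: sum.cong)
  qed
  moreover have "prep (\<lambda>x y. \<Sum>p | p permutes {0..<n}. signof p * (\<Prod>i = 0..<n. gram x y i (p i)))"
    using permutes_in_image[of _ "{0..<n}"]
    by (intro prep_sum prep_mult prep_const prep_prod gram) auto
  ultimately show ?thesis by simp
qed

text \<open>The cover consists of the zero sets of the Gram determinants, one for each bump and each
  positive eigenvalue.\<close>

lemma nondense_null_cover:
  "\<exists>\<N>. countable \<N> \<and> (\<forall>N\<in>\<N>. closedin (prod_topology T T) N \<and> N \<in> null_sets \<mu>) \<and>
    (\<forall>a\<in>carrier G. \<forall>b\<in>carrier G. Abstract_Topology.closure_of T (generate G {a, b}) \<noteq> carrier G \<longrightarrow> (a, b) \<in> \<Union>\<N>)"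
proof -
  obtain \<Phi> where \<Phi>: "countable \<Phi>" "\<And>\<phi>. \<phi> \<in> \<Phi> \<Longrightarrow> convolution G T \<nu> \<phi>"
    "\<And>f. f \<in> C0 \<Longrightarrow> f \<noteq> 0 \<Longrightarrow> \<exists>\<phi>\<in>\<Phi>. convolution.conv G \<nu> \<phi> f \<noteq> 0"
    by (rule countable_bumps) (rule that; blast)
  \<comment> \<open>Null sets exist for every positive \<open>r\<close>; restricting to values with
    a nonzero eigenspace makes the index set countable.\<close>
  define E where "E \<phi> = {r. r > 0 \<and> (\<exists>f\<in>convolution.eigenspace G T \<nu> \<phi> r. f \<noteq> 0)}" for \<phi>
  have "\<exists>N. closedin (prod_topology T T) N \<and> N \<in> null_sets \<mu> \<and>
      (\<forall>a\<in>carrier G. \<forall>b\<in>carrier G. \<forall>f\<in>convolution.eigenspace G T \<nu> \<phi> r.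
        f \<noteq> 0 \<longrightarrow> ltrans a f = f \<longrightarrow> ltrans b f = f \<longrightarrow> (a, b) \<in> N)"
    if \<phi>: "\<phi> \<in> \<Phi>" and r: "r > 0" for \<phi> r
  proof -
    interpret c: convolution G T \<nu> \<phi> by (rule \<Phi>(2)[OF \<phi>])
    obtain n b where rep: "function_rep G T \<nu> (c.eigenspace r) n b"
      using c.eigenspace_function_rep[OF r conn_T] .
    interpret function_rep G T \<nu> "c.eigenspace r" n b by (rule rep)
    obtain x0 y0 where xy: "x0 \<in> carrier G" "y0 \<in> carrier G" "gram_det x0 y0 \<noteq> 0"
      using gram_det_nonzero c.eigenspace_no_fixed by blast
    let ?N = "{(x, y) \<in> carrier G \<times> carrier G. gram_det x y = 0}"
    have "closedin (prod_topology T T) ?N" "?N \<in> null_sets \<mu>"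
      using prep_zero_set[OF prep_gram_det[OF rep]] xy by auto
    moreover have "(a, b') \<in> ?N"
      if "a \<in> carrier G" "b' \<in> carrier G" "f \<in> c.eigenspace r" "f \<noteq> 0" "ltrans a f = f" "ltrans b' f = f" for a b' f
      using gram_det_zero[OF that] that by simp
    ultimately show ?thesis by blast
  qed
  then obtain N where N: "\<And>\<phi> r. \<phi> \<in> \<Phi> \<Longrightarrow> r > 0 \<Longrightarrow> closedin (prod_topology T T) (N \<phi> r) \<and> N \<phi> r \<in> null_sets \<mu>"
    "\<And>\<phi> r a b f. \<phi> \<in> \<Phi> \<Longrightarrow> r > 0 \<Longrightarrow> a \<in> carrier G \<Longrightarrow> b \<in> carrier G \<Longrightarrow> f \<in> convolution.eigenspace G T \<nu> \<phi> r \<Longrightarrow>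
      f \<noteq> 0 \<Longrightarrow> ltrans a f = f \<Longrightarrow> ltrans b f = f \<Longrightarrow> (a, b) \<in> N \<phi> r"
    by metis
  have "countable (E \<phi>)" if \<phi>: "\<phi> \<in> \<Phi>" for \<phi>
  proof -
    interpret c: convolution G T \<nu> \<phi> by (rule \<Phi>(2)[OF \<phi>])
    show ?thesis by (rule countable_subset[OF _ c.countable_eigenvalues]) (auto simp: E_def c.eigenspace_def)
  qed
  then have "countable ((\<lambda>(\<phi>, r). N \<phi> r) ` (SIGMA \<phi>:\<Phi>. E \<phi>))"
    by (intro countable_image countable_SIGMA \<Phi>(1))
  then show ?thesis
  proof (intro exI[of _ "(\<lambda>(\<phi>, r). N \<phi> r) ` (SIGMA \<phi>:\<Phi>. E \<phi>)"] conjI ballI impI)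
    show "closedin (prod_topology T T) A" "A \<in> null_sets \<mu>" if "A \<in> (\<lambda>(\<phi>, r). N \<phi> r) ` (SIGMA \<phi>:\<Phi>. E \<phi>)" for A
      using that N(1) by (auto simp: E_def)
    fix a b assume ab: "a \<in> carrier G" "b \<in> carrier G"
      and nd: "Abstract_Topology.closure_of T (generate G {a, b}) \<noteq> carrier G"
    obtain \<phi> r f where f: "\<phi> \<in> \<Phi>" "r > 0" "f \<in> convolution.eigenspace G T \<nu> \<phi> r" "f \<noteq> 0" "ltrans a f = f" "ltrans b f = f"
      by (rule eigenfunction_fixed[OF \<Phi>(2,3) ab nd])
    then have "(\<phi>, r) \<in> (SIGMA \<phi>:\<Phi>. E \<phi>)" by (auto simp: E_def)
    moreover have "(a, b) \<in> N \<phi> r" by (rule N(2)[OF f(1,2) ab f(3-6)])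
    ultimately show "(a, b) \<in> \<Union>((\<lambda>(\<phi>, r). N \<phi> r) ` (SIGMA \<phi>:\<Phi>. E \<phi>))" by force
  qed
qed

text \<open>A representation that moves a commutator has noncommuting image, so the word is not a
  law there. Some matrix entry of the word therefore differs from that of the identity at one pair,
  and the zeros of this difference form the set \<open>N\<close>.\<close>

lemma word_null_cover:
  assumes nc: "\<not> comm_group G" and w: "reduced_word w" "w \<noteq> []"
  shows "\<exists>N. closedin (prod_topology T T) N \<and> N \<in> null_sets \<mu> \<and>
    (\<forall>a\<in>carrier G. \<forall>b\<in>carrier G. gword a b w = \<one> \<longrightarrow> (a, b) \<in> N)"
proof -
  obtain g h where gh: "g \<in> carrier G" "h \<in> carrier G" "g \<otimes> h \<noteq> h \<otimes> g"
    using nc group_comm_groupI by blast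
  \<comment> \<open>A commutator in a form convenient for cancellation: if the images of
    \<open>g\<close> and \<open>h\<close> commute, then \<open>R c\<close> is the identity.\<close>
  define c where "c = (h \<otimes> g) \<otimes> inv (g \<otimes> h)"
  have c: "c \<in> carrier G" "c \<otimes> (g \<otimes> h) = h \<otimes> g" using gh by (auto simp: c_def m_assoc)
  have "c \<noteq> \<one>" using c gh by auto
  obtain \<Phi> where \<Phi>: "countable \<Phi>" "\<And>\<phi>. \<phi> \<in> \<Phi> \<Longrightarrow> convolution G T \<nu> \<phi>"
    "\<And>f. f \<in> C0 \<Longrightarrow> f \<noteq> 0 \<Longrightarrow> \<exists>\<phi>\<in>\<Phi>. convolution.conv G \<nu> \<phi> f \<noteq> 0"
    by (rule countable_bumps) (rule that; blast)
  obtain \<phi> r f where f: "\<phi> \<in> \<Phi>" "r > 0" "f \<in> convolution.eigenspace G T \<nu> \<phi> r" "ltrans c f \<noteq> f"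
    by (rule eigenfunction_moved[OF \<Phi>(2,3) c(1) \<open>c \<noteq> \<one>\<close>])
  interpret c: convolution G T \<nu> \<phi> by (rule \<Phi>(2)[OF f(1)])
  obtain n b where rep: "function_rep G T \<nu> (c.eigenspace r) n b"
    using c.eigenspace_function_rep[OF f(2) conn_T] .
  interpret function_rep G T \<nu> "c.eigenspace r" n b by (rule rep)
  have "R g * R h \<noteq> R h * R g"
  proof
    assume "R g * R h = R h * R g"
    then have eq: "R (g \<otimes> h) = R (h \<otimes> g)" using gh by (simp add: R_mult)
    have "R c * R (g \<otimes> h) = R (h \<otimes> g)" using R_mult[of c "g \<otimes> h"] c gh by simp
    then have "R c * R (g \<otimes> h) * R (inv (g \<otimes> h)) = R (g \<otimes> h) * R (inv (g \<otimes> h))" using eq by simp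
    moreover have inv: "R (g \<otimes> h) * R (inv (g \<otimes> h)) = Idm n"
      using R_mult[of "g \<otimes> h" "inv (g \<otimes> h)"] gh R_one by simp
    ultimately have "R c * Idm n = Idm n" unfolding mult.assoc inv by simp
    then have "R c = Idm n" by simp
    then have "vec_of (ltrans c f) = Idm n * vec_of f" using R_vec_of[OF c(1) f(3)] by simp
    also have "\<dots> = vec_of f" by (rule Idm_mult) (simp add: vec_of_def)
    finally show False using vec_of_inj[OF c.eigenspace_ltrans[OF c(1) f(3)] f(3)] f(4) by simp
  qed
  from nonabelian_rep_no_law[OF gh(1,2) this w]
  obtain x y where xy: "x \<in> carrier G" "y \<in> carrier G" "R (gword x y w) \<noteq> Idm n" by blast
  then obtain i j where ij: "i < n" "j < n" "rho (gword x y w) i j \<noteq> (if i = j then 1 else 0)"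
  proof -
    have "\<exists>i<n. \<exists>j<n. rho (gword x y w) i j \<noteq> (if i = j then 1 else 0)"
    proof (rule ccontr)
      assume "\<not> ?thesis"
      then have "R (gword x y w) = Idm n" by (intro fmat_eqI) (auto simp: R_def Idm_def)
      then show False using xy by simp
    qed
    then show thesis using that by blast
  qed
  let ?F = "\<lambda>x y. rho (gword x y w) i j - (if i = j then 1 else 0)"
  have F: "prep ?F" by (intro prep_diff prep_gword[OF rep] prep_const ij)
  show ?thesis
    by (intro exI conjI, rule prep_zero_set(1)[OF F], rule prep_zero_set(2)[OF F xy(1,2)]) (use ij rho_one in auto)
qed

text \<open>If the complement were meagre, the closures of its nowhere dense pieces together with
  the closed null sets would cover a nonempty compact Hausdorff space by countably many closed sets
  with empty interior.\<close>

lemma second_category_complement: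
  assumes \<N>: "countable \<N>" "\<And>N. N \<in> \<N> \<Longrightarrow> closedin (prod_topology T T) N \<and> N \<in> null_sets \<mu>"
  shows "second_category_in (prod_topology T T) (carrier G \<times> carrier G - \<Union>\<N>)"
  unfolding second_category_in_def first_category_in_def
proof (intro conjI notI)
  let ?X = "prod_topology T T"
  show "carrier G \<times> carrier G - \<Union>\<N> \<subseteq> topspace ?X" by (auto simp: topspace_eq)
  assume "\<exists>\<A>. countable \<A> \<and> (\<forall>A\<in>\<A>. nowhere_dense_in ?X A) \<and> carrier G \<times> carrier G - \<Union>\<N> = \<Union>\<A>"
  then obtain \<A> where A: "countable \<A>" "\<And>A. A \<in> \<A> \<Longrightarrow> nowhere_dense_in ?X A"
    "carrier G \<times> carrier G - \<Union>\<N> = \<Union>\<A>" by blast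
  let ?\<G> = "\<N> \<union> (\<lambda>A. Abstract_Topology.closure_of ?X A) ` \<A>"
  have "?X interior_of \<Union>?\<G> = {}"
  proof (rule Baire_category_alt)
    show "completely_metrizable_space ?X \<or> locally_compact_space ?X \<and> regular_space ?X"
      using compact_prod compact_imp_locally_compact_space compact_Hausdorff_imp_regular_space L.Hausdorff by blast
    show "countable ?\<G>" using \<N>(1) A(1) by simp
    fix S assume "S \<in> ?\<G>"
    then show "closedin ?X S \<and> ?X interior_of S = {}"
    proof
      assume S: "S \<in> \<N>"
      have "?X interior_of S = {}"
      proof (rule ccontr)
        assume "?X interior_of S \<noteq> {}"
        then have "0 < emeasure \<mu> (?X interior_of S)" by (intro L.open_positive) auto
        also have "\<dots> \<le> emeasure \<mu> S"
          using \<N>(2)[OF S] by (intro emeasure_mono interior_of_subset) auto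
        finally show False using \<N>(2)[OF S] by (auto simp: null_sets_def)
      qed
      then show ?thesis using \<N>(2)[OF S] by simp
    next
      assume "S \<in> (\<lambda>A. Abstract_Topology.closure_of ?X A) ` \<A>"
      then show ?thesis using A(2) by (auto simp: nowhere_dense_in_def)
    qed
  qed
  moreover have "topspace ?X \<subseteq> \<Union>?\<G>"
  proof
    fix p assume "p \<in> topspace ?X"
    then have "p \<in> \<Union>\<N> \<or> p \<in> \<Union>\<A>" using A(3) by (auto simp: topspace_eq)
    moreover have "A \<subseteq> Abstract_Topology.closure_of ?X A" if "A \<in> \<A>" for A
      using A(2)[OF that] by (intro closure_of_subset) (simp add: nowhere_dense_in_def)
    ultimately show "p \<in> \<Union>?\<G>" by blast
  qed
  then have "?X interior_of topspace ?X \<subseteq> ?X interior_of \<Union>?\<G>" by (rule interior_of_mono)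
  ultimately have "topspace ?X \<subseteq> {}" unfolding interior_of_topspace by (rule back_subst[where P = "\<lambda>S. topspace ?X \<subseteq> S", rotated])
  moreover have "(\<one>, \<one>) \<in> topspace ?X" by (simp add: topspace_eq)
  ultimately show False by blast
qed

lemma generic_pairs_dense_free:
  assumes nc: "\<not> comm_group G"
  shows "\<exists>\<O>. \<O> \<subseteq> carrier G \<times> carrier G \<and>
           second_category_in (prod_topology T T) \<O> \<and>
           full_measure \<mu> \<O> \<and>
           (\<forall>(a, b)\<in>\<O>.
              Abstract_Topology.closure_of T (generate G {a, b}) = carrier G \<and>
              free_group_of_rank (subgroup_generated G {a, b}) 2)"
proof -
  obtain \<D> where D: "countable \<D> \<and> (\<forall>N\<in>\<D>. closedin (prod_topology T T) N \<and> N \<in> null_sets \<mu>) \<and>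
    (\<forall>a\<in>carrier G. \<forall>b\<in>carrier G. Abstract_Topology.closure_of T (generate G {a, b}) \<noteq> carrier G \<longrightarrow> (a, b) \<in> \<Union>\<D>)"
    using nondense_null_cover ..
  \<comment> \<open>Words over truth values form a countable type, so one null set for each word is
    admissible.\<close>
  define W where "W = {w :: (bool \<times> bool) list. reduced_word w \<and> w \<noteq> []}"
  have "\<forall>w\<in>W. \<exists>N. closedin (prod_topology T T) N \<and> N \<in> null_sets \<mu> \<and>
      (\<forall>a\<in>carrier G. \<forall>b\<in>carrier G. gword a b w = \<one> \<longrightarrow> (a, b) \<in> N)"
    by (intro ballI word_null_cover nc) (simp_all add: W_def)
  from bchoice[OF this] obtain N where N: "\<forall>w\<in>W. closedin (prod_topology T T) (N w) \<and> N w \<in> null_sets \<mu> \<and>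
      (\<forall>a\<in>carrier G. \<forall>b\<in>carrier G. gword a b w = \<one> \<longrightarrow> (a, b) \<in> N w)" ..
  define \<N> where "\<N> = \<D> \<union> N ` W"
  have c: "countable \<N>" unfolding \<N>_def using D by (intro countable_Un countable_image) auto
  have \<N>: "closedin (prod_topology T T) A \<and> A \<in> null_sets \<mu>" if "A \<in> \<N>" for A
    using that D N by (auto simp: \<N>_def)
  show ?thesis
  proof (intro exI conjI)
    show "second_category_in (prod_topology T T) (carrier G \<times> carrier G - \<Union>\<N>)"
      by (rule second_category_complement[OF c \<N>])
    have "\<Union>\<N> \<in> null_sets \<mu>"
      using null_sets_UN'[OF c, of "\<lambda>A. A" \<mu>] \<N> by simp
    moreover have "\<Union>\<N> \<subseteq> carrier G \<times> carrier G"
      using sets.sets_into_space[OF null_setsD2[OF calculation]] by (simp add: space_\<mu>)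
    then have "space \<mu> - (carrier G \<times> carrier G - \<Union>\<N>) = \<Union>\<N>"
      by (simp add: space_\<mu> double_diff)
    ultimately show "full_measure \<mu> (carrier G \<times> carrier G - \<Union>\<N>)"
      unfolding full_measure_def using space_\<mu> null_sets_completionI by auto
    show "\<forall>(a, b)\<in>carrier G \<times> carrier G - \<Union>\<N>.
        Abstract_Topology.closure_of T (generate G {a, b}) = carrier G \<and>
        free_group_of_rank (subgroup_generated G {a, b}) 2"
    proof (rule ballI, clarify, rule conjI)
      fix a b assume ab: "a \<in> carrier G" "b \<in> carrier G" and out: "(a, b) \<notin> \<Union>\<N>"
      show "Abstract_Topology.closure_of T (generate G {a, b}) = carrier G"
        using D ab out unfolding \<N>_def by blast
      show "free_group_of_rank (subgroup_generated G {a, b}) 2"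
        by (rule free_group_of_rank_2[OF ab]) (use N ab out in \<open>auto simp: \<N>_def W_def\<close>)
    qed
  qed auto
qed

end

theorem proposition8p2:
  fixes G :: "('a, 'b) monoid_scheme" and T :: "'a topology" and \<mu> :: "('a \<times> 'a) measure"
  assumes "topological_group G T"
    and "second_countable T" and "connected_space T" and "compact_space T"
    and "\<not> comm_group G"
    and "haar_measure (G \<times>\<times> G) (prod_topology T T) \<mu>"
  shows "\<exists>\<O>. \<O> \<subseteq> carrier G \<times> carrier G \<and>
           second_category_in (prod_topology T T) \<O> \<and>
           full_measure \<mu> \<O> \<and>
           (\<forall>(a, b)\<in>\<O>.
              Abstract_Topology.closure_of T (generate G {a, b}) = carrier G \<and>
              free_group_of_rank (subgroup_generated G {a, b}) 2)"
proof -
  interpret H: haar_pair G T \<mu> by (intro haar_pair.intro haar_pair_axioms.intro assms)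
  show ?thesis by (rule H.generic_pairs_dense_free[OF assms(5)])
qed

end
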